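(* For every hereditary graph property $\mathcal{P}$ there is a function $t_{\mathcal{P}}:(0,1)^2\to\mathbb{N}$ such that for all $\varepsilon,\delta\in(0,1)$, the property $\mathcal{P}$ is $\varepsilon$-testable in the VDF model with one-sided error and sample complexity $t_{\mathcal{P}}(\varepsilon,\delta)$, under the promise that inputs $(G,\mathcal{D})$ always satisfy $\min_{v\in V(G)}\mathcal{D}(v)\ge\delta/|V(G)|$.
   Context: All graphs are finite, simple, undirected, with nonempty vertex set. A graph property is a family of graphs closed under isomorphism; it is hereditary if it is closed under removal of vertices. A vertex-weighted graph is a pair $(G,\mathcal{D})$ with $G$ a graph and $\mathcal{D}$ a probability distribution on $V(G)$. For graphs $G_1,G_2$ on the same vertex set $V$ and a distribution $\mathcal{D}$ on $V$, their distance with respect to $\mathcal{D}$ is $\sum_{\{x,y\}\in E(G_1)\triangle E(G_2)}\mathcal{D}(x)\mathcal{D}(y)$. $(G,\mathcal{D})$ is $\varepsilon$-far from $\mathcal{P}$ if for every $G'\in\mathcal{P}$ with $V(G')=V(G)$ the distance between $G$ and $G'$ with respect to $\mathcal{D}$ is at least $\varepsilon$ (vacuously true if no such $G'$ exists). VDF model. The input is $(G,\mathcal{D})$, with $\mathcal{D}$ unknown to the algorithm. A (randomized) algorithm accesses the input only by drawing independent random vertices distributed according to $\mathcal{D}$ (it can tell whether two samples are the same vertex, but vertex names carry no other information) and by edge queries "is $\{u,v\}$ an edge of $G$?" for sampled vertices $u,v$; it is not given $|V(G)|$. There is no restriction on computation. $\mathcal{P}$ is $\varepsilon$-testable with one-sided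 error and sample complexity $t$ under a promise on inputs if there is such an algorithm (which may depend on $\varepsilon$ and on the parameters of the promise), drawing at most $t$ vertices, which for every $(G,\mathcal{D})$ fulfilling the promise accepts with probability $1$ if $G\in\mathcal{P}$ and rejects with probability at least $2/3$ if $(G,\mathcal{D})$ is $\varepsilon$-far from $\mathcal{P}$. *)

theory Defs
  imports "HOL-Probability.Probability"
begin

datatype 'a graph = Graph (verts: "'a set") (edges: "'a set set")

definition simple_graph :: "'a graph \<Rightarrow> bool" where
  "simple_graph G \<longleftrightarrow>
     finite (verts G) \<and> verts G \<noteq> {} \<and> (\<forall>e\<in>edges G. e \<subseteq> verts G \<and> card e = 2)"

definition isomorphic :: "'a graph \<Rightarrow> 'b graph \<Rightarrow> bool" where
  "isomorphic G H \<longleftrightarrow>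
     (\<exists>f. bij_betw f (verts G) (verts H) \<and>
          (\<forall>x\<in>verts G. \<forall>y\<in>verts G. {x, y} \<in> edges G \<longleftrightarrow> {f x, f y} \<in> edges H))"

definition graph_property :: "'a graph set \<Rightarrow> bool" where
  "graph_property P \<longleftrightarrow>
     (\<forall>G\<in>P. simple_graph G) \<and>
     (\<forall>G\<in>P. \<forall>H. simple_graph H \<and> isomorphic G H \<longrightarrow> H \<in> P)"

definition remove_vertex :: "'a \<Rightarrow> 'a graph \<Rightarrow> 'a graph" where
  "remove_vertex v G = Graph (verts G - {v}) {e \<in> edges G. v \<notin> e}"

text \<open>Graphs have a nonempty vertex set, so the last vertex is never removed.\<close>

definition hereditary :: "'a graph set \<Rightarrow> bool" where
  "hereditary P \<longleftrightarrow>
     (\<forall>G\<in>P. \<forall>v\<in>verts G. verts G \<noteq> {v} \<longrightarrow> remove_vertex v G \<in> P)"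

definition weighted_graph :: "'a graph \<Rightarrow> 'a pmf \<Rightarrow> bool" where
  "weighted_graph G D \<longleftrightarrow> simple_graph G \<and> set_pmf D \<subseteq> verts G"

text \<open>For an edge \<open>e = {x, y}\<close> the product below is \<open>D(x) D(y)\<close>.\<close>

definition graph_distance :: "'a pmf \<Rightarrow> 'a graph \<Rightarrow> 'a graph \<Rightarrow> real" where
  "graph_distance D G H =
     (\<Sum>e\<in>(edges G - edges H) \<union> (edges H - edges G). \<Prod>x\<in>e. pmf D x)"

definition far_from :: "real \<Rightarrow> 'a graph set \<Rightarrow> 'a graph \<Rightarrow> 'a pmf \<Rightarrow> bool" where
  "far_from \<epsilon> P G D \<longleftrightarrow> (\<forall>H\<in>P. verts H = verts G \<longrightarrow> \<epsilon> \<le> graph_distance D G H)"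

text \<open>
  A tester is an adaptive, computationally unrestricted decision tree. Sampled vertices are
  referred to only by the position of their draw, so their names are invisible. After
  \<open>Draw k\<close> the tester learns only the position of the first draw that produced the
  new vertex; this is the position of the current draw exactly when the vertex has not been seen
  before. \<open>Query i j k\<close> asks whether the vertices drawn at positions \<open>i\<close> and \<open>j\<close> are
  adjacent. \<open>Randomize p\<close> provides the internal randomness. The tree does not depend on
  the input, so in particular the number of vertices is not available to the tester.
\<close>

datatype tester =
    Decide bool
  | Randomize "tester pmf"
  | Draw "nat \<Rightarrow> tester"
  | Query nat nat "bool \<Rightarrow> tester"

text \<open>The list argument contains the vertices drawn so far, in order. A query to a position
  that has not been drawn yet is answered negatively.\<close>

primrec run :: "'a graph \<Rightarrow> 'a pmf \<Rightarrow> tester \<Rightarrow> 'a list \<Rightarrow> bool pmf" where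
  "run G D (Decide b) = (\<lambda>xs. return_pmf b)"
| "run G D (Randomize p) = (\<lambda>xs. bind_pmf (map_pmf (run G D) p) (\<lambda>r. r xs))"
| "run G D (Draw k) =
     (\<lambda>xs. bind_pmf D (\<lambda>v. run G D (k (LEAST i. (xs @ [v]) ! i = v)) (xs @ [v])))"
| "run G D (Query i j k) =
     (\<lambda>xs. run G D (k (i < length xs \<and> j < length xs \<and> {xs ! i, xs ! j} \<in> edges G)) xs)"

primrec draws_at_most :: "tester \<Rightarrow> nat \<Rightarrow> bool" where
  "draws_at_most (Decide b) = (\<lambda>t. True)"
| "draws_at_most (Randomize p) = (\<lambda>t. \<forall>d\<in>set_pmf (map_pmf draws_at_most p). d t)"
| "draws_at_most (Draw k) = (\<lambda>t. t > 0 \<and> (\<forall>i. draws_at_most (k i) (t - 1)))"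
| "draws_at_most (Query i j k) = (\<lambda>t. \<forall>b. draws_at_most (k b) t)"

definition vdf_testable ::
  "real \<Rightarrow> 'a graph set \<Rightarrow> ('a graph \<Rightarrow> 'a pmf \<Rightarrow> bool) \<Rightarrow> nat \<Rightarrow> bool" where
  "vdf_testable \<epsilon> P promise t \<longleftrightarrow>
     (\<exists>A. draws_at_most A t \<and>
          (\<forall>G D. weighted_graph G D \<and> promise G D \<longrightarrow>
             (G \<in> P \<longrightarrow> pmf (run G D A []) True = 1) \<and>
             (far_from \<epsilon> P G D \<longrightarrow> pmf (run G D A []) False \<ge> 2 / 3)))"

end

theory Submission
  imports Defs "HOL-Library.Diagonal_Subsequence"
begin

text \<open>
  The tester accepts iff the sampled vertices induce a member of \<open>P\<close>. If no sample size worked,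
  there would be \<open>\<epsilon>\<close>-far inputs \<open>(G_s, D_s)\<close> whose random induced subgraphs of any fixed size
  lie in \<open>P\<close> with probability tending to 1; then the number of vertices tends to infinity. Along a
  subsequence, boundedly many heavy vertices span a constant graph, and the remaining weight lies,
  up to \<open>\<epsilon> / 8\<close>, on vertices of vanishing weight. By the promise the latter carry at least half of
  \<open>\<delta>\<close>, so they have a limit object: types of vertices (adjacency to the heavy vertices followed by
  greedily chosen Frieze--Kannan sets) become nested intervals of \<open>[0,1)\<close>, and edge densities
  between types converge to a kernel \<open>W\<close>, which the counting lemma connects with subgraph densities.

  The repair (following Lovasz and Szegedy): send every light vertex to a random point of the
  interval of its type, insert edges where \<open>W = 1\<close>, delete them where \<open>W = 0\<close>, and keep the
  adjacency elsewhere. The new graph occurs with positive density in the limit for almost all choices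
  of the points, hence belongs to \<open>P\<close>, and the expected cost is small because step kernels converge
  to \<open>W\<close> in \<open>L\<^sup>1\<close>.
\<close>

section \<open>The induced-subgraph tester\<close>

text \<open>The overview leaves open how one graph of the sequence is repaired by means of the
  others. Fix one index: the repaired graph is a pattern of a fixed size, and its density is read
  off from the later graphs of the sequence. Were it outside \<open>P\<close>, a positive limit
  density would make samples of that size violate \<open>P\<close> with probability bounded away
  from 0. This is where weights matter. A heavy vertex must be hit exactly, with probability at
  least \<theta> per draw; \<open>k\<close> light draws keep a factor of at least (\<delta> / 2)^k;
  and since light weights tend to 0, collisions disappear in the limit, so that a pattern of
  positive density occurs on distinct vertices. Heavy vertices cannot be replaced by random points;
  types therefore start with the adjacency to them. Where 0 < W < 1, both adjacencies are compatible
  with positive density, which is why nothing has to be changed there. The budget is \<epsilon> / 8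
  for the weights in between, \<epsilon> / 4 for types of limit frequency 0 and \<epsilon> / 4 for
  changes forced by the kernel.\<close>

definition induced :: "'a graph \<Rightarrow> 'a set \<Rightarrow> 'a graph" where
  "induced G S = Graph S {e \<in> edges G. e \<subseteq> S}"

lemma verts_induced [simp]: "verts (induced G S) = S"
  and edges_induced [simp]: "edges (induced G S) = {e \<in> edges G. e \<subseteq> S}"
  by (simp_all add: induced_def)

lemma simple_graph_induced:
  assumes "simple_graph G" "S \<subseteq> verts G" "S \<noteq> {}"
  shows "simple_graph (induced G S)"
  using assms unfolding simple_graph_def by (auto intro: finite_subset)

lemma induced_verts: "simple_graph G \<Longrightarrow> induced G (verts G) = G"
  by (cases G) (auto simp: induced_def simple_graph_def)

text \<open>Heredity deletes one vertex at a time and never the last one, so the induction runs over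
  the deleted set \<open>T\<close>, and \<open>T \<noteq> verts G\<close> guarantees that a vertex
  survives each deletion.\<close>

lemma induced_mem_hereditary:
  assumes "graph_property P" "hereditary P" "G \<in> P" "S \<subseteq> verts G" "S \<noteq> {}"
  shows "induced G S \<in> P"
proof -
  have sG: "simple_graph G" using assms(1,3) by (auto simp: graph_property_def)
  have compl: "\<lbrakk>finite T; T \<subseteq> verts G; T \<noteq> verts G\<rbrakk> \<Longrightarrow> induced G (verts G - T) \<in> P" for T
  proof (induction T rule: finite_induct)
    case empty
    then show ?case using assms(3) sG by (simp add: induced_verts)
  next
    case (insert v T)
    have *: "induced G (verts G - T) \<in> P" using insert by auto
    have "verts G - T \<noteq> {v}" "v \<in> verts G - T" using insert.hyps insert.prems by auto
    then have "remove_vertex v (induced G (verts G - T)) \<in> P"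
      using assms(2) * unfolding hereditary_def by simp
    moreover have "remove_vertex v (induced G (verts G - T)) = induced G (verts G - insert v T)"
      unfolding remove_vertex_def induced_def by auto
    ultimately show ?case by simp
  qed
  have "verts G - S \<noteq> verts G" using assms(4,5) by blast
  then show ?thesis
    using compl[of "verts G - S"] assms(4,5) sG by (simp add: simple_graph_def double_diff)
qed

lemma graph_property_iso:
  assumes "graph_property P" "G \<in> P" "simple_graph H"
    and "bij_betw g (verts G) (verts H)"
    and "\<And>x y. x \<in> verts G \<Longrightarrow> y \<in> verts G \<Longrightarrow> {x, y} \<in> edges G \<longleftrightarrow> {g x, g y} \<in> edges H"
  shows "H \<in> P"
  using assms unfolding graph_property_def isomorphic_def by blast

section \<open>Testers in continuation form and the answers they receive\<close>

primrec draws :: "nat \<Rightarrow> (nat list \<Rightarrow> tester) \<Rightarrow> tester" where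
  "draws 0 c = c []"
| "draws (Suc n) c = Draw (\<lambda>k. draws n (\<lambda>ks. c (k # ks)))"

primrec queries :: "(nat \<times> nat) list \<Rightarrow> (bool list \<Rightarrow> tester) \<Rightarrow> tester" where
  "queries [] c = c []"
| "queries (p # ps) c = Query (fst p) (snd p) (\<lambda>b. queries ps (\<lambda>bs. c (b # bs)))"

text \<open>The answers to drawing \<open>ys\<close> after \<open>xs\<close>, with the same
  \<open>LEAST\<close> term as in \<open>run\<close>.\<close>

primrec firsts :: "'a list \<Rightarrow> 'a list \<Rightarrow> nat list" where
  "firsts xs [] = []"
| "firsts xs (y # ys) = (LEAST i. (xs @ [y]) ! i = y) # firsts (xs @ [y]) ys"

definition adjacent_at :: "'a graph \<Rightarrow> 'a list \<Rightarrow> nat \<times> nat \<Rightarrow> bool" where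
  "adjacent_at G xs p \<longleftrightarrow>
     fst p < length xs \<and> snd p < length xs \<and> {xs ! fst p, xs ! snd p} \<in> edges G"

definition all_pairs :: "nat \<Rightarrow> (nat \<times> nat) list" where
  "all_pairs s = List.product [0..<s] [0..<s]"

definition observation :: "'a graph \<Rightarrow> nat \<Rightarrow> 'a list \<Rightarrow> nat list \<times> bool list" where
  "observation G s xs = (firsts [] xs, map (adjacent_at G xs) (all_pairs s))"

text \<open>A leaf of the decision tree knows only answers, not the sampled graph. It therefore
  accepts if some member of \<open>P\<close> gives the same answers on a list that exhausts its
  vertices; by isomorphism invariance it does not matter which member and which names.\<close>

definition induced_tester :: "'a graph set \<Rightarrow> nat \<Rightarrow> tester" where
  "induced_tester P s = draws s (\<lambda>ks. queries (all_pairs s) (\<lambda>bs.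
     Decide (\<exists>H\<in>P. \<exists>ys. length ys = s \<and> set ys = verts H \<and> observation H s ys = (ks, bs))))"

lemma run_draws:
  "run G D (draws n c) xs = bind_pmf (replicate_pmf n D) (\<lambda>ys. run G D (c (firsts xs ys)) (xs @ ys))"
  by (induction n arbitrary: c xs) (simp_all add: bind_return_pmf bind_assoc_pmf)

lemma run_queries:
  "run G D (queries ps c) xs = run G D (c (map (adjacent_at G xs) ps)) xs"
  by (induction ps arbitrary: c) (simp_all add: adjacent_at_def)

lemma draws_at_most_draws: "(\<And>ks. draws_at_most (c ks) 0) \<Longrightarrow> draws_at_most (draws n c) n"
  by (induction n arbitrary: c) simp_all

lemma draws_at_most_queries: "(\<And>bs. draws_at_most (c bs) t) \<Longrightarrow> draws_at_most (queries ps c) t"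
  by (induction ps arbitrary: c) simp_all

lemma draws_at_most_induced_tester: "draws_at_most (induced_tester P s) s"
  unfolding induced_tester_def by (intro draws_at_most_draws draws_at_most_queries) simp

lemma length_firsts [simp]: "length (firsts zs ys) = length ys"
  by (induction ys arbitrary: zs) auto

lemma firsts_nth:
  "i < length ys \<Longrightarrow> firsts zs ys ! i = (LEAST t. (zs @ take (Suc i) ys) ! t = ys ! i)"
proof (induction ys arbitrary: zs i)
  case (Cons y ys)
  then show ?case by (cases i) auto
qed simp

text \<open>The vertex drawn at position \<open>i\<close> occurs at \<open>i\<close>, so its least
  position lies within the prefix of length \<open>Suc i\<close> and does not depend on later
  draws.\<close>

lemma firsts_Nil_nth:
  assumes "i < length ys"
  shows "firsts [] ys ! i = (LEAST t. ys ! t = ys ! i)"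
proof -
  have "(LEAST t. take (Suc i) ys ! t = ys ! i) = (LEAST t. ys ! t = ys ! i)" (is "?a = ?b")
  proof -
    have b: "ys ! ?b = ys ! i" "?b \<le> i"
      by (rule LeastI[of _ i], simp, rule Least_le, simp)
    have a: "take (Suc i) ys ! ?a = ys ! i" "?a \<le> i"
      by (rule LeastI[of _ i], simp, rule Least_le, simp)
    have "?a \<le> ?b" using b by (intro Least_le) simp
    moreover have "?b \<le> ?a" using a by (intro Least_le) simp
    ultimately show ?thesis by simp
  qed
  then show ?thesis using assms by (simp add: firsts_nth)
qed

lemma nth_firsts:
  assumes "i < length ys"
  shows "firsts [] ys ! i \<le> i" "ys ! (firsts [] ys ! i) = ys ! i"
  unfolding firsts_Nil_nth[OF assms]
  by (rule Least_le, simp, rule LeastI[of _ i], simp)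

lemma nth_eq_iff_firsts:
  assumes "i < length ys" "j < length ys"
  shows "ys ! i = ys ! j \<longleftrightarrow> firsts [] ys ! i = firsts [] ys ! j"
proof
  assume "ys ! i = ys ! j"
  then show "firsts [] ys ! i = firsts [] ys ! j" using assms by (simp add: firsts_Nil_nth)
next
  assume eq: "firsts [] ys ! i = firsts [] ys ! j"
  have "ys ! i = ys ! (firsts [] ys ! i)" by (rule nth_firsts(2)[OF assms(1), symmetric])
  also have "\<dots> = ys ! j" unfolding eq by (rule nth_firsts(2)[OF assms(2)])
  finally show "ys ! i = ys ! j" .
qed

lemma observation_eqD:
  assumes "observation G s xs = observation H s ys" "length xs = s" "length ys = s"
  shows "\<And>i j. i < s \<Longrightarrow> j < s \<Longrightarrow> xs ! i = xs ! j \<longleftrightarrow> ys ! i = ys ! j"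
    and "\<And>i j. i < s \<Longrightarrow> j < s \<Longrightarrow> {xs ! i, xs ! j} \<in> edges G \<longleftrightarrow> {ys ! i, ys ! j} \<in> edges H"
proof -
  fix i j assume ij: "i < s" "j < s"
  show "xs ! i = xs ! j \<longleftrightarrow> ys ! i = ys ! j"
    using nth_eq_iff_firsts[of i xs j] nth_eq_iff_firsts[of i ys j] assms ij
    by (simp add: observation_def)
  have "(i, j) \<in> set (all_pairs s)" using ij by (simp add: all_pairs_def)
  then have "adjacent_at G xs (i, j) = adjacent_at H ys (i, j)"
    using assms(1) by (simp add: observation_def)
  then show "{xs ! i, xs ! j} \<in> edges G \<longleftrightarrow> {ys ! i, ys ! j} \<in> edges H"
    using ij assms by (simp add: adjacent_at_def)
qed

text \<open>From right to left the induced subgraph is itself the witness. From left to right,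
  sending the vertex at position \<open>i\<close> of \<open>ys\<close> to the one at position
  \<open>i\<close> of \<open>xs\<close> is well defined and injective because both lists have the
  same repetitions, and it preserves adjacency because all queries agree.\<close>

lemma observed_iff_induced:
  assumes "graph_property P" "simple_graph G" "set xs \<subseteq> verts G" "length xs = s" "s > 0"
  shows "(\<exists>H\<in>P. \<exists>ys. length ys = s \<and> set ys = verts H \<and> observation H s ys = observation G s xs)
     \<longleftrightarrow> induced G (set xs) \<in> P" (is "?L \<longleftrightarrow> ?R")
proof
  assume ?R
  have "adjacent_at (induced G (set xs)) xs = adjacent_at G xs"
    by (auto simp: adjacent_at_def fun_eq_iff)
  then have "observation (induced G (set xs)) s xs = observation G s xs"
    by (simp add: observation_def)
  then show ?L using \<open>?R\<close> assms(4) by (intro bexI[of _ "induced G (set xs)"] exI[of _ xs]) auto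
next
  assume ?L
  then obtain H ys where H: "H \<in> P" "length ys = s" "set ys = verts H"
      "observation H s ys = observation G s xs" by blast
  note eq = observation_eqD[OF H(4) H(2) assms(4)]
  define idx where "idx v = (SOME i. i < s \<and> ys ! i = v)" for v
  have idx: "idx v < s \<and> ys ! idx v = v" if "v \<in> verts H" for v
  proof -
    have "v \<in> set ys" using that H(3) by simp
    then have "\<exists>i. i < s \<and> ys ! i = v" using H(2) by (auto simp: in_set_conv_nth)
    then show ?thesis unfolding idx_def by (rule someI_ex)
  qed
  define g where "g v = xs ! idx v" for v
  have gy: "g (ys ! i) = xs ! i" if "i < s" for i
  proof -
    have "ys ! i \<in> verts H" using that H(2,3) nth_mem by blast
    then show ?thesis using idx[of "ys ! i"] eq(1)[of "idx (ys ! i)" i] that unfolding g_def by simp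
  qed
  have sne: "set xs \<noteq> {}" using assms by auto
  have inj: "inj_on g (verts H)"
  proof (rule inj_onI)
    fix x y assume "x \<in> verts H" "y \<in> verts H" "g x = g y"
    then show "x = y" using idx[of x] idx[of y] eq(1)[of "idx x" "idx y"] by (simp add: g_def)
  qed
  have im: "g ` verts H = set xs"
  proof -
    have "g ` verts H = (\<lambda>i. g (ys ! i)) ` {..<s}"
      using H(2) unfolding H(3)[symmetric] by (auto simp: set_conv_nth)
    also have "\<dots> = set xs" using gy assms(4) by (auto simp: set_conv_nth)
    finally show ?thesis .
  qed
  show ?R
  proof (rule graph_property_iso[OF assms(1) H(1)])
    show "simple_graph (induced G (set xs))"
      using assms sne by (intro simple_graph_induced) auto
    show "bij_betw g (verts H) (verts (induced G (set xs)))"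
      using inj im by (simp add: bij_betw_def)
    fix x y assume xy: "x \<in> verts H" "y \<in> verts H"
    have "{x, y} \<in> edges H \<longleftrightarrow> {g x, g y} \<in> edges G"
      using eq(2)[of "idx x" "idx y"] idx[OF xy(1)] idx[OF xy(2)] unfolding g_def by simp
    then show "{x, y} \<in> edges H \<longleftrightarrow> {g x, g y} \<in> edges (induced G (set xs))"
      using im xy by auto
  qed
qed

lemma run_induced_tester:
  assumes "graph_property P" "weighted_graph G D" "s > 0"
  shows "run G D (induced_tester P s) [] =
     map_pmf (\<lambda>xs. induced G (set xs) \<in> P) (replicate_pmf s D)"
proof -
  have "run G D (induced_tester P s) [] = bind_pmf (replicate_pmf s D) (\<lambda>xs. return_pmf
      (\<exists>H\<in>P. \<exists>ys. length ys = s \<and> set ys = verts H \<and> observation H s ys = observation G s xs))"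
    unfolding induced_tester_def run_draws run_queries by (simp add: observation_def)
  also have "\<dots> = bind_pmf (replicate_pmf s D) (\<lambda>xs. return_pmf (induced G (set xs) \<in> P))"
  proof (rule bind_pmf_cong[OF refl])
    fix xs assume "xs \<in> set_pmf (replicate_pmf s D)"
    then have "length xs = s" "set xs \<subseteq> verts G"
      using assms(2) by (auto simp: set_replicate_pmf weighted_graph_def)
    then show "return_pmf (\<exists>H\<in>P. \<exists>ys. length ys = s \<and> set ys = verts H \<and>
        observation H s ys = observation G s xs) = return_pmf (induced G (set xs) \<in> P)"
      using assms observed_iff_induced[of P G xs s] by (simp add: weighted_graph_def)
  qed
  finally show ?thesis by (simp add: map_pmf_def)
qed

section \<open>Violation probabilities and independent blocks of a sample\<close>

definition violation :: "'a graph set \<Rightarrow> 'a graph \<Rightarrow> 'a pmf \<Rightarrow> nat \<Rightarrow> real" where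
  "violation P G D k = measure (replicate_pmf k D) {xs. induced G (set xs) \<notin> P}"

text \<open>One-sidedness is free: heredity puts every induced subgraph of a member of
  \<open>P\<close> into \<open>P\<close>. Only the rejection probability on far inputs remains to be
  supplied.\<close>

lemma vdf_testableI:
  assumes "graph_property P" "hereditary P" "s > 0"
    and "\<And>G D. weighted_graph G D \<Longrightarrow> promise G D \<Longrightarrow> far_from \<epsilon> P G D \<Longrightarrow>
           violation P G D s \<ge> 2 / 3"
  shows "vdf_testable \<epsilon> P promise s"
  unfolding vdf_testable_def
proof (intro exI[of _ "induced_tester P s"] conjI allI impI draws_at_most_induced_tester)
  fix G D assume *: "weighted_graph G D \<and> promise G D"
  note run = run_induced_tester[OF assms(1) conjunct1[OF *] assms(3)]
  show "pmf (run G D (induced_tester P s) []) True = 1" if "G \<in> P"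
  proof -
    have "induced G (set xs) \<in> P" if "xs \<in> set_pmf (replicate_pmf s D)" for xs
      using that * assms \<open>G \<in> P\<close>
      by (intro induced_mem_hereditary) (auto simp: set_replicate_pmf weighted_graph_def)
    then have "AE xs in replicate_pmf s D. induced G (set xs) \<in> P"
      by (simp add: AE_measure_pmf_iff)
    then have "measure (replicate_pmf s D) {xs. induced G (set xs) \<in> P} = 1"
      by (simp add: measure_pmf.prob_eq_1)
    then show ?thesis by (simp add: run pmf_map vimage_def)
  qed
  show "pmf (run G D (induced_tester P s) []) False \<ge> 2 / 3" if "far_from \<epsilon> P G D"
    using assms(4)[of G D] * that by (simp add: run pmf_map vimage_def violation_def)
qed

lemma measure_pair_pmf_Times:
  "measure (pair_pmf p q) (A \<times> B) = measure p A * measure q B"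
proof -
  have "emeasure (pair_pmf p q) (A \<times> B) = (\<integral>\<^sup>+z. indicator (A \<times> B) z \<partial>pair_pmf p q)"
    by simp
  also have "\<dots> = (\<integral>\<^sup>+x. \<integral>\<^sup>+y. indicator A x * indicator B y \<partial>q \<partial>p)"
    unfolding nn_integral_pair_pmf' by (simp add: indicator_times)
  also have "\<dots> = emeasure p A * emeasure q B"
    by (simp add: nn_integral_cmult nn_integral_multc)
  finally show ?thesis by (simp add: measure_def enn2real_mult)
qed

text \<open>A sample of \<open>k * q + r\<close> vertices contains \<open>q\<close> independent
  blocks of \<open>k\<close> draws, and by heredity the whole sample induces a member of
  \<open>P\<close> only if every block does. The induction splits off one block.\<close>

lemma violation_block:
  assumes "graph_property P" "hereditary P" "weighted_graph G D" "k > 0"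
  shows "1 - violation P G D (k * q + r) \<le> (1 - violation P G D k) ^ q"
proof (induction q)
  case 0
  show ?case by (simp add: violation_def)
next
  case (Suc q)
  define Ok where "Ok n = {xs. length xs = n \<and> set xs \<subseteq> verts G \<and> induced G (set xs) \<in> P}" for n
  have Ok: "1 - violation P G D n = measure (replicate_pmf n D) (Ok n)" for n
  proof -
    have "1 - violation P G D n = measure (replicate_pmf n D) {xs. induced G (set xs) \<in> P}"
      unfolding violation_def
      using measure_pmf.prob_compl[of "{xs. induced G (set xs) \<notin> P}" "replicate_pmf n D"]
      by (simp add: set_diff_eq)
    also have "\<dots> = measure (replicate_pmf n D) (Ok n)"
      using assms(3) by (intro measure_pmf.finite_measure_eq_AE)
        (auto simp: AE_measure_pmf_iff set_replicate_pmf Ok_def weighted_graph_def)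
    finally show ?thesis .
  qed
  let ?m = "k * q + r"
  have split: "k * Suc q + r = k + ?m" by simp
  have eq: "replicate_pmf (k + ?m) D =
      map_pmf (\<lambda>(xs, ys). xs @ ys) (pair_pmf (replicate_pmf k D) (replicate_pmf ?m D))"
    unfolding replicate_pmf_distrib pair_pmf_def
    by (simp add: map_pmf_def bind_assoc_pmf bind_return_pmf)
  have "measure (replicate_pmf (k + ?m) D) (Ok (k + ?m)) =
      measure (pair_pmf (replicate_pmf k D) (replicate_pmf ?m D)) {(xs, ys). xs @ ys \<in> Ok (k + ?m)}"
    unfolding eq by (simp add: vimage_def case_prod_unfold)
  \<comment> \<open>The remaining sample may be empty and then induces no member of
    \<open>P\<close>. The guard \<open>?m > 0\<close> treats this case, in which
    \<open>q = 0\<close> and the power is 1.\<close>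
  also have "\<dots> \<le> measure (pair_pmf (replicate_pmf k D) (replicate_pmf ?m D))
      {(xs, ys). xs \<in> Ok k \<and> (?m > 0 \<longrightarrow> ys \<in> Ok ?m)}"
  proof (rule measure_pmf.finite_measure_mono_AE)
    have "xs \<in> Ok k \<and> (?m > 0 \<longrightarrow> ys \<in> Ok ?m)"
      if "length xs = k" "length ys = ?m" "xs @ ys \<in> Ok (k + ?m)" for xs ys
    proof -
      have st: "set (xs @ ys) \<subseteq> verts G" "induced G (set (xs @ ys)) \<in> P"
        using that by (auto simp: Ok_def)
      have ind: "induced G S \<in> P" if "S \<subseteq> set (xs @ ys)" "S \<noteq> {}" for S
      proof -
        have "induced (induced G (set (xs @ ys))) S \<in> P"
          by (rule induced_mem_hereditary[OF assms(1,2) st(2)]) (use that in simp_all)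
        moreover have "induced (induced G (set (xs @ ys))) S = induced G S"
          using that unfolding induced_def by auto
        ultimately show ?thesis by simp
      qed
      have "ys \<noteq> []" if "?m > 0" using that \<open>length ys = ?m\<close> by (metis less_irrefl list.size(3))
      then show ?thesis using ind[of "set xs"] ind[of "set ys"] that assms(4) st by (auto simp: Ok_def)
    qed
    then show "AE x in pair_pmf (replicate_pmf k D) (replicate_pmf ?m D).
        x \<in> {(xs, ys). xs @ ys \<in> Ok (k + ?m)} \<longrightarrow>
        x \<in> {(xs, ys). xs \<in> Ok k \<and> (?m > 0 \<longrightarrow> ys \<in> Ok ?m)}"
      by (auto simp: AE_measure_pmf_iff set_replicate_pmf)
  qed auto
  also have "{(xs, ys). xs \<in> Ok k \<and> (?m > 0 \<longrightarrow> ys \<in> Ok ?m)} =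
      Ok k \<times> {ys. ?m > 0 \<longrightarrow> ys \<in> Ok ?m}" by auto
  also have "measure (pair_pmf (replicate_pmf k D) (replicate_pmf ?m D)) \<dots> =
      measure (replicate_pmf k D) (Ok k) * measure (replicate_pmf ?m D) {ys. ?m > 0 \<longrightarrow> ys \<in> Ok ?m}"
    by (rule measure_pair_pmf_Times)
  also have "\<dots> \<le> (1 - violation P G D k) * (1 - violation P G D k) ^ q"
  proof (intro mult_mono)
    show "measure (replicate_pmf ?m D) {ys. ?m > 0 \<longrightarrow> ys \<in> Ok ?m} \<le> (1 - violation P G D k) ^ q"
    proof (cases "?m > 0")
      case True
      then show ?thesis using Suc.IH by (simp add: Ok)
    next
      case False
      then show ?thesis using assms(4) by simp
    qed
  qed (simp_all add: Ok)
  finally show ?case by (simp only: split Ok) simp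
qed

section \<open>Step systems and their limit kernels\<close>

definition words :: "nat \<Rightarrow> bool list set" where
  "words m = {w. length w = m}"

lemma mem_words [simp]: "w \<in> words m \<longleftrightarrow> length w = m"
  by (simp add: words_def)

lemma words_0: "words 0 = {[]}"
  by (auto simp: words_def)

lemma words_Suc: "words (Suc m) = (#) True ` words m \<union> (#) False ` words m"
proof -
  have "w \<in> (#) True ` words m \<union> (#) False ` words m" if "length w = Suc m" for w
    using that by (cases w; cases "hd w") auto
  then show ?thesis by (auto simp: words_def)
qed

lemma finite_words [simp]: "finite (words m)"
  by (induction m) (simp_all add: words_0 words_Suc)

lemma sum_words_Suc:
  "(\<Sum>w\<in>words (Suc m). g w) = (\<Sum>w\<in>words m. g (True # w) + g (False # w))"
proof -
  have "(\<Sum>w\<in>words (Suc m). g w) = (\<Sum>w\<in>(#) True ` words m. g w) + (\<Sum>w\<in>(#) False ` words m. g w)"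
    unfolding words_Suc by (rule sum.union_disjoint) auto
  then show ?thesis by (simp add: sum.reindex sum.distrib)
qed

text \<open>A step system records the limiting type frequencies \<open>p\<close> and edge frequencies \<open>e\<close> of a
  sequence of graphs; words grow at the head, so that \<open>drop n\<close> forgets the \<open>n\<close> newest bits.\<close>

locale step_system =
  fixes p :: "bool list \<Rightarrow> real" and e :: "bool list \<Rightarrow> bool list \<Rightarrow> real"
  assumes p_nonneg: "0 \<le> p w"
    and p_Nil: "p [] = 1"
    and p_split: "p w = p (True # w) + p (False # w)"
    and e_nonneg: "0 \<le> e a b"
    and e_le: "e a b \<le> p a * p b"
    and e_split: "e a b = e (True # a) (True # b) + e (True # a) (False # b)
                        + e (False # a) (True # b) + e (False # a) (False # b)"
begin

definition dens :: "bool list \<Rightarrow> bool list \<Rightarrow> real" where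
  "dens a b = e a b / (p a * p b)"

text \<open>If one of the types has frequency 0, then \<open>e_le\<close> forces
  \<open>e a b\<close> to vanish, in agreement with the value 0 of the quotient.\<close>

lemma p_p_dens: "p a * p b * dens a b = e a b"
  using e_nonneg[of a b] e_le[of a b] by (auto simp: dens_def)

lemma dens_nonneg: "0 \<le> dens a b"
  by (simp add: dens_def e_nonneg p_nonneg)

lemma dens_le_1: "dens a b \<le> 1"
proof -
  have "dens a b \<le> p a * p b / (p a * p b)"
    unfolding dens_def by (intro divide_right_mono e_le mult_nonneg_nonneg p_nonneg)
  also have "\<dots> \<le> 1" by simp
  finally show ?thesis .
qed

text \<open>Peeling off the newest bit merges two siblings by \<open>p_split\<close>; a function of
  the coarse type thus keeps its mean under refinement.\<close>

lemma sum_p_drop: "(\<Sum>w\<in>words (m + n). p w * g (drop n w)) = (\<Sum>w\<in>words m. p w * g w)"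
proof (induction n)
  case (Suc n)
  have "(\<Sum>w\<in>words (m + Suc n). p w * g (drop (Suc n) w))
      = (\<Sum>w\<in>words (m + n). p (True # w) * g (drop n w) + p (False # w) * g (drop n w))"
    by (simp add: sum_words_Suc)
  also have "\<dots> = (\<Sum>w\<in>words (m + n). p w * g (drop n w))"
    by (intro sum.cong refl) (subst p_split, simp add: algebra_simps)
  finally show ?case using Suc.IH by simp
qed simp

lemma sum_e_drop:
  "(\<Sum>a\<in>words (m + n). \<Sum>b\<in>words (m + n). e a b * g (drop n a) (drop n b))
   = (\<Sum>a\<in>words m. \<Sum>b\<in>words m. e a b * g a b)"
proof (induction n)
  case (Suc n)
  have "(\<Sum>a\<in>words (m + Suc n). \<Sum>b\<in>words (m + Suc n). e a b * g (drop (Suc n) a) (drop (Suc n) b))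
      = (\<Sum>a\<in>words (m + n). \<Sum>b\<in>words (m + n). e a b * g (drop n a) (drop n b))"
    by (simp add: sum_words_Suc sum.distrib[symmetric], intro sum.cong refl)
       (subst (5) e_split, simp add: algebra_simps)
  then show ?case using Suc.IH by simp
qed simp

lemma sum_p: "(\<Sum>w\<in>words m. p w) = 1"
  using sum_p_drop[where m = 0 and n = m and g = "\<lambda>_. 1"] by (simp add: words_0 p_Nil)

lemma sum_p_p: "(\<Sum>a\<in>words m. \<Sum>b\<in>words m. p a * p b) = 1"
  by (simp add: sum_distrib_left[symmetric] sum_p)

lemma sum_p_p_drop:
  "(\<Sum>a\<in>words (m + n). \<Sum>b\<in>words (m + n). p a * p b * g (drop n a) (drop n b))
   = (\<Sum>a\<in>words m. \<Sum>b\<in>words m. p a * p b * g a b)"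
proof -
  have "(\<Sum>a\<in>words (m + n). \<Sum>b\<in>words (m + n). p a * p b * g (drop n a) (drop n b))
      = (\<Sum>a\<in>words (m + n). p a * (\<Sum>b\<in>words (m + n). p b * g (drop n a) (drop n b)))"
    by (simp add: sum_distrib_left mult.assoc)
  also have "\<dots> = (\<Sum>a\<in>words (m + n). p a * (\<Sum>b\<in>words m. p b * g (drop n a) b))"
    by (subst sum_p_drop) simp
  also have "\<dots> = (\<Sum>a\<in>words m. p a * (\<Sum>b\<in>words m. p b * g a b))"
    by (rule sum_p_drop)
  finally show ?thesis by (simp add: sum_distrib_left mult.assoc)
qed

text \<open>The index of the regularity method. By \<open>p_p_dens\<close> it is the squared L^2
  norm of the step function with values \<open>dens\<close>.\<close>

definition energy :: "nat \<Rightarrow> real" where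
  "energy m = (\<Sum>a\<in>words m. \<Sum>b\<in>words m. e a b * dens a b)"

lemma energy_nonneg: "0 \<le> energy m"
  unfolding energy_def by (intro sum_nonneg mult_nonneg_nonneg e_nonneg dens_nonneg)

lemma energy_le_1: "energy m \<le> 1"
proof -
  have "energy m \<le> (\<Sum>a\<in>words m. \<Sum>b\<in>words m. p a * p b)"
    unfolding energy_def
    by (intro sum_mono order_trans[OF _ e_le] mult_left_le dens_le_1 e_nonneg)
  then show ?thesis by (simp add: sum_p_p)
qed

text \<open>Pythagoras: coarse densities are averages of fine ones, so in the expanded square the
  mixed sum collapses to the coarse energy.\<close>

lemma energy_diff:
  "(\<Sum>a\<in>words (m + n). \<Sum>b\<in>words (m + n). p a * p b * (dens a b - dens (drop n a) (drop n b))\<^sup>2)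
   = energy (m + n) - energy m"
proof -
  have expand: "p a * p b * (dens a b - D)\<^sup>2 = e a b * dens a b - 2 * (e a b * D) + p a * p b * D\<^sup>2" for a b D
  proof -
    have "q * (y - D)\<^sup>2 = x * y - 2 * (x * D) + q * D\<^sup>2" if "x = q * y" for x y q :: real
      unfolding that by (simp add: power2_eq_square algebra_simps)
    from this[OF p_p_dens[symmetric]] show ?thesis .
  qed
  have "(\<Sum>a\<in>words (m + n). \<Sum>b\<in>words (m + n). p a * p b * (dens a b - dens (drop n a) (drop n b))\<^sup>2)
     = energy (m + n)
       - 2 * (\<Sum>a\<in>words (m + n). \<Sum>b\<in>words (m + n). e a b * dens (drop n a) (drop n b))
       + (\<Sum>a\<in>words (m + n). \<Sum>b\<in>words (m + n). p a * p b * (dens (drop n a) (drop n b))\<^sup>2)"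
    unfolding expand energy_def by (simp add: sum.distrib sum_subtractf sum_distrib_left)
  also have "\<dots> = energy (m + n) - 2 * energy m
       + (\<Sum>a\<in>words m. \<Sum>b\<in>words m. p a * p b * (dens a b)\<^sup>2)"
    unfolding sum_e_drop[where g = dens] sum_p_p_drop[where g = "\<lambda>a b. (dens a b)\<^sup>2"] energy_def ..
  also have "(\<Sum>a\<in>words m. \<Sum>b\<in>words m. p a * p b * (dens a b)\<^sup>2) = energy m"
    unfolding energy_def power2_eq_square mult.assoc[symmetric] p_p_dens ..
  finally show ?thesis by simp
qed

lemma energy_mono: "energy m \<le> energy (m + n)"
proof -
  have "0 \<le> energy (m + n) - energy m"
    unfolding energy_diff[symmetric] by (intro sum_nonneg mult_nonneg_nonneg p_nonneg) simp
  then show ?thesis by simp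
qed

section \<open>Types as nested intervals and step kernels on the unit square\<close>

primrec lo :: "bool list \<Rightarrow> real" where
  "lo [] = 0"
| "lo (b # w) = lo w + (if b then p (False # w) else 0)"

text \<open>Descends through the half-open intervals \<open>[lo w, lo w + p w)\<close>, in which the
  \<open>False\<close> child takes the left part of its parent; a type of frequency 0 gets an empty
  interval.\<close>

primrec cell :: "nat \<Rightarrow> real \<Rightarrow> bool list" where
  "cell 0 x = []"
| "cell (Suc m) x = (lo (cell m x) + p (False # cell m x) \<le> x) # cell m x"

lemma length_cell [simp]: "length (cell m x) = m"
  by (induction m) auto

lemma drop_cell: "drop n (cell (m + n) x) = cell m x"
  by (induction n) auto

lemma cell_eq_iff:
  "0 \<le> x \<Longrightarrow> x < 1 \<Longrightarrow> cell (length w) x = w \<longleftrightarrow> lo w \<le> x \<and> x < lo w + p w"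
proof (induction w)
  case (Cons b w)
  then have IH: "cell (length w) x = w \<longleftrightarrow> lo w \<le> x \<and> x < lo w + p w" by simp
  show ?case
    using IH p_split[of w] p_nonneg[of "False # w"] p_nonneg[of "True # w"] by auto
qed (simp add: p_Nil)

lemma lo_bounds: "0 \<le> lo w \<and> lo w + p w \<le> 1"
proof (induction w)
  case (Cons b w)
  then show ?case
    using p_split[of w] p_nonneg[of "False # w"] p_nonneg[of "True # w"] by auto
qed (simp add: p_Nil)

end

definition unif :: "real measure" where
  "unif = uniform_measure lborel {0..<1}"

lemma space_unif [simp]: "space unif = UNIV"
  and sets_unif [simp, measurable_cong]: "sets unif = sets borel"
  by (simp_all add: unif_def)

interpretation unif: prob_space unif
  unfolding unif_def by (rule prob_space_uniform_measure) simp_all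

interpretation unif2: pair_prob_space unif unif ..

interpretation unif_prod: product_prob_space "\<lambda>_. unif" I for I :: "nat set" ..

context step_system
begin

lemma measurable_cell [measurable]: "cell m \<in> measurable borel (count_space UNIV)"
proof (induction m)
  case (Suc m)
  note [measurable] = Suc
  have "(\<lambda>x. (lo c + p (False # c) \<le> x) # c) \<in> measurable borel (count_space UNIV)" for c
    by (rule measurable_compose[where N = "count_space UNIV" and g = "\<lambda>b. b # c"]) (simp_all add: pred_def atLeast_def[symmetric])
  then have "(\<lambda>x. (lo (cell m x) + p (False # cell m x) \<le> x) # cell m x)
      \<in> measurable borel (count_space UNIV)"
    by (rule measurable_compose_countable[where g = "cell m"
          and f = "\<lambda>c x. (lo c + p (False # c) \<le> x) # c"]) (rule Suc)
  then show ?case by simp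
qed simp

lemma measure_cell: "length w = m \<Longrightarrow> measure unif {x. cell m x = w} = p w"
proof -
  assume "length w = m"
  then have "{0..<1} \<inter> {x. cell m x = w} = {lo w..<lo w + p w}"
    using lo_bounds[of w] cell_eq_iff[of _ w] by auto
  moreover have "{x. cell m x = w} \<in> sets borel" by measurable
  ultimately have "emeasure unif {x. cell m x = w} = ennreal (p w)"
    unfolding unif_def by (subst emeasure_uniform_measure) (simp_all add: p_nonneg divide_ennreal_def)
  then show ?thesis by (simp add: measure_def p_nonneg)
qed

text \<open>The cells of independent uniform points are independent words of law \<open>p\<close>.
  Expanding \<open>h\<close> into indicators of the finitely many cell vectors turns the integral
  into a sum.\<close>

lemma integral_cells:
  fixes h :: "(nat \<Rightarrow> bool list) \<Rightarrow> real"
  assumes "finite I"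
  shows "(\<integral>x. h (\<lambda>i\<in>I. cell m (x i)) \<partial>PiM I (\<lambda>_. unif))
       = (\<Sum>a\<in>PiE I (\<lambda>_. words m). (\<Prod>i\<in>I. p (a i)) * h a)"
proof -
  let ?S = "PiE I (\<lambda>_. words m)"
  have fin: "finite ?S" using assms by (intro finite_PiE) auto
  have eq: "h (\<lambda>i\<in>I. cell m (x i)) = (\<Sum>a\<in>?S. h a * (\<Prod>i\<in>I. indicator {y. cell m y = a i} (x i)))" for x
  proof -
    let ?c = "\<lambda>i\<in>I. cell m (x i)"
    have "(\<Prod>i\<in>I. indicator {y. cell m y = a i} (x i)) = (if a = ?c then 1 else (0::real))"
      if "a \<in> ?S" for a
    proof (cases "a = ?c")
      case False
      have "\<exists>i\<in>I. a i \<noteq> cell m (x i)"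
      proof (rule ccontr)
        assume "\<not> ?thesis"
        then have "a = ?c" using that by (intro extensionalityI[of a I]) (auto simp: PiE_iff)
        then show False using False by simp
      qed
      then obtain i where "i \<in> I" "a i \<noteq> cell m (x i)" by blast
      then show ?thesis using False assms by (auto simp: prod_zero_iff indicator_def)
    qed (auto simp: indicator_def intro!: prod.neutral)
    then have "(\<Sum>a\<in>?S. h a * (\<Prod>i\<in>I. indicator {y. cell m y = a i} (x i)))
        = (\<Sum>a\<in>?S. if a = ?c then h a else 0)"
      by (intro sum.cong) auto
    also have "\<dots> = h ?c" using fin by (simp add: sum.delta')
    finally show ?thesis by simp
  qed
  have int: "integrable (PiM I (\<lambda>_. unif)) (\<lambda>x. \<Prod>i\<in>I. indicator {y. cell m y = a i} (x i) :: real)" for a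
    using assms by (intro unif_prod.product_integrable_prod) (auto intro!: unif.integrable_const_bound[where B=1])
  have "(\<integral>x. h (\<lambda>i\<in>I. cell m (x i)) \<partial>PiM I (\<lambda>_. unif))
      = (\<Sum>a\<in>?S. h a * (\<integral>x. (\<Prod>i\<in>I. indicator {y. cell m y = a i} (x i)) \<partial>PiM I (\<lambda>_. unif)))"
    unfolding eq using int by (subst Bochner_Integration.integral_sum) auto
  also have "\<dots> = (\<Sum>a\<in>?S. h a * (\<Prod>i\<in>I. p (a i)))"
  proof (intro sum.cong refl arg_cong2[where f="(*)"])
    fix a assume "a \<in> ?S"
    then have "(\<integral>y. indicator {y. cell m y = a i} y \<partial>unif) = p (a i)" if "i \<in> I" for i
    proof -
      have "length (a i) = m" using \<open>a \<in> ?S\<close> that by (auto simp: PiE_iff)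
      then show ?thesis using measure_cell[of "a i" m] by simp
    qed
    moreover have "(\<integral>x. (\<Prod>i\<in>I. indicator {y. cell m y = a i} (x i)) \<partial>PiM I (\<lambda>_. unif))
        = (\<Prod>i\<in>I. \<integral>y. (indicator {y. cell m y = a i} y :: real) \<partial>unif)"
      using assms by (intro unif_prod.product_integral_prod) (auto intro!: unif.integrable_const_bound[where B=1])
    ultimately show "(\<integral>x. (\<Prod>i\<in>I. indicator {y. cell m y = a i} (x i)) \<partial>PiM I (\<lambda>_. unif)) = (\<Prod>i\<in>I. p (a i))"
      by simp
  qed
  finally show ?thesis by (simp add: mult.commute)
qed

lemma integral_cells2:
  fixes h :: "bool list \<Rightarrow> bool list \<Rightarrow> real"
  shows "(\<integral>z. h (cell m (fst z)) (cell m (snd z)) \<partial>(unif \<Otimes>\<^sub>M unif))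
       = (\<Sum>a\<in>words m. \<Sum>b\<in>words m. p a * p b * h a b)"
proof -
  let ?A = "\<lambda>a. {y. cell m y = a}"
  have eq: "h (cell m (fst z)) (cell m (snd z))
      = (\<Sum>a\<in>words m. \<Sum>b\<in>words m. h a b * indicator (?A a \<times> ?A b) z)" for z
  proof -
    have "(\<Sum>a\<in>words m. \<Sum>b\<in>words m. h a b * indicator (?A a \<times> ?A b) z)
        = (\<Sum>a\<in>words m. if a = cell m (fst z) then
             (\<Sum>b\<in>words m. if b = cell m (snd z) then h a b else 0) else 0)"
      by (intro sum.cong refl) (auto simp: indicator_def mem_Times_iff intro!: sum.cong sum.neutral)
    then show ?thesis by (simp add: sum.delta')
  qed
  have m: "measure (unif \<Otimes>\<^sub>M unif) (?A a \<times> ?A b) = p a * p b" if "length a = m" "length b = m" for a b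
    using unif.emeasure_pair_measure_Times[of "?A a" unif "?A b"] that
    by (simp add: measure_def enn2real_mult measure_cell[unfolded measure_def])
  have "(\<integral>z. h (cell m (fst z)) (cell m (snd z)) \<partial>(unif \<Otimes>\<^sub>M unif))
      = (\<Sum>a\<in>words m. \<Sum>b\<in>words m. h a b * measure (unif \<Otimes>\<^sub>M unif) (?A a \<times> ?A b))"
  proof -
    have int: "integrable (unif \<Otimes>\<^sub>M unif) (\<lambda>z. h a b * indicator (?A a \<times> ?A b) z)" for a b
      by (intro integrable_mult_right integrable_real_indicator)
         (auto intro!: pair_measureI simp: unif2.P.emeasure_eq_measure)
    have "(\<integral>z. h (cell m (fst z)) (cell m (snd z)) \<partial>(unif \<Otimes>\<^sub>M unif))
      = (\<Sum>a\<in>words m. \<integral>z. (\<Sum>b\<in>words m. h a b * indicator (?A a \<times> ?A b) z) \<partial>(unif \<Otimes>\<^sub>M unif))"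
      unfolding eq by (rule Bochner_Integration.integral_sum) (intro Bochner_Integration.integrable_sum int)
    also have "\<dots> = (\<Sum>a\<in>words m. \<Sum>b\<in>words m. \<integral>z. h a b * indicator (?A a \<times> ?A b) z \<partial>(unif \<Otimes>\<^sub>M unif))"
      by (intro sum.cong refl Bochner_Integration.integral_sum int)
    finally show ?thesis by (simp add: space_pair_measure)
  qed
  also have "\<dots> = (\<Sum>a\<in>words m. \<Sum>b\<in>words m. p a * p b * h a b)"
    by (intro sum.cong refl) (simp add: m mult.commute)
  finally show ?thesis .
qed

definition kernel :: "nat \<Rightarrow> real \<times> real \<Rightarrow> real" where
  "kernel m z = dens (cell m (fst z)) (cell m (snd z))"

lemma measurable_kernel [measurable]: "kernel m \<in> borel_measurable (unif \<Otimes>\<^sub>M unif)"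
proof -
  have "(\<lambda>z. dens c (cell m (snd z))) \<in> borel_measurable (unif \<Otimes>\<^sub>M unif)" for c
  proof (rule measurable_compose[where N = "count_space UNIV" and g = "dens c"])
    show "(\<lambda>z. cell m (snd z)) \<in> measurable (unif \<Otimes>\<^sub>M unif) (count_space UNIV)" by measurable
  qed simp
  moreover have "(\<lambda>z. cell m (fst z)) \<in> measurable (unif \<Otimes>\<^sub>M unif) (count_space UNIV)"
    by measurable
  ultimately have "(\<lambda>z. dens (cell m (fst z)) (cell m (snd z))) \<in> borel_measurable (unif \<Otimes>\<^sub>M unif)"
    by (rule measurable_compose_countable[where f = "\<lambda>c z. dens c (cell m (snd z))"])
  then show ?thesis by (simp add: kernel_def[abs_def])
qed

lemma kernel_bounds: "0 \<le> kernel m z" "kernel m z \<le> 1"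
  by (simp_all add: kernel_def dens_nonneg dens_le_1)

lemma kernel_L2: "(\<integral>z. (kernel (m + n) z - kernel m z)\<^sup>2 \<partial>(unif \<Otimes>\<^sub>M unif)) = energy (m + n) - energy m"
  using integral_cells2[where m = "m + n" and h = "\<lambda>a b. (dens a b - dens (drop n a) (drop n b))\<^sup>2"]
  by (simp add: kernel_def drop_cell energy_diff)

text \<open>Nonnegativity of the variance bounds the squared mean of the difference by its mean
  square, and the latter is the energy gap by \<open>kernel_L2\<close>.\<close>

lemma kernel_L1: "(\<integral>z. \<bar>kernel (m + n) z - kernel m z\<bar> \<partial>(unif \<Otimes>\<^sub>M unif)) \<le> sqrt (energy (m + n) - energy m)"
proof (rule real_le_rsqrt)
  let ?X = "\<lambda>z. \<bar>kernel (m + n) z - kernel m z\<bar>"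
  have b: "?X z \<le> 1" for z
    using kernel_bounds[of m z] kernel_bounds[of "m + n" z] by (simp add: abs_le_iff)
  have b2: "(?X z)\<^sup>2 \<le> 1" for z using b[of z] by (simp add: abs_square_le_1)
  have "0 \<le> unif2.P.variance ?X" by (rule unif2.P.variance_positive)
  also have "\<dots> = unif2.P.expectation (\<lambda>z. (?X z)\<^sup>2) - (unif2.P.expectation ?X)\<^sup>2"
    by (rule unif2.P.variance_eq)
       (rule unif2.P.integrable_const_bound[where B=1], use b b2 in auto)+
  finally show "(unif2.P.expectation ?X)\<^sup>2 \<le> energy (m + n) - energy m"
    by (simp add: kernel_L2)
qed

end

text \<open>Completeness of L^1 among functions with values in [0,1]. A subsequence with L^1 steps
  at most \<open>2 * (1/2) ^ k\<close> converges almost everywhere, since its increments have an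
  integrable sum; dominated convergence and the Cauchy condition carry this over to the full
  sequence.\<close>

lemma (in prob_space) L1_Cauchy_limit:
  fixes g :: "nat \<Rightarrow> 'a \<Rightarrow> real"
  assumes [measurable]: "\<And>n. g n \<in> borel_measurable M"
    and g01: "\<And>n x. 0 \<le> g n x" "\<And>n x. g n x \<le> 1"
    and Cauchy: "\<And>\<eta>. \<eta> > 0 \<Longrightarrow> \<exists>m. \<forall>n\<ge>m. (\<integral>x. \<bar>g n x - g m x\<bar> \<partial>M) \<le> \<eta>"
  obtains W where "W \<in> borel_measurable M" "\<And>x. 0 \<le> W x" "\<And>x. W x \<le> 1"
    "(\<lambda>n. \<integral>x. \<bar>g n x - W x\<bar> \<partial>M) \<longlonglongrightarrow> 0"
proof -
  have int: "integrable M (\<lambda>x. \<bar>g n x - h x\<bar>)"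
    if [measurable]: "h \<in> borel_measurable M" and "\<And>x. 0 \<le> h x" "\<And>x. h x \<le> 1" for n h
  proof (rule integrable_const_bound[where B=1])
    have "\<bar>g n x - h x\<bar> \<le> 1" for x
      using g01(1)[of n x] g01(2)[of n x] that(2)[of x] that(3)[of x] by linarith
    then show "AE x in M. norm \<bar>g n x - h x\<bar> \<le> 1" by simp
  qed measurable
  obtain r0 where r0: "\<And>k n. n \<ge> r0 k \<Longrightarrow> (\<integral>x. \<bar>g n x - g (r0 k) x\<bar> \<partial>M) \<le> (1/2) ^ k"
    using Cauchy[of "(1/2) ^ k" for k] by (metis zero_less_power half_gt_zero zero_less_one)
  have tri: "(\<integral>x. \<bar>g a x - h x\<bar> \<partial>M) \<le> (\<integral>x. \<bar>g a x - g c x\<bar> \<partial>M) + (\<integral>x. \<bar>g c x - h x\<bar> \<partial>M)"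
    if "h \<in> borel_measurable M" "\<And>x. 0 \<le> h x" "\<And>x. h x \<le> 1" for a c h
    using that g01 by (subst Bochner_Integration.integral_add[symmetric])
      (auto intro!: integral_mono int Bochner_Integration.integrable_add)
  \<comment> \<open>Partial sums make the indices nondecreasing and keep \<open>r k\<close> above
    \<open>r0 k\<close>; comparing \<open>r k\<close> with \<open>r (Suc k)\<close> through
    \<open>r0 k\<close> costs \<open>(1/2) ^ k\<close> twice.\<close>
  define r where "r k = (\<Sum>i\<le>k. r0 i)" for k
  have r_ge: "r0 k \<le> r k" for k unfolding r_def by (rule member_le_sum) auto
  have r_mono: "r k \<le> r (Suc k)" for k unfolding r_def by simp
  have r0_r: "r0 k \<le> r (Suc k)" for k using r_ge[of k] r_mono[of k] by simp
  have step: "(\<integral>x. \<bar>g (r (Suc k)) x - g (r k) x\<bar> \<partial>M) \<le> 2 * (1/2) ^ k" for k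
  proof -
    have "(\<integral>x. \<bar>g (r (Suc k)) x - g (r k) x\<bar> \<partial>M)
        \<le> (\<integral>x. \<bar>g (r (Suc k)) x - g (r0 k) x\<bar> \<partial>M) + (\<integral>x. \<bar>g (r0 k) x - g (r k) x\<bar> \<partial>M)"
      using g01 by (intro tri) auto
    also have "(\<integral>x. \<bar>g (r0 k) x - g (r k) x\<bar> \<partial>M) = (\<integral>x. \<bar>g (r k) x - g (r0 k) x\<bar> \<partial>M)"
      by (simp add: abs_minus_commute)
    finally show ?thesis using r0[OF r0_r[of k]] r0[OF r_ge[of k]] by simp
  qed
  have ae: "AE x in M. convergent (\<lambda>k. g (r k) x)"
  proof -
    let ?h = "\<lambda>k x. \<bar>g (r (Suc k)) x - g (r k) x\<bar>"
    have "(\<integral>\<^sup>+x. (\<Sum>k. ennreal (?h k x)) \<partial>M) = (\<Sum>k. \<integral>\<^sup>+x. ennreal (?h k x) \<partial>M)"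
      by (rule nn_integral_suminf) measurable
    also have "\<dots> \<le> (\<Sum>k. ennreal (2 * (1/2) ^ k))"
    proof (rule suminf_le)
      fix k
      have "(\<integral>\<^sup>+x. ennreal (?h k x) \<partial>M) = ennreal (\<integral>x. ?h k x \<partial>M)"
        using g01 by (intro nn_integral_eq_integral int) auto
      then show "(\<integral>\<^sup>+x. ennreal (?h k x) \<partial>M) \<le> ennreal (2 * (1/2) ^ k)"
        using step[of k] by (simp add: ennreal_leI)
    qed auto
    also have "\<dots> = ennreal (\<Sum>k. 2 * (1/2) ^ k)"
      by (intro suminf_ennreal2) (auto intro!: summable_mult summable_geometric)
    finally have "(\<integral>\<^sup>+x. (\<Sum>k. ennreal (?h k x)) \<partial>M) \<noteq> \<infinity>"
      by (auto simp: top_unique)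
    then have "AE x in M. (\<Sum>k. ennreal (?h k x)) \<noteq> \<infinity>"
      by (intro nn_integral_PInf_AE) measurable
    then show ?thesis
    proof eventually_elim
      case (elim x)
      then have "summable (\<lambda>k. ?h k x)"
        by (intro summable_suminf_not_top) auto
      then have "summable (\<lambda>k. g (r (Suc k)) x - g (r k) x)"
        by (rule summable_rabs_cancel)
      then obtain s where "(\<lambda>k. g (r (Suc k)) x - g (r k) x) sums s" by (auto simp: summable_def)
      then have "(\<lambda>n. g (r n) x - g (r 0) x) \<longlonglongrightarrow> s"
        unfolding sums_def sum_lessThan_telescope[where f = "\<lambda>k. g (r k) x"] .
      then have "(\<lambda>n. g (r n) x - g (r 0) x + g (r 0) x) \<longlonglongrightarrow> s + g (r 0) x"
        by (intro tendsto_intros)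
      then show ?case by (auto simp: convergent_def)
    qed
  qed
  \<comment> \<open>Clipping ensures the bounds at every point, also where the subsequence diverges
    and \<open>lim\<close> has no meaning.\<close>
  define W where "W x = max 0 (min 1 (lim (\<lambda>k. g (r k) x)))" for x
  have [measurable]: "W \<in> borel_measurable M" unfolding W_def by measurable
  have W01: "0 \<le> W x" "W x \<le> 1" for x by (auto simp: W_def)
  have aeW: "AE x in M. (\<lambda>k. g (r k) x) \<longlonglongrightarrow> W x"
    using ae
  proof eventually_elim
    case (elim x)
    then have l: "(\<lambda>k. g (r k) x) \<longlonglongrightarrow> lim (\<lambda>k. g (r k) x)" by (simp add: convergent_LIMSEQ_iff)
    have "0 \<le> lim (\<lambda>k. g (r k) x)" "lim (\<lambda>k. g (r k) x) \<le> 1"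
      using LIMSEQ_le_const[OF l, of 0] LIMSEQ_le_const2[OF l, of 1] g01 by auto
    then show ?case using l by (simp add: W_def)
  qed
  have sub: "(\<lambda>k. \<integral>x. \<bar>g (r k) x - W x\<bar> \<partial>M) \<longlonglongrightarrow> (\<integral>x. 0 \<partial>M)"
  proof (rule integral_dominated_convergence[where w="\<lambda>_. 1"])
    show "AE x in M. (\<lambda>k. \<bar>g (r k) x - W x\<bar>) \<longlonglongrightarrow> 0"
      using aeW by eventually_elim (auto intro!: tendsto_rabs_zero simp: LIM_zero_iff)
    fix k
    have "\<bar>g (r k) x - W x\<bar> \<le> 1" for x
      using g01(1)[of "r k" x] g01(2)[of "r k" x] W01[of x] by (simp add: abs_le_iff)
    then show "AE x in M. norm \<bar>g (r k) x - W x\<bar> \<le> 1" by simp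
  qed auto
  have "(\<lambda>n. \<integral>x. \<bar>g n x - W x\<bar> \<partial>M) \<longlonglongrightarrow> 0"
  proof (rule LIMSEQ_I)
    fix \<eta> :: real assume "\<eta> > 0"
    from sub have "(\<lambda>k. \<integral>x. \<bar>g (r k) x - W x\<bar> \<partial>M) \<longlonglongrightarrow> 0" by simp
    then have "\<forall>\<^sub>F k in sequentially. (\<integral>x. \<bar>g (r k) x - W x\<bar> \<partial>M) < \<eta> / 2"
      using \<open>\<eta> > 0\<close> by (intro order_tendstoD) auto
    moreover have "(\<lambda>k. 2 * (1/2) ^ k) \<longlonglongrightarrow> (2 * 0 :: real)"
      by (intro tendsto_intros LIMSEQ_realpow_zero) auto
    then have "\<forall>\<^sub>F k in sequentially. 2 * (1/2) ^ k < \<eta> / 2"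
      by (rule order_tendstoD(2)) (use \<open>\<eta> > 0\<close> in simp)
    ultimately have "\<forall>\<^sub>F k in sequentially. (\<integral>x. \<bar>g (r k) x - W x\<bar> \<partial>M) < \<eta> / 2 \<and> 2 * (1/2) ^ k < \<eta> / 2"
      by eventually_elim auto
    then obtain k where k: "(\<integral>x. \<bar>g (r k) x - W x\<bar> \<partial>M) < \<eta> / 2" "2 * (1/2) ^ k < \<eta> / 2"
      using eventually_happens'[OF sequentially_bot] by blast
    show "\<exists>no. \<forall>n\<ge>no. norm ((\<integral>x. \<bar>g n x - W x\<bar> \<partial>M) - 0) < \<eta>"
    proof (intro exI allI impI)
      fix n assume n: "n \<ge> r k"
      have "(\<integral>x. \<bar>g n x - g (r k) x\<bar> \<partial>M)
          \<le> (\<integral>x. \<bar>g n x - g (r0 k) x\<bar> \<partial>M) + (\<integral>x. \<bar>g (r0 k) x - g (r k) x\<bar> \<partial>M)"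
        using g01 by (intro tri) auto
      also have "(\<integral>x. \<bar>g (r0 k) x - g (r k) x\<bar> \<partial>M) = (\<integral>x. \<bar>g (r k) x - g (r0 k) x\<bar> \<partial>M)"
        by (simp add: abs_minus_commute)
      finally have "(\<integral>x. \<bar>g n x - g (r k) x\<bar> \<partial>M) < \<eta> / 2"
        using r0[OF r_ge[of k]] r0[OF order_trans[OF r_ge[of k] n]] k(2) by simp
      moreover have "(\<integral>x. \<bar>g n x - W x\<bar> \<partial>M) \<le> (\<integral>x. \<bar>g n x - g (r k) x\<bar> \<partial>M) + (\<integral>x. \<bar>g (r k) x - W x\<bar> \<partial>M)"
        using W01 by (intro tri) auto
      moreover have "0 \<le> (\<integral>x. \<bar>g n x - W x\<bar> \<partial>M)" by (rule integral_nonneg_AE) simp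
      ultimately show "norm ((\<integral>x. \<bar>g n x - W x\<bar> \<partial>M) - 0) < \<eta>" using k(1) by simp
    qed
  qed
  then show ?thesis using that[of W] W01 by auto
qed

context step_system
begin

text \<open>Energies increase and are bounded by 1, hence form a Cauchy sequence; by
  \<open>kernel_L1\<close>, an energy gap below \<open>\<eta>\<^sup>2\<close> keeps the step kernels
  \<eta>-close in L^1.\<close>

lemma kernel_limit:
  obtains W where "W \<in> borel_measurable (unif \<Otimes>\<^sub>M unif)" "\<And>z. 0 \<le> W z" "\<And>z. W z \<le> 1"
    "(\<lambda>m. \<integral>z. \<bar>kernel m z - W z\<bar> \<partial>(unif \<Otimes>\<^sub>M unif)) \<longlonglongrightarrow> 0"
proof (rule unif2.P.L1_Cauchy_limit[of kernel])
  fix \<eta> :: real assume "\<eta> > 0"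
  have "mono energy" unfolding mono_def using energy_mono by (metis le_Suc_ex)
  moreover have "Bseq energy"
    using energy_nonneg energy_le_1 by (intro BseqI[of 1]) auto
  ultimately have "convergent energy" by (intro Bseq_mono_convergent) (auto simp: mono_def)
  then have "Cauchy energy" by (rule convergent_Cauchy)
  then obtain m where m: "\<And>n. n \<ge> m \<Longrightarrow> norm (energy n - energy m) < \<eta>\<^sup>2"
    using \<open>\<eta> > 0\<close> unfolding Cauchy_iff by (metis order_refl zero_less_power)
  show "\<exists>m. \<forall>n\<ge>m. (\<integral>z. \<bar>kernel n z - kernel m z\<bar> \<partial>(unif \<Otimes>\<^sub>M unif)) \<le> \<eta>"
  proof (intro exI allI impI)
    fix n assume "n \<ge> m"
    then obtain k where n: "n = m + k" by (metis le_Suc_ex)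
    have "sqrt (energy n - energy m) \<le> sqrt (\<eta>\<^sup>2)"
      using m[of n] n by (intro real_sqrt_le_mono) auto
    then show "(\<integral>z. \<bar>kernel n z - kernel m z\<bar> \<partial>(unif \<Otimes>\<^sub>M unif)) \<le> \<eta>"
      using kernel_L1[of m k] n \<open>\<eta> > 0\<close> by simp
  qed
qed (auto simp: kernel_bounds intro: that)

end

section \<open>Pattern densities and the counting lemma\<close>

definition ordered_pairs :: "nat \<Rightarrow> (nat \<times> nat) set" where
  "ordered_pairs k = {(i, l). i < l \<and> l < k}"

lemma finite_ordered_pairs [simp]: "finite (ordered_pairs k)"
  by (rule finite_subset[of _ "{..<k} \<times> {..<k}"]) (auto simp: ordered_pairs_def)

definition literal :: "bool \<Rightarrow> real \<Rightarrow> real" where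
  "literal b t = (if b then t else 1 - t)"

lemma literal_bounds: "0 \<le> t \<Longrightarrow> t \<le> 1 \<Longrightarrow> 0 \<le> literal b t" "0 \<le> t \<Longrightarrow> t \<le> 1 \<Longrightarrow> literal b t \<le> 1"
  by (auto simp: literal_def)

text \<open>For a 0/1-valued \<open>g\<close> the second product tells whether \<open>x\<close> is a
  labelled induced copy of \<open>F\<close>; for a kernel it is the probability that the random
  graph with edge probabilities \<open>g (x i) (x l)\<close> equals \<open>F\<close>. The factors
  \<open>u i\<close> serve to prescribe the types of the vertices.\<close>

definition pattern_weight ::
  "nat \<Rightarrow> (nat \<Rightarrow> 'b \<Rightarrow> real) \<Rightarrow> (nat \<Rightarrow> nat \<Rightarrow> bool) \<Rightarrow> ('b \<Rightarrow> 'b \<Rightarrow> real) \<Rightarrow> (nat \<Rightarrow> 'b) \<Rightarrow> real" where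
  "pattern_weight k u F g x =
     (\<Prod>i<k. u i (x i)) * (\<Prod>(i, l)\<in>ordered_pairs k. literal (F i l) (g (x i) (x l)))"

lemma pattern_weight_bounds:
  assumes "\<And>i x. 0 \<le> u i x" "\<And>i x. u i x \<le> 1" "\<And>x y. 0 \<le> g x y" "\<And>x y. g x y \<le> 1"
  shows "0 \<le> pattern_weight k u F g x" "pattern_weight k u F g x \<le> 1"
proof -
  have 1: "0 \<le> (\<Prod>i<k. u i (x i))" "(\<Prod>i<k. u i (x i)) \<le> 1"
    using assms by (auto intro!: prod_nonneg prod_le_1)
  have 2: "0 \<le> (\<Prod>(i, l)\<in>ordered_pairs k. literal (F i l) (g (x i) (x l)))"
    "(\<Prod>(i, l)\<in>ordered_pairs k. literal (F i l) (g (x i) (x l))) \<le> 1"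
    using assms by (auto intro!: prod_nonneg prod_le_1 literal_bounds)
  show "0 \<le> pattern_weight k u F g x" "pattern_weight k u F g x \<le> 1"
    unfolding pattern_weight_def using 1 2 by (auto intro: mult_le_one)
qed

section \<open>Cut bounds and counting\<close>

definition tuple_pmf :: "nat \<Rightarrow> 'b pmf \<Rightarrow> (nat \<Rightarrow> 'b) pmf" where
  "tuple_pmf k \<mu> = Pi_pmf {..<k} undefined (\<lambda>_. \<mu>)"

lemma finite_set_Pi_pmf:
  assumes "finite I" "finite (set_pmf \<mu>)"
  shows "finite (set_pmf (Pi_pmf I d (\<lambda>_. \<mu>)))"
  using assms by (intro finite_subset[OF set_Pi_pmf_subset'[OF assms(1)]] finite_PiE_dflt) auto

text \<open>A bilinear form on [0,1]-valued functions is largest at indicators: for fixed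
  \<open>v\<close> it is linear in \<open>u\<close>, so \<open>u\<close> can be rounded to the set
  where its coefficient is positive, and then \<open>v\<close> likewise.\<close>

lemma expectation_bilinear_le:
  fixes s :: "'b \<Rightarrow> 'b \<Rightarrow> real"
  assumes fin: "finite (set_pmf \<mu>)"
    and cut: "\<And>S T. measure_pmf.expectation (pair_pmf \<mu> \<mu>)
                 (\<lambda>(x, y). s x y * of_bool (S x) * of_bool (T y)) \<le> c"
    and u: "\<And>x. 0 \<le> u x" "\<And>x. u x \<le> 1" and v: "\<And>y. 0 \<le> v y" "\<And>y. v y \<le> 1"
  shows "measure_pmf.expectation (pair_pmf \<mu> \<mu>) (\<lambda>(x, y). s x y * u x * v y) \<le> c"
proof -
  let ?A = "set_pmf \<mu>"
  define B where "B u v = measure_pmf.expectation (pair_pmf \<mu> \<mu>) (\<lambda>(x, y). s x y * u x * v y)" for u v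
  have B: "B u v = (\<Sum>x\<in>?A. \<Sum>y\<in>?A. s x y * u x * v y * (pmf \<mu> x * pmf \<mu> y))" for u v
  proof -
    have "B u v = (\<Sum>z\<in>?A \<times> ?A. (case z of (x, y) \<Rightarrow> s x y * u x * v y) * pmf (pair_pmf \<mu> \<mu>) z)"
      unfolding B_def by (rule integral_measure_pmf_real) (use fin in auto)
    then show ?thesis
      unfolding sum.cartesian_product by (simp, intro sum.cong refl) (auto simp: pmf_pair)
  qed
  have max: "t * \<phi> \<le> of_bool (\<phi> > 0) * \<phi>" if "0 \<le> t" "t \<le> 1" for t \<phi> :: real
    using that by (auto simp: mult_le_cancel_right1 mult_nonneg_nonpos not_less)
  define \<phi> where "\<phi> x = (\<Sum>y\<in>?A. s x y * v y * (pmf \<mu> x * pmf \<mu> y))" for x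
  have 1: "B u v = (\<Sum>x\<in>?A. u x * \<phi> x)" for u
    unfolding B \<phi>_def by (simp add: sum_distrib_left mult_ac)
  define S where "S x \<longleftrightarrow> \<phi> x > 0" for x
  have "B u v \<le> B (\<lambda>x. of_bool (S x)) v"
    unfolding 1 S_def by (intro sum_mono max u)
  define \<psi> where "\<psi> y = (\<Sum>x\<in>?A. s x y * of_bool (S x) * (pmf \<mu> x * pmf \<mu> y))" for y
  have 2: "B (\<lambda>x. of_bool (S x)) v = (\<Sum>y\<in>?A. v y * \<psi> y)" for v
    unfolding B \<psi>_def by (subst sum.swap) (simp add: sum_distrib_left mult_ac)
  have "B (\<lambda>x. of_bool (S x)) v \<le> B (\<lambda>x. of_bool (S x)) (\<lambda>y. of_bool (\<psi> y > 0))"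
    unfolding 2 by (intro sum_mono max v)
  also have "\<dots> \<le> c"
    using cut[of S "\<lambda>y. \<psi> y > 0"] unfolding B_def .
  finally show ?thesis using \<open>B u v \<le> B (\<lambda>x. of_bool (S x)) v\<close> by (simp add: B_def)
qed

lemma abs_expectation_bilinear_le:
  fixes s :: "'b \<Rightarrow> 'b \<Rightarrow> real"
  assumes fin: "finite (set_pmf \<mu>)"
    and cut: "\<And>S T. \<bar>measure_pmf.expectation (pair_pmf \<mu> \<mu>)
                 (\<lambda>(x, y). s x y * of_bool (S x) * of_bool (T y))\<bar> \<le> c"
    and u: "\<And>x. 0 \<le> u x" "\<And>x. u x \<le> 1" and v: "\<And>y. 0 \<le> v y" "\<And>y. v y \<le> 1"
  shows "\<bar>measure_pmf.expectation (pair_pmf \<mu> \<mu>) (\<lambda>(x, y). s x y * u x * v y)\<bar> \<le> c"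
proof -
  have neg: "measure_pmf.expectation (pair_pmf \<mu> \<mu>) (\<lambda>(x, y). (- s x y) * u x * v y)
      = - measure_pmf.expectation (pair_pmf \<mu> \<mu>) (\<lambda>(x, y). s x y * u x * v y)" for u v
    by (simp add: case_prod_unfold)
  have "measure_pmf.expectation (pair_pmf \<mu> \<mu>) (\<lambda>(x, y). (- s x y) * u x * v y) \<le> c"
    by (rule expectation_bilinear_le[OF fin _ u v], unfold neg) (use cut in \<open>simp add: abs_le_iff\<close>)
  moreover have "measure_pmf.expectation (pair_pmf \<mu> \<mu>) (\<lambda>(x, y). s x y * u x * v y) \<le> c"
    by (rule expectation_bilinear_le[OF fin _ u v]) (use cut in \<open>simp add: abs_le_iff\<close>)
  ultimately show ?thesis unfolding neg by (simp add: abs_le_iff)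
qed

text \<open>Conditioning on all coordinates except \<open>i\<close> and \<open>l\<close> leaves a bilinear form in the functions
  \<open>a\<close> and \<open>b\<close>.\<close>

lemma expectation_two_coordinates:
  fixes s :: "'b \<Rightarrow> 'b \<Rightarrow> real" and a b :: "('i \<Rightarrow> 'b) \<Rightarrow> real"
  assumes fin: "finite (set_pmf \<mu>)" "finite I" and il: "i \<in> I" "l \<in> I" "i \<noteq> l"
    and cut: "\<And>u v. \<lbrakk>\<And>x. 0 \<le> u x; \<And>x. u x \<le> 1; \<And>y. 0 \<le> v y; \<And>y. v y \<le> 1\<rbrakk> \<Longrightarrow>
       \<bar>measure_pmf.expectation (pair_pmf \<mu> \<mu>) (\<lambda>(x, y). s x y * u x * v y)\<bar> \<le> c"
    and a: "\<And>x. 0 \<le> a x" "\<And>x. a x \<le> 1" "\<And>x t. a (x(l := t)) = a x"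
    and b: "\<And>x. 0 \<le> b x" "\<And>x. b x \<le> 1" "\<And>x t. b (x(i := t)) = b x"
  shows "\<bar>measure_pmf.expectation (Pi_pmf I d (\<lambda>_. \<mu>)) (\<lambda>x. s (x i) (x l) * a x * b x)\<bar> \<le> c"
proof -
  define J where "J = I - {i, l}"
  have I: "I = insert i (insert l J)" "finite J" "l \<notin> J" "i \<notin> insert l J"
    using il fin by (auto simp: J_def)
  let ?Q = "Pi_pmf J d (\<lambda>_. \<mu>)"
  let ?r = "\<lambda>z. map_pmf (\<lambda>(x, y). z(l := y, i := x)) (pair_pmf \<mu> \<mu>)"
  have "Pi_pmf I d (\<lambda>_. \<mu>) = bind_pmf (pair_pmf \<mu> \<mu>)
      (\<lambda>w. bind_pmf ?Q (\<lambda>z. return_pmf (z(l := snd w, i := fst w))))"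
    unfolding I(1) using I
    by (simp add: Pi_pmf_insert' pair_pmf_def bind_assoc_pmf bind_return_pmf)
  also have "\<dots> = bind_pmf ?Q ?r"
    by (subst bind_commute_pmf) (simp add: map_pmf_def case_prod_unfold)
  finally have eq: "Pi_pmf I d (\<lambda>_. \<mu>) = bind_pmf ?Q ?r" .
  have finQ: "finite (set_pmf ?Q)" using I fin by (intro finite_set_Pi_pmf) auto
  let ?h = "\<lambda>x. s (x i) (x l) * a x * b x"
  have "measure_pmf.expectation (Pi_pmf I d (\<lambda>_. \<mu>)) ?h
      = (\<Sum>z\<in>set_pmf ?Q. pmf ?Q z *\<^sub>R measure_pmf.expectation (?r z) ?h)"
    unfolding eq by (rule pmf_expectation_bind) (use finQ fin in auto)
  also have "\<bar>\<dots>\<bar> \<le> (\<Sum>z\<in>set_pmf ?Q. \<bar>pmf ?Q z *\<^sub>R measure_pmf.expectation (?r z) ?h\<bar>)"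
    by (rule sum_abs)
  also have "\<dots> \<le> (\<Sum>z\<in>set_pmf ?Q. pmf ?Q z * c)"
  proof (rule sum_mono)
    fix z
    have az: "a (z(l := y, i := x)) = a (z(i := x))" for x y
      using a(3)[of "z(i := x)" y] il by (simp add: fun_upd_twist)
    have "measure_pmf.expectation (?r z) ?h
        = measure_pmf.expectation (pair_pmf \<mu> \<mu>) (\<lambda>(x, y). s x y * a (z(i := x)) * b (z(l := y)))"
      using il by (simp add: case_prod_unfold az b(3))
    also have "\<bar>\<dots>\<bar> \<le> c" by (rule cut) (use a b in auto)
    finally show "\<bar>pmf ?Q z *\<^sub>R measure_pmf.expectation (?r z) ?h\<bar> \<le> pmf ?Q z * c"
      by (simp add: abs_mult mult_left_mono)
  qed
  also have "\<dots> = c"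
    using finQ by (simp add: sum_distrib_right[symmetric] sum_pmf_eq_1)
  finally show ?thesis .
qed

text \<open>Replace \<open>f\<close> by \<open>g\<close> one pair at a time. With the other
  coordinates fixed, a single replacement changes the expectation by a bilinear form in the
  difference of \<open>f\<close> and \<open>g\<close>, to which the cut bound \<open>c\<close>
  applies.\<close>

lemma counting_lemma:
  fixes f g :: "'b \<Rightarrow> 'b \<Rightarrow> real"
  assumes fin: "finite (set_pmf \<mu>)"
    and f: "\<And>x y. 0 \<le> f x y" "\<And>x y. f x y \<le> 1" and g: "\<And>x y. 0 \<le> g x y" "\<And>x y. g x y \<le> 1"
    and u: "\<And>i x. 0 \<le> u i x" "\<And>i x. u i x \<le> 1"
    and cut: "\<And>u v. \<lbrakk>\<And>x. 0 \<le> u x; \<And>x. u x \<le> 1; \<And>y. 0 \<le> v y; \<And>y. v y \<le> 1\<rbrakk> \<Longrightarrow>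
       \<bar>measure_pmf.expectation (pair_pmf \<mu> \<mu>) (\<lambda>(x, y). (f x y - g x y) * u x * v y)\<bar> \<le> c"
  shows "\<bar>measure_pmf.expectation (tuple_pmf k \<mu>) (pattern_weight k u F f)
          - measure_pmf.expectation (tuple_pmf k \<mu>) (pattern_weight k u F g)\<bar>
       \<le> real (card (ordered_pairs k)) * c"
proof -
  let ?E = "measure_pmf.expectation (tuple_pmf k \<mu>)"
  define h where "h A q x = literal (F (fst q) (snd q))
      (if q \<in> A then g (x (fst q)) (x (snd q)) else f (x (fst q)) (x (snd q)))"
    for A :: "(nat \<times> nat) set" and q and x :: "nat \<Rightarrow> 'b"
  have h: "0 \<le> h A q x" "h A q x \<le> 1" for A q x
    unfolding h_def using f g by (auto intro: literal_bounds)
  define H where "H A x = (\<Prod>i<k. u i (x i)) * (\<Prod>q\<in>ordered_pairs k. h A q x)" for A x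
  have integrable: "integrable (tuple_pmf k \<mu>) \<phi>" for \<phi> :: "(nat \<Rightarrow> 'b) \<Rightarrow> real"
    unfolding tuple_pmf_def using fin by (intro integrable_measure_pmf_finite finite_set_Pi_pmf) auto
  have step: "\<bar>?E (H A) - ?E (H (insert q A))\<bar> \<le> c"
    if qA: "q \<in> ordered_pairs k" "q \<notin> A" for q A
  proof -
    obtain i l where q: "q = (i, l)" "i < l" "l < k"
      using qA(1) by (auto simp: ordered_pairs_def)
    define R where "R = ordered_pairs k - {q}"
    \<comment> \<open>\<open>b\<close> collects the factors that involve coordinate
      \<open>l\<close>, and \<open>a\<close> the others. Since the pair \<open>q = (i, l)\<close> is
      left out and pairs are increasing, no factor of \<open>b\<close> involves
      \<open>i\<close>.\<close>
    define a where "a x = (\<Prod>j\<in>{..<k} - {l}. u j (x j)) * (\<Prod>r\<in>{r\<in>R. fst r \<noteq> l \<and> snd r \<noteq> l}. h A r x)" for x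
    define b where "b x = u l (x l) * (\<Prod>r\<in>{r\<in>R. \<not> (fst r \<noteq> l \<and> snd r \<noteq> l)}. h A r x)" for x
    have finR: "finite R" by (simp add: R_def)
    have Hab: "H B x = h B q x * a x * b x" if "B = A \<or> B = insert q A" for B x
    proof -
      have "(\<Prod>r\<in>R. h B r x) = (\<Prod>r\<in>R. h A r x)"
        using that by (intro prod.cong refl) (auto simp: h_def R_def)
      also have "\<dots> = (\<Prod>r\<in>{r\<in>R. fst r \<noteq> l \<and> snd r \<noteq> l}. h A r x)
          * (\<Prod>r\<in>{r\<in>R. \<not> (fst r \<noteq> l \<and> snd r \<noteq> l)}. h A r x)"
        by (subst prod.union_disjoint[symmetric]) (use finR in \<open>auto intro!: prod.cong\<close>)
      finally have "(\<Prod>r\<in>ordered_pairs k. h B r x) = h B q x *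
          ((\<Prod>r\<in>{r\<in>R. fst r \<noteq> l \<and> snd r \<noteq> l}. h A r x)
          * (\<Prod>r\<in>{r\<in>R. \<not> (fst r \<noteq> l \<and> snd r \<noteq> l)}. h A r x))"
        using qA(1) by (simp add: prod.remove[of "ordered_pairs k" q] R_def)
      moreover have "(\<Prod>j<k. u j (x j)) = u l (x l) * (\<Prod>j\<in>{..<k} - {l}. u j (x j))"
        using q by (intro prod.remove) auto
      ultimately show ?thesis by (simp add: H_def a_def b_def mult_ac)
    qed
    have diff: "H A x - H (insert q A) x
        = (if F i l then 1 else - 1) * ((f (x i) (x l) - g (x i) (x l)) * a x * b x)" for x
      unfolding Hab[of A, simplified] Hab[of "insert q A", simplified] using qA q
      by (simp add: h_def literal_def algebra_simps)
    have "?E (H A) - ?E (H (insert q A)) = ?E (\<lambda>x. H A x - H (insert q A) x)"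
      by (rule Bochner_Integration.integral_diff[symmetric]) (rule integrable)+
    also have "\<bar>\<dots>\<bar> = \<bar>?E (\<lambda>x. (f (x i) (x l) - g (x i) (x l)) * a x * b x)\<bar>"
      unfolding diff by simp
    also have "\<dots> \<le> c"
      unfolding tuple_pmf_def
    proof (rule expectation_two_coordinates[OF fin])
      show "\<bar>measure_pmf.expectation (pair_pmf \<mu> \<mu>) (\<lambda>(x, y). (f x y - g x y) * u x * v y)\<bar> \<le> c"
        if "\<And>x. 0 \<le> u x" "\<And>x. u x \<le> 1" "\<And>y. 0 \<le> v y" "\<And>y. v y \<le> 1" for u v
        by (rule cut) (use that in auto)
      show "0 \<le> a x" "a x \<le> 1" for x
        unfolding a_def by (auto intro!: mult_nonneg_nonneg mult_le_one prod_nonneg prod_le_1 simp: u h)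
      show "0 \<le> b x" "b x \<le> 1" for x
        unfolding b_def by (auto intro!: mult_nonneg_nonneg mult_le_one prod_nonneg prod_le_1 simp: u h)
      show "a (x(l := t)) = a x" for x t
        unfolding a_def h_def by (intro arg_cong2[where f="(*)"] prod.cong) auto
      show "b (x(i := t)) = b x" for x t
        unfolding b_def h_def using q
        by (intro arg_cong2[where f="(*)"] prod.cong) (auto simp: R_def ordered_pairs_def)
    qed (use q in auto)
    finally show ?thesis .
  qed
  have main: "\<bar>?E (H {}) - ?E (H A)\<bar> \<le> real (card A) * c" if "finite A" "A \<subseteq> ordered_pairs k" for A
    using that
  proof (induction A rule: finite_induct)
    case (insert q A)
    then show ?case using step[of q A] by (auto simp: algebra_simps)
  qed simp
  have "H {} = pattern_weight k u F f" "H (ordered_pairs k) = pattern_weight k u F g"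
    by (auto simp: fun_eq_iff H_def h_def pattern_weight_def case_prod_unfold intro!: prod.cong)
  then show ?thesis using main[of "ordered_pairs k"] by simp
qed

section \<open>Types of vertices and greedy regularity partitions\<close>

primrec vtype :: "('a \<Rightarrow> nat \<Rightarrow> bool) \<Rightarrow> nat \<Rightarrow> 'a \<Rightarrow> bool list" where
  "vtype B 0 x = []"
| "vtype B (Suc m) x = B x m # vtype B m x"

lemma length_vtype [simp]: "length (vtype B m x) = m"
  by (induction m) auto

lemma drop_vtype: "drop n (vtype B (m + n) x) = vtype B m x"
  by (induction n) auto

lemma vtype_cong: "(\<And>n. n < m \<Longrightarrow> B x n = B' x n) \<Longrightarrow> vtype B m x = vtype B' m x"
  by (induction m) auto

definition type_freq :: "'a pmf \<Rightarrow> ('a \<Rightarrow> nat \<Rightarrow> bool) \<Rightarrow> bool list \<Rightarrow> real" where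
  "type_freq \<mu> B w = measure \<mu> {x. vtype B (length w) x = w}"

definition edge_freq ::
  "'a pmf \<Rightarrow> ('a \<Rightarrow> nat \<Rightarrow> bool) \<Rightarrow> ('a \<Rightarrow> 'a \<Rightarrow> bool) \<Rightarrow> bool list \<Rightarrow> bool list \<Rightarrow> real" where
  "edge_freq \<mu> B f a b = measure (pair_pmf \<mu> \<mu>)
     {z. f (fst z) (snd z) \<and> vtype B (length a) (fst z) = a \<and> vtype B (length b) (snd z) = b}"

lemma edge_freq_le_product: "edge_freq \<mu> B f a b \<le> type_freq \<mu> B a * type_freq \<mu> B b"
  unfolding edge_freq_def type_freq_def measure_pair_pmf_Times[symmetric]
  by (rule measure_pmf.finite_measure_mono) auto

text \<open>Finite graphs obey the same axioms as their limits, so the facts on energy and density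
  are available both before and after the limit.\<close>

lemma step_system_freq: "step_system (type_freq \<mu> B) (edge_freq \<mu> B f)"
proof
  fix w a b
  show "type_freq \<mu> B w = type_freq \<mu> B (True # w) + type_freq \<mu> B (False # w)"
    unfolding type_freq_def
    by (subst measure_pmf.finite_measure_Union[symmetric]) (auto intro!: arg_cong[where f="measure \<mu>"])
  let ?S = "\<lambda>s t. {z. f (fst z) (snd z) \<and> vtype B (Suc (length a)) (fst z) = s # a
      \<and> vtype B (Suc (length b)) (snd z) = t # b}"
  let ?m = "measure (pair_pmf \<mu> \<mu>)"
  have "edge_freq \<mu> B f a b = ?m ((?S True True \<union> ?S True False) \<union> (?S False True \<union> ?S False False))"
    unfolding edge_freq_def by (intro arg_cong[where f="?m"]) auto
  also have "\<dots> = ?m (?S True True) + ?m (?S True False) + (?m (?S False True) + ?m (?S False False))"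
    by (subst measure_pmf.finite_measure_Union, simp, simp, force)+ simp
  finally show "edge_freq \<mu> B f a b = edge_freq \<mu> B f (True # a) (True # b) + edge_freq \<mu> B f (True # a) (False # b)
      + edge_freq \<mu> B f (False # a) (True # b) + edge_freq \<mu> B f (False # a) (False # b)"
    unfolding edge_freq_def by simp
qed (auto simp: type_freq_def edge_freq_def intro: edge_freq_le_product[unfolded type_freq_def edge_freq_def])

definition type_dens ::
  "'a pmf \<Rightarrow> ('a \<Rightarrow> nat \<Rightarrow> bool) \<Rightarrow> ('a \<Rightarrow> 'a \<Rightarrow> bool) \<Rightarrow> bool list \<Rightarrow> bool list \<Rightarrow> real" where
  "type_dens \<mu> B f = step_system.dens (type_freq \<mu> B) (edge_freq \<mu> B f)"

text \<open>Serves several laws at once: \<open>C\<close> is adjacency or \<open>True\<close>, and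
  \<open>\<tau>\<close> gives the type of a vertex, of a pair or of a tuple.\<close>

lemma expectation_of_bool_finite_range:
  fixes \<phi> :: "'c \<Rightarrow> real"
  assumes "finite A" "\<And>z. \<tau> z \<in> A"
  shows "measure_pmf.expectation \<nu> (\<lambda>z. of_bool (C z) * \<phi> (\<tau> z)) = (\<Sum>a\<in>A. measure \<nu> {z. C z \<and> \<tau> z = a} * \<phi> a)"
proof -
  have "of_bool (C z) * \<phi> (\<tau> z) = (\<Sum>a\<in>A. indicator {z. C z \<and> \<tau> z = a} z * \<phi> a)" for z
  proof -
    have "(\<Sum>a\<in>A. indicator {z. C z \<and> \<tau> z = a} z * \<phi> a) = (\<Sum>a\<in>A. if a = \<tau> z then of_bool (C z) * \<phi> a else 0)"
      by (intro sum.cong) (auto simp: indicator_def)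
    then show ?thesis using assms by (simp add: sum.delta')
  qed
  then have "measure_pmf.expectation \<nu> (\<lambda>z. of_bool (C z) * \<phi> (\<tau> z))
      = (\<Sum>a\<in>A. measure_pmf.expectation \<nu> (\<lambda>z. indicator {z. C z \<and> \<tau> z = a} z * \<phi> a))"
    by (simp, subst Bochner_Integration.integral_sum)
       (auto intro!: integrable_mult_left integrable_real_indicator simp: measure_pmf.emeasure_eq_measure)
  then show ?thesis by simp
qed

lemma expectation_edge_types:
  "measure_pmf.expectation (pair_pmf \<mu> \<mu>)
     (\<lambda>z. of_bool (f (fst z) (snd z)) * \<phi> (vtype B m (fst z)) (vtype B m (snd z)))
   = (\<Sum>a\<in>words m. \<Sum>b\<in>words m. edge_freq \<mu> B f a b * \<phi> a b)"
proof -
  have fin: "finite (words m \<times> words m)" by simp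
  have "(vtype B m (fst z), vtype B m (snd z)) \<in> words m \<times> words m" for z by simp
  from expectation_of_bool_finite_range[where C = "\<lambda>z. f (fst z) (snd z)"
      and \<phi> = "\<lambda>(a, b). \<phi> a b" and \<nu> = "pair_pmf \<mu> \<mu>", OF fin this]
  show ?thesis
    unfolding sum.cartesian_product
    by (auto simp: edge_freq_def case_prod_unfold prod_eq_iff intro!: sum.cong)
qed

lemma expectation_pair_types:
  "measure_pmf.expectation (pair_pmf \<mu> \<mu>) (\<lambda>z. \<phi> (vtype B m (fst z)) (vtype B m (snd z)))
   = (\<Sum>a\<in>words m. \<Sum>b\<in>words m. type_freq \<mu> B a * type_freq \<mu> B b * \<phi> a b)"
proof -
  have "edge_freq \<mu> B (\<lambda>_ _. True) a b = type_freq \<mu> B a * type_freq \<mu> B b" for a b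
    unfolding edge_freq_def type_freq_def measure_pair_pmf_Times[symmetric]
    by (intro arg_cong[where f = "measure (pair_pmf \<mu> \<mu>)"]) auto
  then show ?thesis using expectation_edge_types[where f = "\<lambda>_ _. True" and \<phi> = \<phi> and B = B and \<mu> = \<mu> and m = m] by simp
qed

text \<open>The signed error of the step approximation at depth \<open>m\<close> on the rectangle of
  \<open>S\<close> and \<open>T\<close>; its largest absolute value is the cut norm of the
  error.\<close>

definition discrepancy ::
  "'a pmf \<Rightarrow> ('a \<Rightarrow> 'a \<Rightarrow> bool) \<Rightarrow> ('a \<Rightarrow> nat \<Rightarrow> bool) \<Rightarrow> nat \<Rightarrow> ('a \<Rightarrow> bool) \<Rightarrow> ('a \<Rightarrow> bool) \<Rightarrow> real" where
  "discrepancy \<mu> f B m S T = measure_pmf.expectation (pair_pmf \<mu> \<mu>)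
     (\<lambda>(x, y). (of_bool (f x y) - type_dens \<mu> B f (vtype B m x) (vtype B m y)) * of_bool (S x) * of_bool (T y))"

lemma weighted_sum_square_le:
  fixes w t :: "'i \<Rightarrow> real"
  assumes "\<And>i. i \<in> I \<Longrightarrow> 0 \<le> w i" "sum w I = 1"
  shows "(\<Sum>i\<in>I. w i * t i)\<^sup>2 \<le> (\<Sum>i\<in>I. w i * (t i)\<^sup>2)"
proof -
  let ?c = "\<Sum>i\<in>I. w i * t i"
  have "0 \<le> (\<Sum>i\<in>I. w i * (t i - ?c)\<^sup>2)" using assms by (intro sum_nonneg) auto
  also have "\<dots> = (\<Sum>i\<in>I. w i * (t i)\<^sup>2 - (w i * t i) * (2 * ?c) + w i * ?c\<^sup>2)"
    by (intro sum.cong refl) (simp add: power2_eq_square algebra_simps)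
  also have "\<dots> = (\<Sum>i\<in>I. w i * (t i)\<^sup>2) - ?c * (2 * ?c) + sum w I * ?c\<^sup>2"
    by (simp only: sum.distrib sum_subtractf sum_distrib_right)
  finally show ?thesis using assms(2) by (simp add: power2_eq_square)
qed

text \<open>Energy increment. The two sets are unions of types of length \<open>m + 2\<close>, so
  the discrepancy is a weighted average of fine minus coarse densities, restricted to a rectangle;
  by convexity of the square and \<open>energy_diff\<close> its square is at most the energy
  gain.\<close>

lemma discrepancy_energy:
  fixes \<mu> :: "'a pmf" and B :: "'a \<Rightarrow> nat \<Rightarrow> bool" and f :: "'a \<Rightarrow> 'a \<Rightarrow> bool"
  defines "en \<equiv> step_system.energy (type_freq \<mu> B) (edge_freq \<mu> B f)"
  shows "(discrepancy \<mu> f B m (\<lambda>x. B x m) (\<lambda>x. B x (Suc m)))\<^sup>2 \<le> en (m + 2) - en m"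
proof -
  interpret step_system "type_freq \<mu> B" "edge_freq \<mu> B f" by (rule step_system_freq)
  let ?p = "type_freq \<mu> B" and ?e = "edge_freq \<mu> B f"
  let ?W = "words (m + 2)"
  \<comment> \<open>Newest bit first: in a word of length \<open>m + 2\<close>, position 1 holds bit
    \<open>m\<close>, membership in the first set, and position 0 holds bit \<open>m + 1\<close>,
    membership in the second.\<close>
  define sel :: "bool list \<Rightarrow> bool list \<Rightarrow> real" where "sel a b = of_bool (a ! 1) * of_bool (b ! 0)" for a b
  let ?sel' = "\<lambda>a b. dens (drop 2 a) (drop 2 b) * sel a b"
  let ?t = "vtype B (m + 2)"
  have int: "integrable (pair_pmf \<mu> \<mu>) h" if "\<And>z. \<bar>h z\<bar> \<le> 1" for h :: "'a \<times> 'a \<Rightarrow> real"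
    using that by (intro measure_pmf.integrable_const_bound[where B = 1]) auto
  have "discrepancy \<mu> f B m (\<lambda>x. B x m) (\<lambda>x. B x (Suc m)) =
      measure_pmf.expectation (pair_pmf \<mu> \<mu>)
        (\<lambda>z. of_bool (f (fst z) (snd z)) * sel (?t (fst z)) (?t (snd z)) - ?sel' (?t (fst z)) (?t (snd z)))"
    unfolding discrepancy_def type_dens_def
    by (intro Bochner_Integration.integral_cong refl) (auto simp: sel_def algebra_simps)
  also have "\<dots> = (\<Sum>(a, b)\<in>?W \<times> ?W. ?e a b * sel a b)
      - (\<Sum>(a, b)\<in>?W \<times> ?W. ?p a * ?p b * ?sel' a b)"
    unfolding sum.cartesian_product[symmetric] expectation_edge_types[where \<phi> = sel, symmetric]
      expectation_pair_types[where \<phi> = ?sel', symmetric]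
    by (rule Bochner_Integration.integral_diff; rule int)
       (auto simp: sel_def abs_mult dens_nonneg dens_le_1)
  also have "\<dots> = (\<Sum>(a, b)\<in>?W \<times> ?W. ?p a * ?p b * ((dens a b - dens (drop 2 a) (drop 2 b)) * sel a b))"
    unfolding sum_subtractf[symmetric]
    by (intro sum.cong refl) (auto simp: p_p_dens[symmetric] algebra_simps simp del: p_p_dens)
  finally have "(discrepancy \<mu> f B m (\<lambda>x. B x m) (\<lambda>x. B x (Suc m)))\<^sup>2
      = (\<Sum>z\<in>?W \<times> ?W. (?p (fst z) * ?p (snd z)) *
          ((dens (fst z) (snd z) - dens (drop 2 (fst z)) (drop 2 (snd z))) * sel (fst z) (snd z)))\<^sup>2"
    by (simp add: case_prod_unfold)
  also have "\<dots> \<le> (\<Sum>z\<in>?W \<times> ?W. (?p (fst z) * ?p (snd z)) *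
      ((dens (fst z) (snd z) - dens (drop 2 (fst z)) (drop 2 (snd z))) * sel (fst z) (snd z))\<^sup>2)"
  proof (rule weighted_sum_square_le)
    show "(\<Sum>z\<in>?W \<times> ?W. ?p (fst z) * ?p (snd z)) = 1"
      using sum_p_p[of "m + 2"] by (simp only: sum.cartesian_product case_prod_unfold)
  qed (simp add: p_nonneg)
  also have "\<dots> \<le> (\<Sum>z\<in>?W \<times> ?W. (?p (fst z) * ?p (snd z)) *
      (dens (fst z) (snd z) - dens (drop 2 (fst z)) (drop 2 (snd z)))\<^sup>2)"
    by (intro sum_mono mult_left_mono) (auto simp: sel_def p_nonneg)
  also have "\<dots> = energy (m + 2) - energy m"
    using energy_diff[where m = m and n = 2] by (simp only: sum.cartesian_product case_prod_unfold)
  finally show ?thesis by (simp add: en_def)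
qed

text \<open>The discrepancy at depth \<open>m\<close> reads only the bits below \<open>m\<close>.
  Hence the greedy construction may define later bits without spoiling the maximality reached
  earlier.\<close>

lemma discrepancy_cong:
  assumes "\<And>x n. n < m \<Longrightarrow> B x n = B' x n"
  shows "discrepancy \<mu> f B m S T = discrepancy \<mu> f B' m S T"
proof -
  have v: "vtype B m = vtype B' m" using assms by (auto intro!: vtype_cong)
  have "type_dens \<mu> B f a b = type_dens \<mu> B' f a b" if "length a = m" "length b = m" for a b
    using that v by (simp add: type_dens_def step_system.dens_def[OF step_system_freq] type_freq_def edge_freq_def)
  then show ?thesis unfolding discrepancy_def v by (intro Bochner_Integration.integral_cong refl) auto
qed

text \<open>Only the traces of the sets on the finite support matter, which leaves finitely many
  values.\<close>

lemma discrepancy_maximal_sets: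
  assumes "finite (set_pmf \<mu>)"
  shows "\<exists>S T. \<forall>S' T'. \<bar>discrepancy \<mu> f B m S' T'\<bar> \<le> \<bar>discrepancy \<mu> f B m S T\<bar>"
proof -
  let ?A = "set_pmf \<mu>"
  let ?d = "\<lambda>z. \<bar>discrepancy \<mu> f B m (\<lambda>x. x \<in> fst z) (\<lambda>x. x \<in> snd z)\<bar>"
  have "finite (?d ` (Pow ?A \<times> Pow ?A))" "?d ` (Pow ?A \<times> Pow ?A) \<noteq> {}" using assms by auto
  from Max_in[OF this] obtain z where z: "Max (?d ` (Pow ?A \<times> Pow ?A)) = ?d z" by auto
  have "\<bar>discrepancy \<mu> f B m S' T'\<bar> \<le> ?d z" for S' T'
  proof -
    have "discrepancy \<mu> f B m S' T' = discrepancy \<mu> f B m (\<lambda>x. x \<in> {x\<in>?A. S' x}) (\<lambda>x. x \<in> {x\<in>?A. T' x})"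
      unfolding discrepancy_def
      by (intro integral_cong_AE) (auto simp: AE_measure_pmf_iff)
    then have eq: "\<bar>discrepancy \<mu> f B m S' T'\<bar> = ?d ({x\<in>?A. S' x}, {x\<in>?A. T' x})" by simp
    have "?d ({x\<in>?A. S' x}, {x\<in>?A. T' x}) \<le> Max (?d ` (Pow ?A \<times> Pow ?A))"
      using assms by (intro Max_ge imageI) auto
    then show ?thesis unfolding z eq .
  qed
  then show ?thesis by blast
qed

text \<open>The Frieze--Kannan partition: bits \<open>R + 2 * i\<close> and \<open>R + 2 * i + 1\<close> of a vertex record its
  membership in a pair of sets of maximal discrepancy for the partition by the earlier bits.\<close>

lemma greedy_types:
  fixes \<mu> :: "'a pmf" and \<beta> :: "'a \<Rightarrow> nat \<Rightarrow> bool"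
  assumes "finite (set_pmf \<mu>)"
  obtains B where "\<And>x r. r < R \<Longrightarrow> B x r = \<beta> x r"
    and "\<And>i S T. \<bar>discrepancy \<mu> f B (R + 2 * i) S T\<bar>
       \<le> \<bar>discrepancy \<mu> f B (R + 2 * i) (\<lambda>x. B x (R + 2 * i)) (\<lambda>x. B x (Suc (R + 2 * i)))\<bar>"
proof -
  define best where "best B m = (SOME z. \<forall>S' T'. \<bar>discrepancy \<mu> f B m S' T'\<bar> \<le> \<bar>discrepancy \<mu> f B m (fst z) (snd z)\<bar>)" for B m
  have best: "\<bar>discrepancy \<mu> f B m S' T'\<bar> \<le> \<bar>discrepancy \<mu> f B m (fst (best B m)) (snd (best B m))\<bar>" for B m S' T'
  proof -
    have "\<exists>z. \<forall>S' T'. \<bar>discrepancy \<mu> f B m S' T'\<bar> \<le> \<bar>discrepancy \<mu> f B m (fst z) (snd z)\<bar>"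
      using discrepancy_maximal_sets[OF assms, of f B m] by simp
    from someI_ex[OF this] show ?thesis unfolding best_def by blast
  qed
  define Bs where "Bs = rec_nat \<beta> (\<lambda>i B x n.
      if n = R + 2 * i then fst (best B (R + 2 * i)) x
      else if n = Suc (R + 2 * i) then snd (best B (R + 2 * i)) x else B x n)"
  have Bs_Suc: "Bs (Suc i) x n = (if n = R + 2 * i then fst (best (Bs i) (R + 2 * i)) x
      else if n = Suc (R + 2 * i) then snd (best (Bs i) (R + 2 * i)) x else Bs i x n)" for i x n
    by (simp add: Bs_def)
  have stable: "Bs (i + j) x n = Bs i x n" if "n < R + 2 * i" for i j x n
    using that by (induction j) (auto simp: Bs_Suc)
  \<comment> \<open>Stage \<open>i\<close> settles the bits below \<open>R + 2 * i\<close>, so bit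
    \<open>n\<close> is final at stage \<open>Suc n\<close> at the latest.\<close>
  define B where "B x n = Bs (Suc n) x n" for x n
  have B: "B x n = Bs i x n" if "n < R + 2 * i" for i x n
  proof (cases "i \<le> Suc n")
    case True
    then show ?thesis using stable[OF that, of "Suc n - i" x] by (simp add: B_def)
  next
    case False
    then show ?thesis using stable[of n "Suc n" "i - Suc n" x] by (simp add: B_def)
  qed
  show ?thesis
  proof (rule that)
    show "B x r = \<beta> x r" if "r < R" for x r using B[of r 0 x] that by (simp add: Bs_def)
    fix i S T
    let ?m = "R + 2 * i"
    have eq: "discrepancy \<mu> f B ?m S T = discrepancy \<mu> f (Bs i) ?m S T" for S T
      by (intro discrepancy_cong B)
    have "(\<lambda>x. B x ?m) = fst (best (Bs i) ?m)" "(\<lambda>x. B x (Suc ?m)) = snd (best (Bs i) ?m)"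
      using B[of ?m "Suc i"] B[of "Suc ?m" "Suc i"] by (auto simp: Bs_Suc)
    then show "\<bar>discrepancy \<mu> f B ?m S T\<bar> \<le> \<bar>discrepancy \<mu> f B ?m (\<lambda>x. B x ?m) (\<lambda>x. B x (Suc ?m))\<bar>"
      using best[of "Bs i" ?m S T] by (simp only: eq)
  qed
qed

section \<open>Compactness of graph sequences\<close>

lemma diagonal_convergent_subseq:
  fixes X :: "'i::countable \<Rightarrow> nat \<Rightarrow> real"
  assumes bdd: "\<And>i n. \<bar>X i n\<bar> \<le> 1"
  obtains \<rho> where "strict_mono (\<rho> :: nat \<Rightarrow> nat)" "\<And>i. convergent (\<lambda>n. X i (\<rho> n))"
proof -
  interpret subseqs "\<lambda>k s. convergent (\<lambda>n. X (from_nat k) (s n))"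
  proof
    fix k and s :: "nat \<Rightarrow> nat"
    have "\<forall>n. X (from_nat k) (s n) \<in> {-1..1}" using bdd by (simp add: abs_le_iff minus_le_iff)
    then obtain l r where "strict_mono r" "((\<lambda>n. X (from_nat k) (s n)) \<circ> r) \<longlonglongrightarrow> l"
      using compact_imp_seq_compact[OF compact_Icc] unfolding seq_compact_def by metis
    then show "\<exists>r'. strict_mono r' \<and> convergent (\<lambda>n. X (from_nat k) ((s \<circ> r') n))"
      by (auto simp: convergent_def o_def)
  qed
  have "convergent (\<lambda>n. X i (diagseq n))" for i
  proof -
    let ?k = "to_nat i"
    have "convergent (\<lambda>n. X (from_nat ?k) ((diagseq \<circ> ((+) (Suc ?k))) n))"
    proof (rule diagseq_holds)
      fix r s n assume "strict_mono (r :: nat \<Rightarrow> nat)" "convergent (\<lambda>i. X (from_nat n) (s i))"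
      then show "convergent (\<lambda>i. X (from_nat n) ((s \<circ> r) i))"
        using convergent_subseq_convergent[of "\<lambda>i. X (from_nat n) (s i)" r] by (simp add: o_def)
    qed
    then have "convergent (\<lambda>n. X i (diagseq (n + Suc ?k)))" by (simp add: add.commute)
    then show ?thesis by (subst (asm) convergent_ignore_initial_segment)
  qed
  then show ?thesis using that subseq_diagseq by blast
qed

text \<open>Tonelli separates coordinates \<open>i\<close> and \<open>l\<close> from the rest, where
  the product integrates factor by factor.\<close>

lemma nn_integral_product_pair:
  fixes u :: "nat \<Rightarrow> real \<Rightarrow> ennreal" and h :: "real \<times> real \<Rightarrow> ennreal"
  assumes "finite I" "i \<in> I" "l \<in> I" "i \<noteq> l"
    and [measurable]: "\<And>r. u r \<in> borel_measurable unif" "h \<in> borel_measurable (unif \<Otimes>\<^sub>M unif)"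
  shows "(\<integral>\<^sup>+x. (\<Prod>r\<in>I. u r (x r)) * h (x i, x l) \<partial>PiM I (\<lambda>_. unif))
    = (\<Prod>r\<in>I - {i, l}. \<integral>\<^sup>+y. u r y \<partial>unif) * (\<integral>\<^sup>+z. u i (fst z) * u l (snd z) * h z \<partial>(unif \<Otimes>\<^sub>M unif))"
proof -
  define J where "J = I - {i, l}"
  have I: "I = insert i (insert l J)" "finite J" "l \<notin> J" "i \<notin> insert l J"
    using assms by (auto simp: J_def)
  have m1[measurable]: "(\<lambda>x. (\<Prod>r\<in>I. u r (x r)) * h (x i, x l)) \<in> borel_measurable (PiM I (\<lambda>_. unif))"
    using assms by measurable
  have m2[measurable]: "(\<lambda>x. (\<Prod>r\<in>I. u r ((x(i := y)) r)) * h ((x(i := y)) i, (x(i := y)) l))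
      \<in> borel_measurable (PiM (insert l J) (\<lambda>_. unif))" for y
  proof -
    have "(\<lambda>x. x(i := y)) \<in> measurable (PiM (insert l J) (\<lambda>_. unif)) (PiM I (\<lambda>_. unif))"
      unfolding I(1) by (rule measurable_fun_upd[where J = "insert l J"]) auto
    from measurable_compose[OF this m1] show ?thesis .
  qed
  have "(\<integral>\<^sup>+x. (\<Prod>r\<in>I. u r (x r)) * h (x i, x l) \<partial>PiM I (\<lambda>_. unif))
     = (\<integral>\<^sup>+y. \<integral>\<^sup>+y'. \<integral>\<^sup>+x. (\<Prod>r\<in>I. u r ((x(l := y', i := y)) r)) *
          h ((x(l := y', i := y)) i, (x(l := y', i := y)) l) \<partial>PiM J (\<lambda>_. unif) \<partial>unif \<partial>unif)"
    using unif_prod.product_nn_integral_insert_rev[of "insert l J" i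
        "\<lambda>x. (\<Prod>r\<in>I. u r (x r)) * h (x i, x l)"] I(2-4)
      unif_prod.product_nn_integral_insert_rev[OF I(2,3) m2]
    by (simp add: I(1)[symmetric])
  also have "\<dots> = (\<integral>\<^sup>+y. \<integral>\<^sup>+y'. (\<Prod>r\<in>J. \<integral>\<^sup>+t. u r t \<partial>unif) * (u i y * u l y' * h (y, y')) \<partial>unif \<partial>unif)"
  proof (intro nn_integral_cong)
    fix y y'
    have "(\<Prod>r\<in>I. u r ((x(l := y', i := y)) r)) * h ((x(l := y', i := y)) i, (x(l := y', i := y)) l)
        = (\<Prod>r\<in>J. u r (x r)) * (u i y * u l y' * h (y, y'))" for x
    proof -
      have "(\<Prod>r\<in>J. u r ((x(l := y', i := y)) r)) = (\<Prod>r\<in>J. u r (x r))"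
        using I by (intro prod.cong) auto
      then show ?thesis unfolding I(1) using I(2-4) by (simp add: mult_ac)
    qed
    then have "(\<integral>\<^sup>+x. (\<Prod>r\<in>I. u r ((x(l := y', i := y)) r)) *
          h ((x(l := y', i := y)) i, (x(l := y', i := y)) l) \<partial>PiM J (\<lambda>_. unif))
        = (\<integral>\<^sup>+x. (\<Prod>r\<in>J. u r (x r)) * (u i y * u l y' * h (y, y')) \<partial>PiM J (\<lambda>_. unif))"
      by simp
    also have "\<dots> = (\<integral>\<^sup>+x. (\<Prod>r\<in>J. u r (x r)) \<partial>PiM J (\<lambda>_. unif)) * (u i y * u l y' * h (y, y'))"
      by (rule nn_integral_multc) measurable
    also have "(\<integral>\<^sup>+x. (\<Prod>r\<in>J. u r (x r)) \<partial>PiM J (\<lambda>_. unif)) = (\<Prod>r\<in>J. \<integral>\<^sup>+t. u r t \<partial>unif)"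
      using I(2) by (intro unif_prod.product_nn_integral_prod) auto
    finally show "(\<integral>\<^sup>+x. (\<Prod>r\<in>I. u r ((x(l := y', i := y)) r)) *
          h ((x(l := y', i := y)) i, (x(l := y', i := y)) l) \<partial>PiM J (\<lambda>_. unif))
        = (\<Prod>r\<in>J. \<integral>\<^sup>+t. u r t \<partial>unif) * (u i y * u l y' * h (y, y'))" .
  qed
  also have "\<dots> = (\<Prod>r\<in>J. \<integral>\<^sup>+t. u r t \<partial>unif) * (\<integral>\<^sup>+y. \<integral>\<^sup>+y'. u i y * u l y' * h (y, y') \<partial>unif \<partial>unif)"
    by (subst nn_integral_cmult, measurable)+
  also have "(\<integral>\<^sup>+y. \<integral>\<^sup>+y'. u i y * u l y' * h (y, y') \<partial>unif \<partial>unif)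
      = (\<integral>\<^sup>+z. u i (fst z) * u l (snd z) * h z \<partial>(unif \<Otimes>\<^sub>M unif))"
    using unif.nn_integral_fst[of "\<lambda>z. u i (fst z) * u l (snd z) * h z" unif] by simp
  finally show ?thesis by (simp add: J_def)
qed

text \<open>With \<open>u\<close> marking prescribed cells and \<open>g\<close> an error at one
  pair, this integrates the error of that pair while the coordinates are confined to their
  cells.\<close>

lemma integral_product_pair:
  fixes u :: "nat \<Rightarrow> real \<Rightarrow> real" and g :: "real \<times> real \<Rightarrow> real"
  assumes I: "finite I" "i \<in> I" "l \<in> I" "i \<noteq> l"
    and [measurable]: "\<And>r. u r \<in> borel_measurable unif" "g \<in> borel_measurable (unif \<Otimes>\<^sub>M unif)"
    and u: "\<And>r t. 0 \<le> u r t" "\<And>r t. u r t \<le> 1" and g: "\<And>z. 0 \<le> g z"  "\<And>z. g z \<le> 1"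
  shows "(\<integral>x. (\<Prod>r\<in>I. u r (x r)) * g (x i, x l) \<partial>PiM I (\<lambda>_. unif))
    = (\<Prod>r\<in>I - {i, l}. \<integral>t. u r t \<partial>unif) * (\<integral>z. u i (fst z) * u l (snd z) * g z \<partial>(unif \<Otimes>\<^sub>M unif))"
proof -
  have iu: "integrable unif (u r)" for r
    using u by (intro unif.integrable_const_bound[where B = 1]) auto
  have ig: "integrable (unif \<Otimes>\<^sub>M unif) (\<lambda>z. u i (fst z) * u l (snd z) * g z)"
    using u g by (intro unif2.P.integrable_const_bound[where B = 1])
      (auto simp: abs_mult intro!: mult_le_one mult_nonneg_nonneg)
  have m: "(\<lambda>x. (\<Prod>r\<in>I. u r (x r)) * g (x i, x l)) \<in> borel_measurable (PiM I (\<lambda>_. unif))"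
    using I by measurable
  have "(\<integral>\<^sup>+x. ennreal ((\<Prod>r\<in>I. u r (x r)) * g (x i, x l)) \<partial>PiM I (\<lambda>_. unif))
      = (\<integral>\<^sup>+x. (\<Prod>r\<in>I. ennreal (u r (x r))) * ennreal (g (x i, x l)) \<partial>PiM I (\<lambda>_. unif))"
    using u g by (simp add: prod_ennreal ennreal_mult prod_nonneg)
  also have "\<dots> = (\<Prod>r\<in>I - {i, l}. \<integral>\<^sup>+t. ennreal (u r t) \<partial>unif)
      * (\<integral>\<^sup>+z. ennreal (u i (fst z)) * ennreal (u l (snd z)) * ennreal (g z) \<partial>(unif \<Otimes>\<^sub>M unif))"
    by (rule nn_integral_product_pair[OF I, of "\<lambda>r t. ennreal (u r t)" "\<lambda>z. ennreal (g z)"]) measurable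
  also have "(\<lambda>z. ennreal (u i (fst z)) * ennreal (u l (snd z)) * ennreal (g z))
      = (\<lambda>z. ennreal (u i (fst z) * u l (snd z) * g z))"
    using u g by (simp add: ennreal_mult)
  also have "(\<integral>\<^sup>+z. ennreal (u i (fst z) * u l (snd z) * g z) \<partial>(unif \<Otimes>\<^sub>M unif))
      = ennreal (\<integral>z. u i (fst z) * u l (snd z) * g z \<partial>(unif \<Otimes>\<^sub>M unif))"
    using u g ig by (intro nn_integral_eq_integral) auto
  also have "(\<Prod>r\<in>I - {i, l}. \<integral>\<^sup>+t. ennreal (u r t) \<partial>unif) = ennreal (\<Prod>r\<in>I - {i, l}. \<integral>t. u r t \<partial>unif)"
    using u iu by (simp add: nn_integral_eq_integral prod_ennreal)
  finally have "(\<integral>\<^sup>+x. ennreal ((\<Prod>r\<in>I. u r (x r)) * g (x i, x l)) \<partial>PiM I (\<lambda>_. unif))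
      = ennreal ((\<Prod>r\<in>I - {i, l}. \<integral>t. u r t \<partial>unif) * (\<integral>z. u i (fst z) * u l (snd z) * g z \<partial>(unif \<Otimes>\<^sub>M unif)))"
    using u g by (simp add: ennreal_mult prod_nonneg)
  moreover have "0 \<le> (\<Prod>r\<in>I - {i, l}. \<integral>t. u r t \<partial>unif) * (\<integral>z. u i (fst z) * u l (snd z) * g z \<partial>(unif \<Otimes>\<^sub>M unif))"
    using u g by (intro mult_nonneg_nonneg prod_nonneg integral_nonneg_AE) auto
  ultimately show ?thesis
    using u g m by (subst integral_eq_nn_integral) (auto intro!: mult_nonneg_nonneg prod_nonneg)
qed

lemma integral_pair_marginal:
  fixes g :: "real \<times> real \<Rightarrow> real" and I :: "nat set"
  assumes I: "finite I" "i \<in> I" "l \<in> I" "i \<noteq> l"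
    and g: "g \<in> borel_measurable (unif \<Otimes>\<^sub>M unif)" "\<And>z. 0 \<le> g z" "\<And>z. g z \<le> 1"
  shows "(\<integral>x. g (x i, x l) \<partial>PiM I (\<lambda>_. unif)) = (\<integral>z. g z \<partial>(unif \<Otimes>\<^sub>M unif))"
  using integral_product_pair[OF I, of "\<lambda>_ _. 1" g] g by (simp add: unif.prob_space[simplified])

lemma measurable_pattern_weight:
  fixes W :: "real \<times> real \<Rightarrow> real"
  assumes [measurable]: "W \<in> borel_measurable (unif \<Otimes>\<^sub>M unif)" "\<And>i. u i \<in> borel_measurable unif"
  shows "pattern_weight k u F (\<lambda>x y. W (x, y)) \<in> borel_measurable (PiM {..<k} (\<lambda>_. unif))"
proof -
  have "(\<lambda>x. literal (F i l) (W (x i, x l))) \<in> borel_measurable (PiM {..<k} (\<lambda>_. unif))"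
    if "(i, l) \<in> ordered_pairs k" for i l
  proof -
    have [measurable]: "i \<in> {..<k}" "l \<in> {..<k}" using that by (auto simp: ordered_pairs_def)
    show ?thesis unfolding literal_def by measurable
  qed
  then have "(\<lambda>x. (\<Prod>q\<in>ordered_pairs k. literal (F (fst q) (snd q)) (W (x (fst q), x (snd q)))))
      \<in> borel_measurable (PiM {..<k} (\<lambda>_. unif))"
    by (intro borel_measurable_prod) auto
  moreover have "(\<lambda>x. (\<Prod>i<k. u i (x i))) \<in> borel_measurable (PiM {..<k} (\<lambda>_. unif))"
    by measurable
  ultimately show ?thesis
    unfolding pattern_weight_def[abs_def] case_prod_unfold by (rule borel_measurable_times[rotated])
qed

text \<open>A difference of products with factors in [0,1] is at most the sum of the differences of
  the factors, and any two coordinates are jointly uniform on the square. For kernels L^1 distance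
  is thus enough, whereas graphs approach their step densities only in the cut norm and go through
  \<open>counting_lemma\<close>.\<close>

lemma integral_pattern_weight_L1:
  fixes V W :: "real \<times> real \<Rightarrow> real"
  assumes [measurable]: "V \<in> borel_measurable (unif \<Otimes>\<^sub>M unif)" "W \<in> borel_measurable (unif \<Otimes>\<^sub>M unif)"
      "\<And>i. u i \<in> borel_measurable unif"
    and V: "\<And>z. 0 \<le> V z" "\<And>z. V z \<le> 1" and W: "\<And>z. 0 \<le> W z" "\<And>z. W z \<le> 1"
    and u: "\<And>i x. 0 \<le> u i x" "\<And>i x. u i x \<le> 1"
  shows "\<bar>(\<integral>x. pattern_weight k u F (\<lambda>x y. V (x, y)) x \<partial>PiM {..<k} (\<lambda>_. unif))
     - (\<integral>x. pattern_weight k u F (\<lambda>x y. W (x, y)) x \<partial>PiM {..<k} (\<lambda>_. unif))\<bar>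
     \<le> real (card (ordered_pairs k)) * (\<integral>z. \<bar>V z - W z\<bar> \<partial>(unif \<Otimes>\<^sub>M unif))"
proof -
  let ?M = "PiM {..<k} (\<lambda>_. unif)"
  have fm: "finite_measure ?M"
    by (intro prob_space.finite_measure prob_space_PiM) (rule unif.prob_space_axioms)
  note const_bound = finite_measure.integrable_const_bound[OF fm, where B = 1]
  let ?pV = "pattern_weight k u F (\<lambda>x y. V (x, y))" and ?pW = "pattern_weight k u F (\<lambda>x y. W (x, y))"
  have m[measurable]: "?pV \<in> borel_measurable ?M" "?pW \<in> borel_measurable ?M"
    by (rule measurable_pattern_weight; measurable)+
  have b: "0 \<le> ?pV x" "?pV x \<le> 1" "0 \<le> ?pW x" "?pW x \<le> 1" for x
    using V W u by (auto intro!: pattern_weight_bounds)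
  have iV: "integrable ?M ?pV" and iW: "integrable ?M ?pW"
    using b by (auto intro!: const_bound m)
  define D where "D q x = \<bar>V (x (fst q), x (snd q)) - W (x (fst q), x (snd q))\<bar>" for q :: "nat \<times> nat" and x
  have Dm: "D q \<in> borel_measurable ?M" if "q \<in> ordered_pairs k" for q
  proof -
    have [measurable]: "fst q \<in> {..<k}" "snd q \<in> {..<k}" using that by (auto simp: ordered_pairs_def)
    show ?thesis unfolding D_def by measurable
  qed
  have D1: "\<bar>V z - W z\<bar> \<le> 1" for z
    using V(1)[of z] V(2)[of z] W(1)[of z] W(2)[of z] by (simp add: abs_le_iff)
  have iD: "integrable ?M (D q)" if "q \<in> ordered_pairs k" for q
    using Dm[OF that] D1 by (intro const_bound) (auto simp: D_def)
  have pt: "\<bar>?pV x - ?pW x\<bar> \<le> (\<Sum>q\<in>ordered_pairs k. D q x)" for x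
  proof -
    let ?U = "\<Prod>i<k. u i (x i)"
    let ?lV = "\<lambda>q. literal (F (fst q) (snd q)) (V (x (fst q), x (snd q)))"
    let ?lW = "\<lambda>q. literal (F (fst q) (snd q)) (W (x (fst q), x (snd q)))"
    have U: "0 \<le> ?U" "?U \<le> 1" using u by (auto intro!: prod_nonneg prod_le_1)
    have "\<bar>?pV x - ?pW x\<bar> = ?U * \<bar>(\<Prod>q\<in>ordered_pairs k. ?lV q) - (\<Prod>q\<in>ordered_pairs k. ?lW q)\<bar>"
      using U by (simp add: pattern_weight_def case_prod_unfold right_diff_distrib[symmetric] abs_mult)
    also have "\<dots> \<le> \<bar>(\<Prod>q\<in>ordered_pairs k. ?lV q) - (\<Prod>q\<in>ordered_pairs k. ?lW q)\<bar>"
      using U by (simp add: mult_left_le_one_le)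
    also have "\<dots> \<le> (\<Sum>q\<in>ordered_pairs k. \<bar>?lV q - ?lW q\<bar>)"
      using norm_prod_diff[of "ordered_pairs k" ?lV ?lW] V W by (simp add: literal_bounds)
    also have "\<dots> = (\<Sum>q\<in>ordered_pairs k. D q x)"
      by (intro sum.cong refl) (auto simp: literal_def D_def)
    finally show ?thesis .
  qed
  have "\<bar>(\<integral>x. ?pV x \<partial>?M) - (\<integral>x. ?pW x \<partial>?M)\<bar> = \<bar>\<integral>x. ?pV x - ?pW x \<partial>?M\<bar>"
    using iV iW by simp
  also have "\<dots> \<le> (\<integral>x. \<bar>?pV x - ?pW x\<bar> \<partial>?M)"
    using integral_norm_bound[of ?M "\<lambda>x. ?pV x - ?pW x"] by simp
  also have "\<dots> \<le> (\<integral>x. (\<Sum>q\<in>ordered_pairs k. D q x) \<partial>?M)"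
    using iV iW iD pt by (intro integral_mono) auto
  also have "\<dots> = (\<Sum>q\<in>ordered_pairs k. \<integral>x. D q x \<partial>?M)"
    using iD by (intro Bochner_Integration.integral_sum) auto
  also have "\<dots> = (\<Sum>q\<in>ordered_pairs k. \<integral>z. \<bar>V z - W z\<bar> \<partial>(unif \<Otimes>\<^sub>M unif))"
  proof (intro sum.cong refl)
    fix q assume "q \<in> ordered_pairs k"
    then show "(\<integral>x. D q x \<partial>?M) = (\<integral>z. \<bar>V z - W z\<bar> \<partial>(unif \<Otimes>\<^sub>M unif))"
      using integral_pair_marginal[of "{..<k}" "fst q" "snd q" "\<lambda>z. \<bar>V z - W z\<bar>"] D1
      by (auto simp: D_def ordered_pairs_def)
  qed
  finally show ?thesis by simp
qed

section \<open>Pattern densities as functions of the frequencies, and their limits\<close>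

lemma expectation_tuple_types:
  fixes h :: "(nat \<Rightarrow> bool list) \<Rightarrow> real"
  shows "measure_pmf.expectation (tuple_pmf k \<mu>) (\<lambda>x. h (\<lambda>i\<in>{..<k}. vtype B m (x i)))
       = (\<Sum>w\<in>PiE {..<k} (\<lambda>_. words m). (\<Prod>i<k. type_freq \<mu> B (w i)) * h w)"
proof -
  let ?S = "PiE {..<k} (\<lambda>_. words m)"
  have fin: "finite ?S" by (intro finite_PiE) auto
  have "(\<lambda>i\<in>{..<k}. vtype B m (x i)) \<in> ?S" for x by auto
  from expectation_of_bool_finite_range[where C = "\<lambda>_. True" and \<phi> = h, OF fin this, of "tuple_pmf k \<mu>"]
  have "measure_pmf.expectation (tuple_pmf k \<mu>) (\<lambda>x. h (\<lambda>i\<in>{..<k}. vtype B m (x i)))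
      = (\<Sum>w\<in>?S. measure (tuple_pmf k \<mu>) {x. (\<lambda>i\<in>{..<k}. vtype B m (x i)) = w} * h w)"
    by simp
  also have "\<dots> = (\<Sum>w\<in>?S. (\<Prod>i<k. type_freq \<mu> B (w i)) * h w)"
  proof (intro sum.cong refl arg_cong2[where f="(*)"])
    fix w assume w: "w \<in> ?S"
    then have len: "length (w i) = m" if "i < k" for i using that by (auto simp: PiE_iff)
    have "{x. (\<lambda>i\<in>{..<k}. vtype B m (x i)) = w} = {x. \<forall>i\<in>{..<k}. x i \<in> {y. vtype B (length (w i)) y = w i}}"
    proof -
      have "(\<lambda>i\<in>{..<k}. vtype B m (x i)) = w \<longleftrightarrow> (\<forall>i<k. vtype B m (x i) = w i)" for x
        using w by (auto simp: fun_eq_iff PiE_iff extensional_def)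
      then show ?thesis using len by auto
    qed
    also have "measure (tuple_pmf k \<mu>) \<dots> = (\<Prod>i<k. type_freq \<mu> B (w i))"
      unfolding tuple_pmf_def type_freq_def
      by (subst measure_Pi_pmf_Pi[where dflt = undefined, symmetric]) (auto simp: Pi_def Ball_def)
    finally show "measure (tuple_pmf k \<mu>) {x. (\<lambda>i\<in>{..<k}. vtype B m (x i)) = w} = (\<Prod>i<k. type_freq \<mu> B (w i))" .
  qed
  finally show ?thesis .
qed

lemma pattern_weight_types:
  "pattern_weight k (\<lambda>i x. u i (\<tau> x)) F (\<lambda>x y. g (\<tau> x) (\<tau> y)) x
   = pattern_weight k u F g (\<lambda>i\<in>{..<k}. \<tau> (x i))"
  unfolding pattern_weight_def
  by (intro arg_cong2[where f="(*)"] prod.cong) (auto simp: ordered_pairs_def)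

text \<open>Densities need not converge at types of limit frequency 0. There the product of the
  frequencies tends to 0 while the pattern weight stays bounded by 1, so the term vanishes in the
  limit.\<close>

lemma tendsto_pattern_weight:
  fixes pj :: "nat \<Rightarrow> bool list \<Rightarrow> real"
  assumes ss: "\<And>j. step_system (pj j) (ej j)" "step_system p e"
    and p: "\<And>w. (\<lambda>j. pj j w) \<longlonglongrightarrow> p w" and e: "\<And>a b. (\<lambda>j. ej j a b) \<longlonglongrightarrow> e a b"
    and u: "\<And>i x. 0 \<le> u i x" "\<And>i x. u i x \<le> 1"
  shows "(\<lambda>j. (\<Prod>i<k. pj j (w i)) * pattern_weight k u F (step_system.dens (pj j) (ej j)) w)
     \<longlonglongrightarrow> (\<Prod>i<k. p (w i)) * pattern_weight k u F (step_system.dens p e) w"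
proof (cases "\<forall>i<k. p (w i) \<noteq> 0")
  case True
  have "(\<lambda>j. step_system.dens (pj j) (ej j) (w i) (w l)) \<longlonglongrightarrow> step_system.dens p e (w i) (w l)"
    if "i < k" "l < k" for i l
    unfolding step_system.dens_def[OF ss(1)] step_system.dens_def[OF ss(2)]
    using that True by (intro tendsto_intros p e) auto
  then have "(\<lambda>j. literal (F i l) (step_system.dens (pj j) (ej j) (w i) (w l)))
       \<longlonglongrightarrow> literal (F i l) (step_system.dens p e (w i) (w l))" if "(i, l) \<in> ordered_pairs k" for i l
    using that by (auto simp: literal_def ordered_pairs_def intro!: tendsto_intros)
  then show ?thesis
    unfolding pattern_weight_def case_prod_unfold by (intro tendsto_intros p) auto
next
  case False
  then obtain i where i: "i < k" "p (w i) = 0" by blast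
  have b: "0 \<le> pattern_weight k u F (step_system.dens (pj j) (ej j)) w"
    "pattern_weight k u F (step_system.dens (pj j) (ej j)) w \<le> 1" for j
    using u step_system.dens_nonneg[OF ss(1)] step_system.dens_le_1[OF ss(1)]
    by (auto intro!: pattern_weight_bounds)
  have pr: "(\<lambda>j. \<Prod>i<k. pj j (w i)) \<longlonglongrightarrow> (\<Prod>i<k. p (w i))" by (intro tendsto_prod p)
  have z: "(\<Prod>i<k. p (w i)) = 0" using i by (intro prod_zero) auto
  have pn: "0 \<le> (\<Prod>i<k. pj j (w i))" for j
    using step_system.p_nonneg[OF ss(1)] by (intro prod_nonneg) auto
  have "(\<lambda>j. (\<Prod>i<k. pj j (w i)) * pattern_weight k u F (step_system.dens (pj j) (ej j)) w) \<longlonglongrightarrow> 0"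
  proof (rule tendsto_sandwich[OF _ _ tendsto_const pr[unfolded z]])
    show "\<forall>\<^sub>F j in sequentially. 0 \<le> (\<Prod>i<k. pj j (w i)) * pattern_weight k u F (step_system.dens (pj j) (ej j)) w"
      using pn b by (intro always_eventually allI mult_nonneg_nonneg)
    show "\<forall>\<^sub>F j in sequentially. (\<Prod>i<k. pj j (w i)) * pattern_weight k u F (step_system.dens (pj j) (ej j)) w
        \<le> (\<Prod>i<k. pj j (w i))"
      using pn b by (intro always_eventually allI mult_left_le)
  qed
  then show ?thesis by (simp only: z mult_zero_left)
qed

lemma step_system_limit:
  assumes ss: "\<And>j. step_system (pj j) (ej j)"
    and p: "\<And>w. (\<lambda>j. pj j w) \<longlonglongrightarrow> p w" and e: "\<And>a b. (\<lambda>j. ej j a b) \<longlonglongrightarrow> e a b"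
  shows "step_system p e"
proof
  fix w a b
  show "0 \<le> p w" by (rule LIMSEQ_le_const[OF p]) (simp add: step_system.p_nonneg[OF ss])
  show "0 \<le> e a b" by (rule LIMSEQ_le_const[OF e]) (simp add: step_system.e_nonneg[OF ss])
  show "p [] = 1" using LIMSEQ_unique[OF p[of "[]"]] by (simp add: step_system.p_Nil[OF ss])
  show "e a b \<le> p a * p b"
    by (rule LIMSEQ_le[OF e tendsto_mult[OF p p]]) (simp add: step_system.e_le[OF ss])
  have "(\<lambda>j. pj j w) \<longlonglongrightarrow> p (True # w) + p (False # w)"
    by (subst step_system.p_split[OF ss]) (intro tendsto_intros p)
  then show "p w = p (True # w) + p (False # w)" by (rule LIMSEQ_unique[OF p])
  have "(\<lambda>j. ej j a b) \<longlonglongrightarrow> e (True # a) (True # b) + e (True # a) (False # b)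
      + e (False # a) (True # b) + e (False # a) (False # b)"
    by (subst step_system.e_split[OF ss]) (intro tendsto_intros e)
  then show "e a b = e (True # a) (True # b) + e (True # a) (False # b)
      + e (False # a) (True # b) + e (False # a) (False # b)" by (rule LIMSEQ_unique[OF e])
qed

lemma vtype_prefix: "R \<le> m \<Longrightarrow> vtype B R x = drop (m - R) (vtype B m x)"
  using drop_vtype[of "m - R" B R x] by simp

lemma (in step_system) cell_prefix: "R \<le> m \<Longrightarrow> cell R x = drop (m - R) (cell m x)"
  using drop_cell[of "m - R" R x] by simp

text \<open>The maximal discrepancies \<open>c j i\<close> of each graph have square sum at most 1,
  since energies telescope. Their limits inherit this and therefore tend to 0. At a suitable fixed
  depth, the pattern densities of late graphs are close to those of their step densities by
  counting, these converge with the frequencies, and the limit step kernel is close to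
  \<open>W\<close> in L^1. The first \<open>R\<close> bits stay prescribed by
  \<open>\<beta>\<close>, so that patterns with given types of length \<open>R\<close> are
  covered.\<close>

theorem graph_compactness:
  fixes \<mu> :: "nat \<Rightarrow> 'a pmf" and f :: "nat \<Rightarrow> 'a \<Rightarrow> 'a \<Rightarrow> bool" and \<beta> :: "nat \<Rightarrow> 'a \<Rightarrow> nat \<Rightarrow> bool"
  assumes fin: "\<And>j. finite (set_pmf (\<mu> j))"
  obtains \<rho> B p e W where "strict_mono (\<rho> :: nat \<Rightarrow> nat)"
    and "\<And>j x r. r < R \<Longrightarrow> B j x r = \<beta> j x r"
    and "step_system p e"
    and "\<And>w. (\<lambda>j. type_freq (\<mu> (\<rho> j)) (B (\<rho> j)) w) \<longlonglongrightarrow> p w"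
    and "\<And>a b. (\<lambda>j. edge_freq (\<mu> (\<rho> j)) (B (\<rho> j)) (f (\<rho> j)) a b) \<longlonglongrightarrow> e a b"
    and "W \<in> borel_measurable (unif \<Otimes>\<^sub>M unif)" "\<And>z. 0 \<le> W z" "\<And>z. W z \<le> 1"
    and "(\<lambda>m. \<integral>z. \<bar>step_system.kernel p e m z - W z\<bar> \<partial>(unif \<Otimes>\<^sub>M unif)) \<longlonglongrightarrow> 0"
    and "\<And>k F a. (\<lambda>j. measure_pmf.expectation (tuple_pmf k (\<mu> (\<rho> j)))
           (pattern_weight k (\<lambda>i x. of_bool (vtype (B (\<rho> j)) R x = a i)) F (\<lambda>x y. of_bool (f (\<rho> j) x y))))
         \<longlonglongrightarrow> (\<integral>x. pattern_weight k (\<lambda>i t. of_bool (step_system.cell p R t = a i)) F (\<lambda>x y. W (x, y)) x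
                \<partial>PiM {..<k} (\<lambda>_. unif))"
proof -
  define ok where "ok j B \<longleftrightarrow> (\<forall>x r. r < R \<longrightarrow> B x r = \<beta> j x r) \<and>
      (\<forall>i S T. \<bar>discrepancy (\<mu> j) (f j) B (R + 2 * i) S T\<bar>
       \<le> \<bar>discrepancy (\<mu> j) (f j) B (R + 2 * i) (\<lambda>x. B x (R + 2 * i)) (\<lambda>x. B x (Suc (R + 2 * i)))\<bar>)" for j B
  have "\<exists>B. ok j B" for j
    using greedy_types[OF fin[of j], of R "\<beta> j" "f j"] unfolding ok_def by metis
  then obtain B where B: "\<And>j. ok j (B j)" by metis
  note okD = B[unfolded ok_def]
  define c where "c j i = discrepancy (\<mu> j) (f j) (B j) (R + 2 * i)
      (\<lambda>x. B j x (R + 2 * i)) (\<lambda>x. B j x (Suc (R + 2 * i)))" for j i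
  let ?en = "\<lambda>j. step_system.energy (type_freq (\<mu> j) (B j)) (edge_freq (\<mu> j) (B j) (f j))"
  have csum: "(\<Sum>i<N. (c j i)\<^sup>2) \<le> 1" for j N
  proof -
    have "(\<Sum>i<N. (c j i)\<^sup>2) \<le> ?en j (R + 2 * N) - ?en j R"
    proof (induction N)
      case (Suc N)
      have "(c j N)\<^sup>2 \<le> ?en j (R + 2 * N + 2) - ?en j (R + 2 * N)"
        unfolding c_def by (rule discrepancy_energy)
      then show ?case using Suc by simp
    qed simp
    also have "\<dots> \<le> 1"
      using step_system.energy_le_1[OF step_system_freq, of "\<mu> j" "B j" "f j" "R + 2 * N"]
        step_system.energy_nonneg[OF step_system_freq, of "\<mu> j" "B j" "f j" R] by linarith
    finally show ?thesis .
  qed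
  have c1: "\<bar>c j i\<bar> \<le> 1" for j i
  proof -
    have "(c j i)\<^sup>2 \<le> (\<Sum>i<Suc i. (c j i)\<^sup>2)" by (rule member_le_sum) auto
    then have "(c j i)\<^sup>2 \<le> 1" using csum[of j "Suc i"] by linarith
    then show ?thesis by (simp add: abs_square_le_1)
  qed
  define X :: "bool list + (bool list \<times> bool list) + nat \<Rightarrow> nat \<Rightarrow> real" where
    "X s j = (case s of Inl w \<Rightarrow> type_freq (\<mu> j) (B j) w
       | Inr (Inl (a, b)) \<Rightarrow> edge_freq (\<mu> j) (B j) (f j) a b | Inr (Inr i) \<Rightarrow> c j i)" for s j
  have "\<bar>X s j\<bar> \<le> 1" for s j
    using c1 by (auto simp: X_def type_freq_def edge_freq_def split: sum.splits)
  from diagonal_convergent_subseq[of X, OF this]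
  obtain \<rho> :: "nat \<Rightarrow> nat" where \<rho>: "strict_mono \<rho>" "\<And>s. convergent (\<lambda>n. X s (\<rho> n))" by blast
  define p where "p w = lim (\<lambda>n. X (Inl w) (\<rho> n))" for w
  define e where "e a b = lim (\<lambda>n. X (Inr (Inl (a, b))) (\<rho> n))" for a b
  define c' where "c' i = lim (\<lambda>n. X (Inr (Inr i)) (\<rho> n))" for i
  let ?p = "\<lambda>j. type_freq (\<mu> (\<rho> j)) (B (\<rho> j))"
  let ?e = "\<lambda>j. edge_freq (\<mu> (\<rho> j)) (B (\<rho> j)) (f (\<rho> j))"
  have p: "(\<lambda>j. ?p j w) \<longlonglongrightarrow> p w" for w
    using \<rho>(2)[of "Inl w"] unfolding p_def convergent_LIMSEQ_iff by (simp add: X_def)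
  have e: "(\<lambda>j. ?e j a b) \<longlonglongrightarrow> e a b" for a b
    using \<rho>(2)[of "Inr (Inl (a, b))"] unfolding e_def convergent_LIMSEQ_iff by (simp add: X_def)
  have c: "(\<lambda>j. c (\<rho> j) i) \<longlonglongrightarrow> c' i" for i
    using \<rho>(2)[of "Inr (Inr i)"] unfolding c'_def convergent_LIMSEQ_iff by (simp add: X_def)
  have ss: "step_system p e" by (rule step_system_limit[OF step_system_freq p e])
  interpret step_system p e by (rule ss)
  \<comment> \<open>The bound \<open>csum\<close> does not depend on \<open>j\<close>, so it passes
    to the limits \<open>c' i\<close>; at a large stage the discrepancy is then small for all late
    \<open>j\<close> simultaneously.\<close>
  have "(\<Sum>i<N. (c' i)\<^sup>2) \<le> 1" for N
  proof (rule LIMSEQ_le_const2)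
    show "(\<lambda>j. \<Sum>i<N. (c (\<rho> j) i)\<^sup>2) \<longlonglongrightarrow> (\<Sum>i<N. (c' i)\<^sup>2)" by (intro tendsto_intros c)
  qed (use csum in auto)
  then have "(\<Sum>i\<le>N. (c' i)\<^sup>2) \<le> 1" for N by (simp only: lessThan_Suc_atMost[symmetric])
  then have "summable (\<lambda>i. (c' i)\<^sup>2)" by (intro bounded_imp_summable[where B=1]) auto
  then have "(\<lambda>i. (c' i)\<^sup>2) \<longlonglongrightarrow> 0" by (rule summable_LIMSEQ_zero)
  then have "(\<lambda>i. sqrt ((c' i)\<^sup>2)) \<longlonglongrightarrow> sqrt 0" by (rule tendsto_real_sqrt)
  then have c'0: "(\<lambda>i. \<bar>c' i\<bar>) \<longlonglongrightarrow> 0" by simp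
  obtain W where W: "W \<in> borel_measurable (unif \<Otimes>\<^sub>M unif)" "\<And>z. 0 \<le> W z" "\<And>z. W z \<le> 1"
    "(\<lambda>m. \<integral>z. \<bar>kernel m z - W z\<bar> \<partial>(unif \<Otimes>\<^sub>M unif)) \<longlonglongrightarrow> 0" by (rule kernel_limit) (rule that)
  have conv: "(\<lambda>j. measure_pmf.expectation (tuple_pmf k (\<mu> (\<rho> j)))
         (pattern_weight k (\<lambda>i x. of_bool (vtype (B (\<rho> j)) R x = a i)) F (\<lambda>x y. of_bool (f (\<rho> j) x y))))
       \<longlonglongrightarrow> (\<integral>x. pattern_weight k (\<lambda>i t. of_bool (cell R t = a i)) F (\<lambda>x y. W (x, y)) x
              \<partial>PiM {..<k} (\<lambda>_. unif))" (is "?T \<longlonglongrightarrow> ?L") for k F a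
  proof (rule LIMSEQ_I)
    fix \<eta> :: real assume "\<eta> > 0"
    let ?C = "real (card (ordered_pairs k))"
    have "(\<lambda>i. ?C * \<bar>c' i\<bar>) \<longlonglongrightarrow> ?C * 0" by (intro tendsto_intros c'0)
    then have ev1: "\<forall>\<^sub>F i in sequentially. ?C * \<bar>c' i\<bar> < \<eta> / 3"
      by (rule order_tendstoD(2)) (use \<open>\<eta> > 0\<close> in simp)
    have "filterlim (\<lambda>i. R + 2 * i) at_top sequentially"
      by (rule filterlim_at_top_mono[OF filterlim_ident]) (auto intro!: always_eventually)
    from filterlim_compose[OF W(4) this]
    have "(\<lambda>i. ?C * (\<integral>z. \<bar>kernel (R + 2 * i) z - W z\<bar> \<partial>(unif \<Otimes>\<^sub>M unif))) \<longlonglongrightarrow> ?C * 0"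
      by (intro tendsto_intros)
    then have ev2: "\<forall>\<^sub>F i in sequentially. ?C * (\<integral>z. \<bar>kernel (R + 2 * i) z - W z\<bar> \<partial>(unif \<Otimes>\<^sub>M unif)) < \<eta> / 3"
      by (rule order_tendstoD(2)) (use \<open>\<eta> > 0\<close> in simp)
    \<comment> \<open>The depth is chosen before \<open>j\<close> grows. It settles the counting
      error in the limit and the distance to \<open>W\<close>; the last third of \<eta> goes to the
      convergence of \<open>T'\<close> at this depth.\<close>
    obtain i where i: "?C * \<bar>c' i\<bar> < \<eta> / 3"
      "?C * (\<integral>z. \<bar>kernel (R + 2 * i) z - W z\<bar> \<partial>(unif \<Otimes>\<^sub>M unif)) < \<eta> / 3"
      using eventually_happens'[OF sequentially_bot eventually_conj[OF ev1 ev2]] by blast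
    define m where "m = R + 2 * i"
    have Rm: "R \<le> m" by (simp add: m_def)
    let ?u = "\<lambda>i v. of_bool (drop (m - R) v = a i) :: real"
    have u01: "0 \<le> ?u i x" "?u i x \<le> 1" for i x by auto
    define T' where "T' j = measure_pmf.expectation (tuple_pmf k (\<mu> (\<rho> j)))
       (pattern_weight k (\<lambda>i x. ?u i (vtype (B (\<rho> j)) m x)) F
         (\<lambda>x y. type_dens (\<mu> (\<rho> j)) (B (\<rho> j)) (f (\<rho> j)) (vtype (B (\<rho> j)) m x) (vtype (B (\<rho> j)) m y)))" for j
    define Tm where "Tm = (\<Sum>w\<in>PiE {..<k} (\<lambda>_. words m). (\<Prod>i<k. p (w i)) * pattern_weight k ?u F dens w)"
    have td: "0 \<le> type_dens (\<mu> j) (B j) (f j) v w" "type_dens (\<mu> j) (B j) (f j) v w \<le> 1" for j v w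
      unfolding type_dens_def
      by (rule step_system.dens_nonneg[OF step_system_freq] step_system.dens_le_1[OF step_system_freq])+
    have d1: "\<bar>?T j - T' j\<bar> \<le> ?C * \<bar>c (\<rho> j) i\<bar>" for j
    proof -
      have "?T j = measure_pmf.expectation (tuple_pmf k (\<mu> (\<rho> j)))
          (pattern_weight k (\<lambda>i x. ?u i (vtype (B (\<rho> j)) m x)) F (\<lambda>x y. of_bool (f (\<rho> j) x y)))"
        by (simp only: vtype_prefix[OF Rm])
      moreover have "\<bar>discrepancy (\<mu> (\<rho> j)) (f (\<rho> j)) (B (\<rho> j)) m S T\<bar> \<le> \<bar>c (\<rho> j) i\<bar>" for S T
        using okD[of "\<rho> j"] unfolding c_def m_def by blast
      note cut = abs_expectation_bilinear_le[OF fin this[unfolded discrepancy_def]]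
      have "\<bar>measure_pmf.expectation (tuple_pmf k (\<mu> (\<rho> j)))
          (pattern_weight k (\<lambda>i x. ?u i (vtype (B (\<rho> j)) m x)) F (\<lambda>x y. of_bool (f (\<rho> j) x y))) - T' j\<bar>
        \<le> ?C * \<bar>c (\<rho> j) i\<bar>"
        unfolding T'_def
      proof (rule counting_lemma)
        show "finite (set_pmf (\<mu> (\<rho> j)))" by (rule fin)
      qed (rule cut td u01 | assumption | simp)+
      ultimately show ?thesis by simp
    qed
    have T': "T' j = (\<Sum>w\<in>PiE {..<k} (\<lambda>_. words m). (\<Prod>i<k. ?p j (w i)) *
        pattern_weight k ?u F (step_system.dens (?p j) (?e j)) w)" for j
    proof -
      have eq: "pattern_weight k (\<lambda>i x. ?u i (vtype (B (\<rho> j)) m x)) F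
           (\<lambda>x y. g (vtype (B (\<rho> j)) m x) (vtype (B (\<rho> j)) m y))
         = (\<lambda>x. pattern_weight k ?u F g (\<lambda>i\<in>{..<k}. vtype (B (\<rho> j)) m (x i)))" for g
        by (rule ext) (rule pattern_weight_types[where u = ?u and \<tau> = "vtype (B (\<rho> j)) m"])
      show ?thesis unfolding T'_def eq type_dens_def by (rule expectation_tuple_types)
    qed
    have "T' \<longlonglongrightarrow> Tm"
      unfolding T' Tm_def by (intro tendsto_sum tendsto_pattern_weight step_system_freq ss p e u01)
    then have ev3: "\<forall>\<^sub>F j in sequentially. dist (T' j) Tm < \<eta> / 3"
      by (rule tendstoD) (use \<open>\<eta> > 0\<close> in simp)
    have Tm: "Tm = (\<integral>x. pattern_weight k (\<lambda>i t. of_bool (cell R t = a i)) F (\<lambda>x y. kernel m (x, y)) x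
              \<partial>PiM {..<k} (\<lambda>_. unif))"
    proof -
      have "pattern_weight k (\<lambda>i t. of_bool (cell R t = a i)) F (\<lambda>x y. kernel m (x, y)) x
          = pattern_weight k ?u F dens (\<lambda>i\<in>{..<k}. cell m (x i))" for x
        unfolding pattern_weight_types[where u = ?u and \<tau> = "cell m", symmetric] kernel_def
        by (simp add: cell_prefix[OF Rm])
      then show ?thesis unfolding Tm_def by (simp add: integral_cells)
    qed
    have cm: "(\<lambda>t. of_bool (cell R t = a i) :: real) \<in> borel_measurable unif" for i
      by measurable
    have d2: "\<bar>Tm - ?L\<bar> < \<eta> / 3"
      unfolding Tm
      by (rule le_less_trans[OF integral_pattern_weight_L1 i(2)[folded m_def]])
         (use W cm kernel_bounds in \<open>auto intro: measurable_kernel\<close>)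
    have "(\<lambda>j. ?C * \<bar>c (\<rho> j) i\<bar>) \<longlonglongrightarrow> ?C * \<bar>c' i\<bar>" by (intro tendsto_intros c)
    then have ev4: "\<forall>\<^sub>F j in sequentially. ?C * \<bar>c (\<rho> j) i\<bar> < \<eta> / 3"
      by (rule order_tendstoD(2)) (rule i(1))
    have "\<forall>\<^sub>F j in sequentially. norm (?T j - ?L) < \<eta>"
      using ev3 ev4
    proof eventually_elim
      case (elim j)
      then show ?case using d1[of j] d2 unfolding dist_real_def real_norm_def by linarith
    qed
    then show "\<exists>no. \<forall>n\<ge>no. norm (?T n - ?L) < \<eta>" by (simp add: eventually_sequentially)
  qed
  show ?thesis
    by (rule that[of \<rho> B p e W]) (use \<rho>(1) okD ss p e W conv in auto)
qed

section \<open>Sequences of counterexamples\<close>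

lemma pmf_replicate_pmf:
  "pmf (replicate_pmf (length xs) D) xs = prod_list (map (pmf D) xs)"
proof (induction xs)
  case (Cons x xs)
  have "replicate_pmf (Suc (length xs)) D
      = map_pmf (\<lambda>(x, xs). x # xs) (pair_pmf D (replicate_pmf (length xs) D))"
    by (simp add: pair_pmf_def map_pmf_def bind_assoc_pmf bind_return_pmf)
  moreover have "pmf (map_pmf (\<lambda>(x, xs). x # xs) (pair_pmf D (replicate_pmf (length xs) D)))
      ((\<lambda>(x, xs). x # xs) (x, xs)) = pmf (pair_pmf D (replicate_pmf (length xs) D)) (x, xs)"
    by (rule pmf_map_inj') (auto simp: inj_def)
  ultimately show ?case using Cons by (simp add: pmf_pair)
qed simp

lemma violation_ge_sum:
  assumes "finite S" "\<And>xs. xs \<in> S \<Longrightarrow> length xs = n \<and> induced G (set xs) \<notin> P"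
  shows "(\<Sum>xs\<in>S. prod_list (map (pmf D) xs)) \<le> violation P G D n"
proof -
  have "(\<Sum>xs\<in>S. prod_list (map (pmf D) xs)) = (\<Sum>xs\<in>S. pmf (replicate_pmf n D) xs)"
    using assms(2) by (intro sum.cong refl) (metis pmf_replicate_pmf)
  also have "\<dots> = measure (replicate_pmf n D) S"
    using assms(1) by (simp add: measure_measure_pmf_finite)
  also have "\<dots> \<le> violation P G D n"
    unfolding violation_def using assms(2) by (intro measure_pmf.finite_measure_mono) auto
  finally show ?thesis .
qed

text \<open>If the violation at size \<open>k\<close> stayed at \<open>\<eta>'\<close> or more, then
  \<open>q0\<close> independent blocks would push the acceptance probability below 1/3, against
  \<open>small\<close>, as soon as \<open>s\<close> accommodates them.\<close>

lemma violation_tendsto_0: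
  assumes gp: "graph_property P" "hereditary P"
    and wg: "\<And>s. weighted_graph (G s) (D s)"
    and small: "\<And>s. s > 0 \<Longrightarrow> violation P (G s) (D s) s < 2 / 3"
    and k: "k > 0"
  shows "(\<lambda>s. violation P (G s) (D s) k) \<longlonglongrightarrow> 0"
proof (rule LIMSEQ_I)
  fix \<eta> :: real assume \<eta>: "\<eta> > 0"
  define \<eta>' where "\<eta>' = min \<eta> 1"
  have \<eta>': "0 < \<eta>'" "\<eta>' \<le> 1" "\<eta>' \<le> \<eta>" using \<eta> by (auto simp: \<eta>'_def)
  obtain q0 where q0: "(1 - \<eta>') ^ q0 < 1 / 3"
    using real_arch_pow_inv[of "1/3" "1 - \<eta>'"] \<eta>' by auto
  show "\<exists>no. \<forall>s\<ge>no. norm (violation P (G s) (D s) k - 0) < \<eta>"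
  proof (intro exI allI impI)
    fix s assume s: "s \<ge> k * Suc q0"
    let ?v = "violation P (G s) (D s) k"
    have v: "0 \<le> ?v" "?v \<le> 1" by (auto simp: violation_def)
    have "s > 0" using s k by (metis gr0I le_zero_eq mult_is_0 nat.distinct(1) not_gr0)
    have "q0 \<le> s div k" using s k by (metis Suc_leD div_le_mono nonzero_mult_div_cancel_left not_gr0)
    have "\<not> \<eta>' \<le> ?v"
    proof
      assume "\<eta>' \<le> ?v"
      have "1 - violation P (G s) (D s) s \<le> (1 - ?v) ^ (s div k)"
        using violation_block[OF gp wg k, of s "s div k" "s mod k"] by simp
      also have "\<dots> \<le> (1 - ?v) ^ q0" using v \<open>q0 \<le> s div k\<close> by (intro power_decreasing) auto
      also have "\<dots> \<le> (1 - \<eta>') ^ q0" using v \<open>\<eta>' \<le> ?v\<close> by (intro power_mono) auto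
      finally show False using q0 small[OF \<open>s > 0\<close>] by simp
    qed
    then show "norm (?v - 0) < \<eta>" using v \<eta>' by simp
  qed
qed

text \<open>The two enumerations define the isomorphism. Increasing pairs suffice for the comparison
  because edges are unordered and loops are absent.\<close>

lemma graph_property_enumeration:
  assumes gp: "graph_property P" and GP: "G \<in> P" and K: "simple_graph K"
    and x: "bij_betw x {..<n::nat} (verts G)" and y: "bij_betw y {..<n} (verts K)"
    and edge: "\<And>i l. i < l \<Longrightarrow> l < n \<Longrightarrow> {x i, x l} \<in> edges G \<longleftrightarrow> {y i, y l} \<in> edges K"
  shows "K \<in> P"
proof -
  have sG: "simple_graph G" using gp GP by (auto simp: graph_property_def)
  have loop: "{v, v} \<notin> edges H" if "simple_graph H" for v H
    using that by (auto simp: simple_graph_def)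
  define g where "g = y \<circ> inv_into {..<n} x"
  have gx: "g (x i) = y i" if "i < n" for i
    using that x by (simp add: g_def bij_betw_def)
  show ?thesis
  proof (rule graph_property_iso[OF gp GP K])
    show "bij_betw g (verts G) (verts K)"
      unfolding g_def by (rule bij_betw_trans[OF bij_betw_inv_into[OF x] y])
    fix u v assume "u \<in> verts G" "v \<in> verts G"
    then obtain i l where il: "u = x i" "i < n" "v = x l" "l < n"
      using x unfolding bij_betw_def by (metis imageE lessThan_iff)
    consider "i < l" | "i = l" | "l < i" by linarith
    then show "{u, v} \<in> edges G \<longleftrightarrow> {g u, g v} \<in> edges K"
    proof cases
      case 1
      then show ?thesis using edge[of i l] il gx by simp
    next
      case 2
      then show ?thesis using il loop[OF sG] loop[OF K] by simp
    next
      case 3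
      then show ?thesis using edge[of l i] il gx by (simp add: insert_commute)
    qed
  qed
qed

lemma bij_betw_append:
  fixes R k :: nat
  assumes h: "bij_betw h {..<R} S" and x: "bij_betw x {..<k} T" and "S \<inter> T = {}"
  shows "bij_betw (\<lambda>n. if n < R then h n else x (n - R)) {..<R + k} (S \<union> T)"
proof -
  let ?f = "\<lambda>n. if n < R then h n else x (n - R)"
  have "bij_betw ?f {..<R} S"
    using h by (subst bij_betw_cong[where g = h]) auto
  moreover have "bij_betw ?f {R..<R + k} T"
  proof -
    have "bij_betw (\<lambda>n. n - R) {R..<R + k} {..<k}"
      by (rule bij_betw_byWitness[where f' = "\<lambda>n. n + R"]) auto
    from bij_betw_trans[OF this x] show ?thesis
      by (subst bij_betw_cong[where g = "x \<circ> (\<lambda>n. n - R)"]) auto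
  qed
  moreover have "{..<R} \<union> {R..<R + k} = {..<R + k}" by auto
  ultimately show ?thesis using bij_betw_combine[OF _ _ \<open>S \<inter> T = {}\<close>, of ?f "{..<R}" "{R..<R + k}"] by simp
qed

lemma nth_vtype: "n < m \<Longrightarrow> vtype B m x ! (m - 1 - n) = B x n"
proof (induction m)
  case (Suc m)
  then show ?case by (cases "n = m") (auto simp: nth_Cons')
qed simp

text \<open>Two independent draws agree with probability the sum of the squared weights, which is at
  most the largest weight. The two-coordinate lemma with constant \<open>a\<close> and
  \<open>b\<close> transfers this to coordinates \<open>i\<close> and \<open>l\<close> of a
  tuple.\<close>

lemma collision_probability:
  fixes \<mu> :: "'a pmf"
  assumes fin: "finite (set_pmf \<mu>)" and small: "\<And>x. pmf \<mu> x \<le> c" and il: "i < k" "l < k" "i \<noteq> l"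
  shows "measure (tuple_pmf k \<mu>) {x. x i = x l} \<le> c"
proof -
  let ?A = "set_pmf \<mu>"
  have pair: "measure_pmf.expectation (pair_pmf \<mu> \<mu>) (\<lambda>(x, y). of_bool (x = y)) \<le> c"
  proof -
    have "measure_pmf.expectation (pair_pmf \<mu> \<mu>) (\<lambda>(x, y). of_bool (x = y))
        = (\<Sum>z\<in>?A \<times> ?A. (case z of (x, y) \<Rightarrow> of_bool (x = y)) * pmf (pair_pmf \<mu> \<mu>) z)"
      by (rule integral_measure_pmf_real) (use fin in auto)
    also have "\<dots> = (\<Sum>x\<in>?A. \<Sum>y\<in>?A. if y = x then pmf \<mu> x * pmf \<mu> x else 0)"
      unfolding sum.cartesian_product by (intro sum.cong refl) (auto simp: pmf_pair)
    also have "\<dots> = (\<Sum>x\<in>?A. pmf \<mu> x * pmf \<mu> x)" using fin by simp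
    also have "\<dots> \<le> (\<Sum>x\<in>?A. pmf \<mu> x * c)" using small by (intro sum_mono mult_left_mono) auto
    also have "\<dots> = c" using fin by (simp add: sum_distrib_right[symmetric] sum_pmf_eq_1)
    finally show ?thesis .
  qed
  have "\<bar>measure_pmf.expectation (tuple_pmf k \<mu>) (\<lambda>x. of_bool (x i = x l) * 1 * 1)\<bar> \<le> c"
    unfolding tuple_pmf_def
  proof (rule expectation_two_coordinates[OF fin, where s = "\<lambda>x y. of_bool (x = y)"
        and a = "\<lambda>_. 1" and b = "\<lambda>_. 1"])
    fix u v :: "'a \<Rightarrow> real"
    assume uv: "\<And>x. 0 \<le> u x" "\<And>x. u x \<le> 1" "\<And>y. 0 \<le> v y" "\<And>y. v y \<le> 1"
    have int: "integrable (pair_pmf \<mu> \<mu>) h" for h :: "'a \<times> 'a \<Rightarrow> real"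
      using fin by (intro integrable_measure_pmf_finite) auto
    have "0 \<le> measure_pmf.expectation (pair_pmf \<mu> \<mu>) (\<lambda>(x, y). of_bool (x = y) * u x * v y)"
      using uv by (intro integral_nonneg_AE) auto
    moreover have "measure_pmf.expectation (pair_pmf \<mu> \<mu>) (\<lambda>(x, y). of_bool (x = y) * u x * v y)
        \<le> measure_pmf.expectation (pair_pmf \<mu> \<mu>) (\<lambda>(x, y). of_bool (x = y))"
      by (rule integral_mono[OF int int]) (auto intro!: mult_le_one simp: uv)
    ultimately show "\<bar>measure_pmf.expectation (pair_pmf \<mu> \<mu>) (\<lambda>(x, y). of_bool (x = y) * u x * v y)\<bar> \<le> c"
      using pair by linarith
  qed (use il in auto)
  moreover have "measure_pmf.expectation (tuple_pmf k \<mu>) (\<lambda>x. of_bool (x i = x l) * 1 * 1)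
      = measure (tuple_pmf k \<mu>) {x. x i = x l}"
  proof -
    have "(\<lambda>x. of_bool (x i = x l) * 1 * 1) = (indicator {x. x i = x l} :: (nat \<Rightarrow> 'a) \<Rightarrow> real)"
      by (auto simp: fun_eq_iff indicator_def)
    then show ?thesis by simp
  qed
  ultimately show ?thesis by simp
qed

text \<open>Adjacency of the \<open>n\<close>-th and \<open>l\<close>-th vertex, \<open>n < l\<close>, in a graph consisting of \<open>R\<close> heavy
  vertices, adjacent as in \<open>A\<close>, followed by light vertices, adjacent as in \<open>F\<close>, whose types \<open>a\<close>
  store the adjacency to the heavy vertices in reverse order.\<close>

definition joint_pattern ::
  "nat \<Rightarrow> (nat \<times> nat) set \<Rightarrow> (nat \<Rightarrow> nat \<Rightarrow> bool) \<Rightarrow> (nat \<Rightarrow> bool list) \<Rightarrow> nat \<Rightarrow> nat \<Rightarrow> bool" where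
  "joint_pattern R A F a n l \<longleftrightarrow>
     (if l < R then (n, l) \<in> A else if n < R then a (l - R) ! (R - 1 - n) else F (n - R) (l - R))"

text \<open>Counterexamples after all extractions of subsequences. \<open>h j\<close> lists the
  heavy vertices in an order for which the same \<open>A\<close> describes their graph for every
  \<open>j\<close>. The threshold \<open>\<theta>\<close> is fixed while \<open>\<theta>s\<close>
  tends to 0: the former bounds the heavy part, the latter makes collisions of light vertices
  vanish.\<close>

locale bad_sequence =
  fixes P :: "'a graph set" and \<epsilon> \<delta> \<theta> :: real and R :: nat and A :: "(nat \<times> nat) set"
    and G :: "nat \<Rightarrow> 'a graph" and D :: "nat \<Rightarrow> 'a pmf" and h :: "nat \<Rightarrow> nat \<Rightarrow> 'a" and \<theta>s :: "nat \<Rightarrow> real"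
  assumes gp: "graph_property P"
    and eps: "0 < \<epsilon>" and delta: "0 < \<delta>" and theta: "0 < \<theta>" "\<And>j. \<theta>s j \<le> \<theta>" "\<theta>s \<longlonglongrightarrow> 0"
    and wg: "\<And>j. weighted_graph (G j) (D j)"
    and pos: "\<And>j v. v \<in> verts (G j) \<Longrightarrow> 0 < pmf (D j) v"
    and far: "\<And>j. far_from \<epsilon> P (G j) (D j)"
    and viol: "\<And>k. k > 0 \<Longrightarrow> (\<lambda>j. violation P (G j) (D j) k) \<longlonglongrightarrow> 0"
    and junk: "\<And>j. measure (D j) {v \<in> verts (G j). \<theta>s j \<le> pmf (D j) v \<and> pmf (D j) v < \<theta>} < \<epsilon> / 8"
    and light: "\<And>j. \<delta> / 2 \<le> measure (D j) {v \<in> verts (G j). pmf (D j) v < \<theta>s j}"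
    and h: "\<And>j. bij_betw (h j) {..<R} {v \<in> verts (G j). \<theta> \<le> pmf (D j) v}"
    and A: "\<And>j r r'. r < R \<Longrightarrow> r' < R \<Longrightarrow> {h j r, h j r'} \<in> edges (G j) \<longleftrightarrow> (r, r') \<in> A"
begin

section \<open>Conditioning on the light vertices\<close>

definition lights :: "nat \<Rightarrow> 'a set" where
  "lights j = {v \<in> verts (G j). pmf (D j) v < \<theta>s j}"

definition heavies :: "nat \<Rightarrow> 'a set" where
  "heavies j = {v \<in> verts (G j). \<theta> \<le> pmf (D j) v}"

definition mu :: "nat \<Rightarrow> 'a pmf" where
  "mu j = cond_pmf (D j) (lights j)"

definition adj :: "nat \<Rightarrow> 'a \<Rightarrow> 'a \<Rightarrow> bool" where
  "adj j x y \<longleftrightarrow> {x, y} \<in> edges (G j)"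

lemma simple: "simple_graph (G j)"
  using wg by (simp add: weighted_graph_def)

lemma finite_verts: "finite (verts (G j))"
  using simple by (simp add: simple_graph_def)

lemma set_pmf_D: "set_pmf (D j) = verts (G j)"
  using wg[of j] pos[of _ j] by (force simp: weighted_graph_def set_pmf_iff)

lemma lights_pos: "0 < measure (D j) (lights j)"
  using light[of j] delta by (simp add: lights_def)

lemma lights_nonempty: "set_pmf (D j) \<inter> lights j \<noteq> {}"
  using lights_pos[of j] by (auto simp: measure_pmf_zero_iff[symmetric])

lemma pmf_mu: "pmf (mu j) v = (if v \<in> lights j then pmf (D j) v / measure (D j) (lights j) else 0)"
  unfolding mu_def by (rule pmf_cond[OF lights_nonempty])

lemma set_mu: "set_pmf (mu j) = lights j"
  unfolding mu_def using lights_nonempty[of j] by (subst set_cond_pmf) (auto simp: set_pmf_D lights_def)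

lemma finite_mu: "finite (set_pmf (mu j))"
  using finite_verts[of j] by (simp add: set_mu lights_def)

lemma pmf_mu_le: "pmf (mu j) v \<le> \<bar>\<theta>s j\<bar> / (\<delta> / 2)"
proof (cases "v \<in> lights j")
  case True
  then have "pmf (mu j) v \<le> \<bar>\<theta>s j\<bar> / measure (D j) (lights j)"
    by (auto simp: pmf_mu lights_def intro!: divide_right_mono)
  also have "\<dots> \<le> \<bar>\<theta>s j\<bar> / (\<delta> / 2)"
    using light[of j] delta by (intro divide_left_mono mult_pos_pos) (auto simp: lights_def intro: lights_pos[unfolded lights_def])
  finally show ?thesis .
next
  case False
  then show ?thesis using delta by (simp add: pmf_mu)
qed

lemma h_mem: "r < R \<Longrightarrow> h j r \<in> heavies j"
  using bij_betwE[OF h[of j]] by (auto simp: heavies_def)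

lemma lights_heavies_disjoint: "lights j \<inter> heavies j = {}"
  using theta(2)[of j] by (auto simp: lights_def heavies_def)

text \<open>Lists made of the heavy vertices in order and a tuple of light ones with the required
  types and adjacencies induce a copy of \<open>K\<close>. Each heavy entry contributes at least
  \<open>\<theta>\<close>, each light entry at least \<delta> / 2 times its weight under
  \<open>mu j\<close>. Tuples with repetitions may match the pattern but induce too few vertices,
  hence the subtracted collision term.\<close>

lemma violation_lower_bound:
  assumes K: "simple_graph K" "K \<notin> P" "bij_betw y {..<R + k} (verts K)"
    and Ke: "\<And>n l. n < l \<Longrightarrow> l < R + k \<Longrightarrow> {y n, y l} \<in> edges K \<longleftrightarrow> joint_pattern R A F a n l"
    and B: "\<And>x r. r < R \<Longrightarrow> B x r = adj j x (h j r)"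
  defines "T \<equiv> measure_pmf.expectation (tuple_pmf k (mu j))
      (pattern_weight k (\<lambda>i x. of_bool (vtype B R x = a i)) F (\<lambda>x y. of_bool (adj j x y)))"
  shows "\<theta> ^ R * (\<delta> / 2) ^ k * (T - real (card (ordered_pairs k)) * (\<bar>\<theta>s j\<bar> / (\<delta> / 2)))
     \<le> violation P (G j) (D j) (R + k)"
proof -
  define good where "good x \<longleftrightarrow> (\<forall>i<k. vtype B R (x i) = a i) \<and>
      (\<forall>(i, l)\<in>ordered_pairs k. adj j (x i) (x l) = F i l)" for x
  let ?M = "tuple_pmf k (mu j)"
  have finM: "finite (set_pmf ?M)"
    unfolding tuple_pmf_def by (intro finite_set_Pi_pmf finite_mu) auto
  have int: "integrable ?M \<phi>" for \<phi> :: "(nat \<Rightarrow> 'a) \<Rightarrow> real"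
    by (rule integrable_measure_pmf_finite[OF finM])
  have T_le: "T \<le> measure ?M {x. good x}"
  proof -
    have "pattern_weight k (\<lambda>i x. of_bool (vtype B R x = a i)) F (\<lambda>x y. of_bool (adj j x y)) x
        \<le> indicator {x. good x} x" for x
    proof (cases "good x")
      case True
      then show ?thesis using pattern_weight_bounds(2)[where u = "\<lambda>i x. of_bool (vtype B R x = a i)"
            and g = "\<lambda>x y. of_bool (adj j x y)"] by simp
    next
      case False
      then consider i where "i < k" "vtype B R (x i) \<noteq> a i"
        | i l where "(i, l) \<in> ordered_pairs k" "adj j (x i) (x l) \<noteq> F i l"
        unfolding good_def by auto
      then have "pattern_weight k (\<lambda>i x. of_bool (vtype B R x = a i)) F (\<lambda>x y. of_bool (adj j x y)) x = 0"
      proof cases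
        case 1
        then have "(\<Prod>i<k. of_bool (vtype B R (x i) = a i)) = (0 :: real)"
          by (intro prod_zero) auto
        then show ?thesis by (simp only: pattern_weight_def mult_zero_left)
      next
        case 2
        then have "(\<Prod>(i, l)\<in>ordered_pairs k. literal (F i l) (of_bool (adj j (x i) (x l)))) = 0"
          by (intro prod_zero) (auto simp: literal_def intro!: bexI[of _ "(i, l)"])
        then show ?thesis by (simp only: pattern_weight_def mult_zero_right)
      qed
      then show ?thesis by simp
    qed
    then have "T \<le> measure_pmf.expectation ?M (indicator {x. good x})"
      unfolding T_def by (intro integral_mono int) auto
    then show ?thesis by simp
  qed
  define C where "C = (\<Union>(i, l)\<in>ordered_pairs k. {x. x i = (x l :: 'a)})"
  have C_le: "measure ?M C \<le> real (card (ordered_pairs k)) * (\<bar>\<theta>s j\<bar> / (\<delta> / 2))"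
  proof -
    have "measure ?M C \<le> (\<Sum>q\<in>ordered_pairs k. measure ?M (case q of (i, l) \<Rightarrow> {x. x i = x l}))"
      unfolding C_def by (rule measure_pmf.finite_measure_subadditive_finite) auto
    also have "\<dots> \<le> (\<Sum>q\<in>ordered_pairs k. \<bar>\<theta>s j\<bar> / (\<delta> / 2))"
    proof (intro sum_mono)
      fix q assume "q \<in> ordered_pairs k"
      then obtain i l where "q = (i, l)" "i < k" "l < k" "i \<noteq> l" by (auto simp: ordered_pairs_def)
      then show "measure ?M (case q of (i, l) \<Rightarrow> {x. x i = x l}) \<le> \<bar>\<theta>s j\<bar> / (\<delta> / 2)"
        using collision_probability[OF finite_mu pmf_mu_le] by simp
    qed
    finally show ?thesis by simp
  qed
  define S where "S = {x \<in> set_pmf ?M. good x \<and> x \<notin> C}"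
  have finS: "finite S" using finM by (simp add: S_def)
  have S_ge: "T - measure ?M C \<le> measure ?M S"
  proof -
    have "measure ?M {x. good x} \<le> measure ?M (S \<union> C)"
      by (rule measure_pmf.finite_measure_mono_AE) (auto simp: AE_measure_pmf_iff S_def)
    also have "\<dots> \<le> measure ?M S + measure ?M C" by (rule measure_Un_le) auto
    finally show ?thesis using T_le by simp
  qed
  have S_sub: "x \<in> PiE_dflt {..<k} undefined (\<lambda>_. lights j)" if "x \<in> S" for x
    using that set_Pi_pmf_subset'[of "{..<k}" undefined "\<lambda>_. mu j"]
    by (auto simp: S_def tuple_pmf_def o_def set_mu)
  have S_mem: "x i \<in> lights j" if "x \<in> S" "i < k" for x i
    using S_sub[OF that(1)] that(2) by (auto simp: PiE_dflt_def)
  \<comment> \<open>Coordinates from \<open>k\<close> on carry the default value of the product law,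
    so a tuple is determined by its list and \<open>L\<close> is injective.\<close>
  have S_out: "x i = undefined" if "x \<in> S" "i \<ge> k" for x i
    using S_sub[OF that(1)] that(2) by (auto simp: PiE_dflt_def)
  have S_inj: "inj_on x {..<k}" if "x \<in> S" for x
  proof (rule inj_onI)
    fix i l assume "i \<in> {..<k}" "l \<in> {..<k}" "x i = x l"
    moreover have "x n \<noteq> x n'" if "n < n'" "n' < k" for n n'
      using \<open>x \<in> S\<close> that by (auto simp: S_def C_def ordered_pairs_def)
    ultimately show "i = l" by (metis lessThan_iff linorder_neqE_nat)
  qed
  define hx where "hx x n = (if n < R then h j n else x (n - R))" for x n
  define L where "L x = map (hx x) [0..<R + k]" for x
  have Lset: "set (L x) = hx x ` {..<R + k}" for x by (auto simp: L_def)
  have Linj: "inj_on L S"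
  proof (rule inj_onI)
    fix x x' assume x: "x \<in> S" "x' \<in> S" "L x = L x'"
    have "x i = x' i" for i
    proof (cases "i < k")
      case True
      then have "hx x (R + i) = hx x' (R + i)" using x(3) by (simp add: L_def)
      then show ?thesis by (simp add: hx_def)
    next
      case False
      then show ?thesis using S_out[OF x(1), of i] S_out[OF x(2), of i] by simp
    qed
    then show "x = x'" by auto
  qed
  have hx_inj: "inj_on (hx x) {..<R + k}" if x: "x \<in> S" for x
  proof -
    have "bij_betw x {..<k} (x ` {..<k})" using S_inj[OF x] by (rule inj_on_imp_bij_betw)
    moreover have "heavies j \<inter> x ` {..<k} = {}" using S_mem[OF x] lights_heavies_disjoint[of j] by auto
    ultimately show ?thesis
      using bij_betw_append[OF h[of j, folded heavies_def]] unfolding hx_def[abs_def] bij_betw_def by blast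
  qed
  have hx_mem: "hx x n \<in> verts (G j)" if "x \<in> S" "n < R + k" for x n
    using that h_mem[of n j] S_mem[of x "n - R"] by (auto simp: hx_def heavies_def lights_def)
  have hx_edge: "{hx x n, hx x l} \<in> edges (G j) \<longleftrightarrow> joint_pattern R A F a n l"
    if x: "x \<in> S" and nl: "n < l" "l < R + k" for x n l
  proof -
    have g: "good x" using x by (simp add: S_def)
    consider "l < R" | "n < R" "R \<le> l" | "R \<le> n" "R \<le> l" by linarith
    then show ?thesis
    proof cases
      case 1
      then show ?thesis using A[of n l j] nl by (simp add: hx_def joint_pattern_def)
    next
      case 2
      then have "vtype B R (x (l - R)) = a (l - R)" using g nl by (auto simp: good_def)
      then have "a (l - R) ! (R - 1 - n) = adj j (x (l - R)) (h j n)"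
        using nth_vtype[of n R B "x (l - R)"] B[of n] 2 by simp
      then show ?thesis using 2 by (simp add: hx_def joint_pattern_def adj_def insert_commute)
    next
      case 3
      then have "(n - R, l - R) \<in> ordered_pairs k" using nl by (auto simp: ordered_pairs_def)
      then have "adj j (x (n - R)) (x (l - R)) = F (n - R) (l - R)" using g by (auto simp: good_def)
      then show ?thesis using 3 by (simp add: hx_def joint_pattern_def adj_def)
    qed
  qed
  have notP: "induced (G j) (set (L x)) \<notin> P" if x: "x \<in> S" for x
  proof
    assume ind: "induced (G j) (set (L x)) \<in> P"
    have "K \<in> P"
    proof (rule graph_property_enumeration[OF gp ind K(1)])
      show "bij_betw (hx x) {..<R + k} (verts (induced (G j) (set (L x))))"
        using hx_inj[OF x] by (simp add: bij_betw_def Lset)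
      show "bij_betw y {..<R + k} (verts K)" by (rule K(3))
      fix n l assume nl: "n < l" "l < R + k"
      then have "{hx x n, hx x l} \<subseteq> set (L x)" by (auto simp: Lset)
      then show "{hx x n, hx x l} \<in> edges (induced (G j) (set (L x))) \<longleftrightarrow> {y n, y l} \<in> edges K"
        using hx_edge[OF x nl] Ke[OF nl] by simp
    qed
    then show False using K(2) by simp
  qed
  have "(\<Sum>xs\<in>L ` S. prod_list (map (pmf (D j)) xs)) \<le> violation P (G j) (D j) (R + k)"
    by (rule violation_ge_sum) (use finS notP in \<open>auto simp: L_def\<close>)
  moreover have "(\<Sum>xs\<in>L ` S. prod_list (map (pmf (D j)) xs))
      = (\<Sum>x\<in>S. (\<Prod>r<R. pmf (D j) (h j r)) * (\<Prod>i<k. pmf (D j) (x i)))"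
    unfolding sum.reindex[OF Linj] o_def
  proof (intro sum.cong refl)
    fix x assume "x \<in> S"
    have "prod_list (map (pmf (D j)) (L x)) = (\<Prod>n<R + k. pmf (D j) (hx x n))"
      unfolding L_def by (simp add: prod.distinct_set_conv_list[symmetric] atLeast0LessThan o_def)
    also have "\<dots> = (\<Prod>n<R. pmf (D j) (hx x n)) * (\<Prod>i<k. pmf (D j) (hx x (R + i)))"
      by (induction k) simp_all
    finally show "prod_list (map (pmf (D j)) (L x)) = (\<Prod>r<R. pmf (D j) (h j r)) * (\<Prod>i<k. pmf (D j) (x i))"
      by (simp add: hx_def)
  qed
  moreover have "\<theta> ^ R * (\<delta> / 2) ^ k * measure ?M S
      \<le> (\<Sum>x\<in>S. (\<Prod>r<R. pmf (D j) (h j r)) * (\<Prod>i<k. pmf (D j) (x i)))"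
  proof -
    have "\<theta> ^ R * (\<delta> / 2) ^ k * measure ?M S = (\<Sum>x\<in>S. \<theta> ^ R * ((\<delta> / 2) ^ k * pmf ?M x))"
      using finS by (simp add: measure_measure_pmf_finite sum_distrib_left mult.assoc)
    also have "\<dots> \<le> (\<Sum>x\<in>S. (\<Prod>r<R. pmf (D j) (h j r)) * (\<Prod>i<k. pmf (D j) (x i)))"
    proof (intro sum_mono mult_mono)
      fix x assume x: "x \<in> S"
      have "(\<Prod>r<R. \<theta>) \<le> (\<Prod>r<R. pmf (D j) (h j r))"
        using theta(1) h_mem[of _ j] by (intro prod_mono) (auto simp: heavies_def)
      then show "\<theta> ^ R \<le> (\<Prod>r<R. pmf (D j) (h j r))" by simp
      have "pmf ?M x = (\<Prod>i<k. pmf (mu j) (x i))"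
        unfolding tuple_pmf_def by (subst pmf_Pi') (use S_out[OF x] in auto)
      then have "(\<delta> / 2) ^ k * pmf ?M x = (\<Prod>i<k. \<delta> / 2 * pmf (mu j) (x i))"
        by (simp only: prod.distrib prod_constant card_lessThan)
      also have "\<dots> \<le> (\<Prod>i<k. pmf (D j) (x i))"
      proof (intro prod_mono conjI)
        fix i assume "i \<in> {..<k}"
        then have "x i \<in> lights j" using S_mem[OF x] by simp
        then have "pmf (D j) (x i) = measure (D j) (lights j) * pmf (mu j) (x i)"
          using lights_pos[of j] by (simp add: pmf_mu)
        then show "\<delta> / 2 * pmf (mu j) (x i) \<le> pmf (D j) (x i)"
          using mult_right_mono[OF light[of j], of "pmf (mu j) (x i)"] by (simp add: lights_def)
      qed (use delta in simp)
      finally show "(\<delta> / 2) ^ k * pmf ?M x \<le> (\<Prod>i<k. pmf (D j) (x i))" .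
    qed (use theta(1) delta in \<open>auto intro!: prod_nonneg\<close>)
    finally show ?thesis .
  qed
  moreover have "\<theta> ^ R * (\<delta> / 2) ^ k * (T - real (card (ordered_pairs k)) * (\<bar>\<theta>s j\<bar> / (\<delta> / 2)))
      \<le> \<theta> ^ R * (\<delta> / 2) ^ k * measure ?M S"
    using S_ge C_le theta(1) delta by (intro mult_left_mono) auto
  ultimately show ?thesis by linarith
qed

end

text \<open>The data of \<open>graph_compactness\<close> for the conditional laws \<open>mu\<close>,
  with the first \<open>R\<close> bits of a type recording adjacency to the heavy vertices; this is
  how limit densities of light tuples see the heavy part.\<close>

locale bad_limit = bad_sequence P \<epsilon> \<delta> \<theta> R A G D h \<theta>s + step_system p e
  for P :: "'a graph set" and \<epsilon> \<delta> \<theta> R A G D h \<theta>s p e +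
  fixes \<rho> :: "nat \<Rightarrow> nat" and B :: "nat \<Rightarrow> 'a \<Rightarrow> nat \<Rightarrow> bool" and W :: "real \<times> real \<Rightarrow> real"
  assumes rho: "strict_mono \<rho>"
    and B: "\<And>j x r. r < R \<Longrightarrow> B j x r = adj j x (h j r)"
    and type_lim: "\<And>w. (\<lambda>j. type_freq (mu (\<rho> j)) (B (\<rho> j)) w) \<longlonglongrightarrow> p w"
    and edge_lim: "\<And>a b. (\<lambda>j. edge_freq (mu (\<rho> j)) (B (\<rho> j)) (adj (\<rho> j)) a b) \<longlonglongrightarrow> e a b"
    and W: "W \<in> borel_measurable (unif \<Otimes>\<^sub>M unif)" "\<And>z. 0 \<le> W z" "\<And>z. W z \<le> 1"
    and W_lim: "(\<lambda>m. \<integral>z. \<bar>kernel m z - W z\<bar> \<partial>(unif \<Otimes>\<^sub>M unif)) \<longlonglongrightarrow> 0"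
    and pattern_lim: "\<And>k F a. (\<lambda>j. measure_pmf.expectation (tuple_pmf k (mu (\<rho> j)))
           (pattern_weight k (\<lambda>i x. of_bool (vtype (B (\<rho> j)) R x = a i)) F (\<lambda>x y. of_bool (adj (\<rho> j) x y))))
         \<longlonglongrightarrow> (\<integral>x. pattern_weight k (\<lambda>i t. of_bool (cell R t = a i)) F (\<lambda>x y. W (x, y)) x
                \<partial>PiM {..<k} (\<lambda>_. unif))"
begin

text \<open>\<open>K\<close> stays fixed while \<open>j\<close> grows. In
  \<open>violation_lower_bound\<close> the violation probability and the collision term tend to 0
  and the prefactor is a positive constant, so the limit density of the pattern cannot be
  positive.\<close>

lemma pattern_integral_zero:
  assumes K: "simple_graph K" "K \<notin> P" "bij_betw y {..<R + k} (verts K)"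
    and Ke: "\<And>n l. n < l \<Longrightarrow> l < R + k \<Longrightarrow> {y n, y l} \<in> edges K \<longleftrightarrow> joint_pattern R A F a n l"
  shows "(\<integral>x. pattern_weight k (\<lambda>i t. of_bool (cell R t = a i)) F (\<lambda>x y. W (x, y)) x
            \<partial>PiM {..<k} (\<lambda>_. unif)) = 0" (is "?I = 0")
proof -
  have "R + k > 0"
    using K(1,3) by (auto simp: simple_graph_def bij_betw_def intro!: gr0I)
  have v: "(\<lambda>j. violation P (G (\<rho> j)) (D (\<rho> j)) (R + k)) \<longlonglongrightarrow> 0"
    using LIMSEQ_subseq_LIMSEQ[OF viol[OF \<open>R + k > 0\<close>] rho] by (simp add: o_def)
  have th: "(\<lambda>j. \<theta>s (\<rho> j)) \<longlonglongrightarrow> 0"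
    using LIMSEQ_subseq_LIMSEQ[OF theta(3) rho] by (simp add: o_def)
  let ?c = "real (card (ordered_pairs k))"
  have "\<theta> ^ R * (\<delta> / 2) ^ k * (?I - ?c * (\<bar>0\<bar> / (\<delta> / 2))) \<le> 0"
  proof (rule LIMSEQ_le[OF _ v])
    show "(\<lambda>j. \<theta> ^ R * (\<delta> / 2) ^ k * (measure_pmf.expectation (tuple_pmf k (mu (\<rho> j)))
           (pattern_weight k (\<lambda>i x. of_bool (vtype (B (\<rho> j)) R x = a i)) F (\<lambda>x y. of_bool (adj (\<rho> j) x y)))
           - ?c * (\<bar>\<theta>s (\<rho> j)\<bar> / (\<delta> / 2)))) \<longlonglongrightarrow> \<theta> ^ R * (\<delta> / 2) ^ k * (?I - ?c * (\<bar>0\<bar> / (\<delta> / 2)))"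
      using delta by (intro tendsto_intros pattern_lim th) auto
  qed (use violation_lower_bound[OF K Ke B] in blast)
  moreover have "0 < \<theta> ^ R * (\<delta> / 2) ^ k" using theta(1) delta by simp
  ultimately have "?I \<le> 0" by (auto simp: mult_le_0_iff not_le[symmetric])
  moreover have "0 \<le> ?I" using W by (intro integral_nonneg_AE AE_I2 pattern_weight_bounds) auto
  ultimately show ?thesis by simp
qed

end

section \<open>Repairing a graph along the limit kernel\<close>

context bad_limit
begin

section \<open>Clashes between a graph and the limit kernel\<close>

definition mass0 :: "bool list \<Rightarrow> bool list \<Rightarrow> real" where
  "mass0 a b = measure (unif \<Otimes>\<^sub>M unif)
     {z. cell (length a) (fst z) = a \<and> cell (length b) (snd z) = b \<and> W z = 0}"

definition mass1 :: "bool list \<Rightarrow> bool list \<Rightarrow> real" where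
  "mass1 a b = measure (unif \<Otimes>\<^sub>M unif)
     {z. cell (length a) (fst z) = a \<and> cell (length b) (snd z) = b \<and> W z = 1}"

text \<open>The probability that the kernel forces the wrong adjacency between two random points of the
  cells of \<open>x\<close> and \<open>y\<close>; it is \<open>0\<close> by convention if one of the cells is a null set.\<close>

definition clash :: "nat \<Rightarrow> nat \<Rightarrow> 'a \<Rightarrow> 'a \<Rightarrow> real" where
  "clash m j x y = (let a = vtype (B j) m x; b = vtype (B j) m y in
     (if adj j x y then mass0 a b else mass1 a b) / (p a * p b))"

lemma clash_nonneg: "0 \<le> clash m j x y"
  by (auto simp: clash_def Let_def mass0_def mass1_def p_nonneg)

lemma sets_cells_W:
  "{z. cell m (fst z) = a \<and> cell n (snd z) = b \<and> W z = c} \<in> sets (unif \<Otimes>\<^sub>M unif)"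
proof -
  note [measurable] = W(1)
  have "{z \<in> space (unif \<Otimes>\<^sub>M unif). cell m (fst z) = a \<and> cell n (snd z) = b \<and> W z = c} \<in> sets (unif \<Otimes>\<^sub>M unif)"
    by measurable
  then show ?thesis by (simp add: space_pair_measure)
qed

text \<open>On a pair of cells the integrand equals \<open>dens a b\<close> where
  \<open>W = 0\<close> and \<open>1 - dens a b\<close> where \<open>W = 1\<close>; these are the
  limit probabilities of adjacency and nonadjacency given the types. The left side is kept
  unsimplified to be the termwise limit of \<open>expectation_clash\<close>; pairs with a cell of
  measure 0 contribute 0 to it.\<close>

lemma kernel_clash:
  "(\<Sum>a\<in>words m. \<Sum>b\<in>words m. e a b * (mass0 a b / (p a * p b)) +
      p a * p b * (mass1 a b / (p a * p b)) - e a b * (mass1 a b / (p a * p b)))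
   \<le> (\<integral>z. \<bar>kernel m z - W z\<bar> \<partial>(unif \<Otimes>\<^sub>M unif))"
proof -
  note [measurable] = W(1)
  let ?N = "unif \<Otimes>\<^sub>M unif"
  let ?g = "\<lambda>z. \<bar>kernel m z - W z\<bar>"
  let ?S = "\<lambda>a b. {z. cell m (fst z) = a \<and> cell m (snd z) = b}"
  let ?T = "\<lambda>a b c. {z. cell m (fst z) = a \<and> cell m (snd z) = b \<and> W z = c}"
  have g1: "?g z \<le> 1" for z using kernel_bounds[of m z] W(2,3)[of z] by (auto simp: abs_le_iff)
  have [measurable]: "?S a b \<in> sets ?N" for a b
  proof -
    have "{z \<in> space ?N. cell m (fst z) = a \<and> cell m (snd z) = b} \<in> sets ?N" by measurable
    then show ?thesis by (simp add: space_pair_measure)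
  qed
  have int: "integrable ?N (\<lambda>z. indicator (?S a b) z * ?g z)" for a b
    using g1 by (intro unif2.P.integrable_const_bound[where B = 1]) (auto simp: indicator_def)
  have cell_bound: "e a b * (mass0 a b / (p a * p b)) + p a * p b * (mass1 a b / (p a * p b))
      - e a b * (mass1 a b / (p a * p b)) \<le> (\<integral>z. indicator (?S a b) z * ?g z \<partial>?N)"
    if "length a = m" "length b = m" for a b
  proof -
    have "e a b * (mass0 a b / (p a * p b)) + p a * p b * (mass1 a b / (p a * p b))
        - e a b * (mass1 a b / (p a * p b)) \<le> dens a b * mass0 a b + (1 - dens a b) * mass1 a b"
    proof (cases "p a * p b = 0")
      case True
      have "0 \<le> dens a b * mass0 a b + (1 - dens a b) * mass1 a b"
        using dens_nonneg[of a b] dens_le_1[of a b] by (simp add: mass0_def mass1_def)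
      then show ?thesis unfolding True by simp
    qed (simp add: dens_def algebra_simps)
    also have "\<dots> = (\<integral>z. dens a b * indicator (?T a b 0) z + (1 - dens a b) * indicator (?T a b 1) z \<partial>?N)"
    proof -
      have i: "integrable ?N (\<lambda>z. t * indicator (?T a b c) z)" for t c :: real
        using sets_cells_W[of m a m b c]
        by (intro integrable_mult_right integrable_real_indicator) (auto simp: unif2.P.emeasure_eq_measure)
      show ?thesis
        using that by (subst Bochner_Integration.integral_add[OF i i])
          (simp add: mass0_def mass1_def space_pair_measure)
    qed
    also have "\<dots> \<le> (\<integral>z. indicator (?S a b) z * ?g z \<partial>?N)"
    proof (rule integral_mono[OF _ int])
      show "integrable ?N (\<lambda>z. dens a b * indicator (?T a b 0) z + (1 - dens a b) * indicator (?T a b 1) z)"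
        using sets_cells_W[of m a m b]
        by (intro Bochner_Integration.integrable_add integrable_mult_right integrable_real_indicator)
           (auto simp: unif2.P.emeasure_eq_measure)
      show "dens a b * indicator (?T a b 0) z + (1 - dens a b) * indicator (?T a b 1) z
          \<le> indicator (?S a b) z * ?g z" for z
        using dens_nonneg[of a b] dens_le_1[of a b] by (auto simp: indicator_def kernel_def)
    qed
    finally show ?thesis .
  qed
  have "(\<Sum>a\<in>words m. \<Sum>b\<in>words m. \<integral>z. indicator (?S a b) z * ?g z \<partial>?N)
      = (\<integral>z. (\<Sum>a\<in>words m. \<Sum>b\<in>words m. indicator (?S a b) z * ?g z) \<partial>?N)"
  proof -
    have "(\<integral>z. (\<Sum>a\<in>words m. \<Sum>b\<in>words m. indicator (?S a b) z * ?g z) \<partial>?N)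
        = (\<Sum>a\<in>words m. \<integral>z. (\<Sum>b\<in>words m. indicator (?S a b) z * ?g z) \<partial>?N)"
      by (rule Bochner_Integration.integral_sum) (intro Bochner_Integration.integrable_sum int)
    also have "\<dots> = (\<Sum>a\<in>words m. \<Sum>b\<in>words m. \<integral>z. indicator (?S a b) z * ?g z \<partial>?N)"
      by (intro sum.cong refl Bochner_Integration.integral_sum int)
    finally show ?thesis ..
  qed
  also have "(\<lambda>z. \<Sum>a\<in>words m. \<Sum>b\<in>words m. indicator (?S a b) z * ?g z) = ?g"
  proof
    fix z
    have "(\<Sum>a\<in>words m. \<Sum>b\<in>words m. indicator (?S a b) z * ?g z)
        = (\<Sum>a\<in>words m. if a = cell m (fst z) then \<Sum>b\<in>words m. if b = cell m (snd z) then ?g z else 0 else 0)"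
      by (intro sum.cong refl) (auto simp: indicator_def intro!: sum.cong sum.neutral)
    then show "(\<Sum>a\<in>words m. \<Sum>b\<in>words m. indicator (?S a b) z * ?g z) = ?g z"
      by (simp add: sum.delta')
  qed
  finally have "(\<Sum>a\<in>words m. \<Sum>b\<in>words m. \<integral>z. indicator (?S a b) z * ?g z \<partial>?N) = (\<integral>z. ?g z \<partial>?N)" .
  moreover have "(\<Sum>a\<in>words m. \<Sum>b\<in>words m. e a b * (mass0 a b / (p a * p b)) +
      p a * p b * (mass1 a b / (p a * p b)) - e a b * (mass1 a b / (p a * p b)))
    \<le> (\<Sum>a\<in>words m. \<Sum>b\<in>words m. \<integral>z. indicator (?S a b) z * ?g z \<partial>?N)"
    by (intro sum_mono cell_bound) auto
  ultimately show ?thesis by simp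
qed

text \<open>Nonadjacent pairs are counted as all pairs minus adjacent ones, so only frequencies with
  known limits occur.\<close>

lemma expectation_clash:
  "measure_pmf.expectation (pair_pmf (mu j) (mu j)) (\<lambda>z. clash m j (fst z) (snd z))
   = (\<Sum>a\<in>words m. \<Sum>b\<in>words m.
       edge_freq (mu j) (B j) (adj j) a b * (mass0 a b / (p a * p b)) +
       type_freq (mu j) (B j) a * type_freq (mu j) (B j) b * (mass1 a b / (p a * p b)) -
       edge_freq (mu j) (B j) (adj j) a b * (mass1 a b / (p a * p b)))"
proof -
  let ?t = "vtype (B j) m"
  let ?M = "pair_pmf (mu j) (mu j)"
  let ?\<phi>0 = "\<lambda>a b. mass0 a b / (p a * p b)" and ?\<phi>1 = "\<lambda>a b. mass1 a b / (p a * p b)"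
  have int: "integrable ?M \<psi>" for \<psi> :: "'a \<times> 'a \<Rightarrow> real"
    by (intro integrable_measure_pmf_finite) (simp add: finite_mu)
  have "(\<lambda>z. clash m j (fst z) (snd z)) =
      (\<lambda>z. of_bool (adj j (fst z) (snd z)) * ?\<phi>0 (?t (fst z)) (?t (snd z))
         + ?\<phi>1 (?t (fst z)) (?t (snd z))
         - of_bool (adj j (fst z) (snd z)) * ?\<phi>1 (?t (fst z)) (?t (snd z)))"
    by (auto simp: fun_eq_iff clash_def Let_def)
  then show ?thesis
    by (simp only: Bochner_Integration.integral_diff[OF int int] Bochner_Integration.integral_add[OF int int]
        expectation_edge_types[where \<phi> = ?\<phi>0] expectation_edge_types[where \<phi> = ?\<phi>1]
        expectation_pair_types[where \<phi> = ?\<phi>1] sum.distrib sum_subtractf)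
qed

text \<open>Every vertex outside the heavy part gets an independent uniform point, and the repaired
  graph almost surely lies in \<open>P\<close>, so it costs at least \<epsilon>. Averaging the cost
  under the condition that good vertices land in the cells of their types gives the right side: the
  weight of the bad vertices plus the expected clash. As \<open>R \<le> m\<close>, the cell of a
  point determines its adjacency to the heavy vertices.\<close>

lemma repaired_edges_error:
  assumes "R \<le> m"
  shows "\<epsilon> \<le> \<epsilon> / 8 + (\<Sum>a\<in>words m. type_freq (mu j) (B j) a * of_bool (p a = 0))
    + measure_pmf.expectation (pair_pmf (mu j) (mu j)) (\<lambda>z. clash m j (fst z) (snd z))"
proof -
  note [measurable] = W(1)
  define V where "V = verts (G j)"
  \<comment> \<open>Junk vertices are counted too: they also receive points, because the repaired
    graph must have all vertices of \<open>G j\<close>.\<close>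
  define k where "k = card (V - heavies j)"
  have finV: "finite V" by (simp add: V_def finite_verts)
  have "\<exists>y. bij_betw y {..<k} (V - heavies j)"
    using ex_bij_betw_nat_finite[of "V - heavies j"] finV by (simp add: k_def atLeast0LessThan)
  then obtain y where y: "bij_betw y {..<k} (V - heavies j)" by blast
  have y_mem: "y i \<in> V" "y i \<notin> heavies j" if "i < k" for i
    using bij_betwE[OF y] that by auto
  have y_inj: "inj_on y {..<k}" using y by (simp add: bij_betw_def)
  define yy where "yy n = (if n < R then h j n else y (n - R))" for n
  have yy: "bij_betw yy {..<R + k} V"
  proof -
    have "heavies j \<union> (V - heavies j) = V" by (auto simp: heavies_def V_def)
    then show ?thesis
      using bij_betw_append[OF h[of j, folded heavies_def] y] unfolding yy_def[abs_def] by simp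
  qed
  have yy_inj: "yy n = yy l \<longleftrightarrow> n = l" if "n < R + k" "l < R + k" for n l
    using yy that by (auto simp: bij_betw_def inj_on_def)
  have yy_mem: "yy n \<in> V" if "n < R + k" for n using bij_betwE[OF yy] that by auto
  \<comment> \<open>The heavy part as in \<open>A\<close>, every other vertex joined to it as its
    type in \<open>a\<close> says, and \<open>Fs\<close> among the other vertices. Naming graphs by
    \<open>Fs\<close> and \<open>a\<close> leaves finitely many candidates.\<close>
  define K where "K Fs a = Graph V {{yy n, yy l} | n l. n < l \<and> l < R + k \<and>
      joint_pattern R A (\<lambda>i l. (i, l) \<in> Fs) a n l}" for Fs a
  have K_simple: "simple_graph (K Fs a)" for Fs a
  proof -
    have "e \<subseteq> V \<and> card e = 2" if "e \<in> edges (K Fs a)" for e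
    proof -
      obtain n l where nl: "e = {yy n, yy l}" "n < l" "l < R + k"
        using \<open>e \<in> edges (K Fs a)\<close> by (auto simp: K_def)
      then have "yy n \<noteq> yy l" "yy n \<in> V" "yy l \<in> V" using yy_inj[of n l] yy_mem by auto
      then show ?thesis using nl(1) by simp
    qed
    moreover have "V \<noteq> {}" using simple[of j] by (simp add: simple_graph_def V_def)
    ultimately show ?thesis using finV by (simp add: simple_graph_def K_def)
  qed
  have K_edge: "{yy n, yy l} \<in> edges (K Fs a) \<longleftrightarrow> joint_pattern R A (\<lambda>i l. (i, l) \<in> Fs) a n l"
    if "n < l" "l < R + k" for Fs a n l
  proof
    assume "{yy n, yy l} \<in> edges (K Fs a)"
    then obtain n' l' where *: "{yy n, yy l} = {yy n', yy l'}" "n' < l'" "l' < R + k"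
      "joint_pattern R A (\<lambda>i l. (i, l) \<in> Fs) a n' l'" by (auto simp: K_def)
    then have "n = n' \<and> l = l'" using that by (auto simp: doubleton_eq_iff yy_inj)
    then show "joint_pattern R A (\<lambda>i l. (i, l) \<in> Fs) a n l" using * by simp
  qed (use that in \<open>auto simp: K_def\<close>)
  have K_verts: "verts (K Fs a) = V" for Fs a by (simp add: K_def)
  let ?M = "PiM {..<k} (\<lambda>_. unif)"
  have fm: "finite_measure ?M"
    by (intro prob_space.finite_measure prob_space_PiM) (rule unif.prob_space_axioms)
  note const_bound = finite_measure.integrable_const_bound[OF fm]
  define Fx where "Fx x = {(i, l) \<in> ordered_pairs k.
      W (x i, x l) \<noteq> 0 \<and> (W (x i, x l) = 1 \<or> adj j (y i) (y l))}" for x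
  define ax where "ax x = (\<lambda>i\<in>{..<k}. cell R (x i))" for x
  let ?pw = "\<lambda>Fs a. pattern_weight k (\<lambda>i t. of_bool (cell R t = a i)) (\<lambda>i l. (i, l) \<in> Fs) (\<lambda>x y. W (x, y))"
  \<comment> \<open>A literal vanishes only for an edge at \<open>W = 0\<close> or a nonedge at
    \<open>W = 1\<close>, and \<open>Fx\<close> avoids both.\<close>
  have pw_pos: "?pw (Fx x) (ax x) x \<noteq> 0" for x
  proof -
    have "literal ((i, l) \<in> Fx x) (W (x i, x l)) \<noteq> 0" if "(i, l) \<in> ordered_pairs k" for i l
      using that by (auto simp: literal_def Fx_def)
    then show ?thesis by (auto simp: pattern_weight_def ax_def prod_zero_iff)
  qed
  \<comment> \<open>By \<open>pattern_integral_zero\<close>, a pattern whose graph is outside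
    \<open>P\<close> has weight 0 off a null set. There are finitely many patterns, so one null set
    serves them all, and with them the random pattern given by \<open>Fx x\<close> and
    \<open>ax x\<close>.\<close>
  have "AE x in ?M. \<forall>Fs\<in>Pow (ordered_pairs k). \<forall>a\<in>PiE {..<k} (\<lambda>_. words R). K Fs a \<notin> P \<longrightarrow> ?pw Fs a x = 0"
  proof (intro AE_finite_allI)
    fix Fs a
    show "AE x in ?M. K Fs a \<notin> P \<longrightarrow> ?pw Fs a x = 0"
    proof (cases "K Fs a \<in> P")
      case False
      have "(\<integral>x. ?pw Fs a x \<partial>?M) = 0"
        using pattern_integral_zero[OF K_simple False yy[folded K_verts[of Fs a]] K_edge] by simp
      moreover have "0 \<le> ?pw Fs a x" "?pw Fs a x \<le> 1" for x
        using W by (auto intro!: pattern_weight_bounds)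
      moreover have "?pw Fs a \<in> borel_measurable ?M"
        by (rule measurable_pattern_weight) measurable
      ultimately have "AE x in ?M. ?pw Fs a x = 0"
        by (subst (asm) integral_nonneg_eq_0_iff_AE) (auto intro!: const_bound[where B = 1])
      then show ?thesis by eventually_elim simp
    qed simp
  qed (auto intro!: finite_PiE)
  then have KP: "AE x in ?M. K (Fx x) (ax x) \<in> P"
  proof eventually_elim
    case (elim x)
    moreover have "Fx x \<in> Pow (ordered_pairs k)" "ax x \<in> PiE {..<k} (\<lambda>_. words R)"
      by (auto simp: Fx_def ax_def)
    ultimately show ?case using pw_pos[of x] by blast
  qed
  define ty where "ty i = vtype (B j) m (y i)" for i
  define good where "good i \<longleftrightarrow> y i \<in> lights j \<and> p (ty i) \<noteq> 0" for i
  \<comment> \<open>The conditioning is done by weights: \<open>u i\<close> marks that the point of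
    a good vertex lies in its cell. Bad vertices stay unconditioned, so the total mass
    \<open>Qp\<close> is positive and can be cancelled at the end.\<close>
  define u :: "nat \<Rightarrow> real \<Rightarrow> real" where "u i t = (if good i then of_bool (cell m t = ty i) else 1)" for i t
  define q where "q i = (if good i then p (ty i) else 1)" for i
  define er :: "nat \<Rightarrow> nat \<Rightarrow> real \<times> real \<Rightarrow> real" where
    "er i l z = of_bool (if adj j (y i) (y l) then W z = 0 else W z = 1)" for i l z
  define Q where "Q = {(i, l) \<in> ordered_pairs k. good i \<and> good l}"
  define d where "d v = pmf (D j) v" for v
  define C where "C x = (\<Sum>(i, l)\<in>Q. d (y i) * d (y l) * er i l (x i, x l))" for x :: "nat \<Rightarrow> real"
  define bad where "bad = {v \<in> V - heavies j. \<not> (v \<in> lights j \<and> p (vtype (B j) m v) \<noteq> 0)}"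
  have d0: "0 \<le> d v" for v by (simp add: d_def)
  have finQ: "finite Q" by (rule finite_subset[of _ "ordered_pairs k"]) (auto simp: Q_def)
  have sumd: "sum d V = 1"
    unfolding d_def V_def using finite_verts[of j] by (intro sum_pmf_eq_1) (auto simp: set_pmf_D)
  have bad_y: "y i \<in> bad \<longleftrightarrow> \<not> good i" if "i < k" for i
    using y_mem[OF that] by (auto simp: bad_def good_def ty_def)
  \<comment> \<open>A changed edge either meets a bad vertex or joins two good ones where
    \<open>W\<close> forces the wrong adjacency. The heavy part agrees by \<open>A\<close>, and a
    good vertex keeps its edges to it because its point lies in its own cell.\<close>
  have dist: "graph_distance (D j) (G j) (K (Fx x) (ax x)) \<le> sum d bad + C x"
    if box: "\<And>i. i < k \<Longrightarrow> u i (x i) = 1" for x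
  proof -
    let ?K = "K (Fx x) (ax x)"
    let ?sym = "(edges (G j) - edges ?K) \<union> (edges ?K - edges (G j))"
    define E1 where "E1 = (\<lambda>(v, w). {v, w}) ` {(v, w) \<in> bad \<times> V. v \<noteq> w}"
    define E2 where "E2 = (\<lambda>(i, l). {y i, y l}) ` {(i, l) \<in> Q. er i l (x i, x l) = 1}"
    have fin: "finite {(v, w) \<in> bad \<times> V. v \<noteq> w}" "finite {(i, l) \<in> Q. er i l (x i, x l) = 1}"
      using finV finQ by (auto intro: finite_subset[of _ "V \<times> V"] finite_subset[of _ Q] simp: bad_def)
    have sub: "?sym \<subseteq> E1 \<union> E2"
    proof
      fix e assume e: "e \<in> ?sym"
      then have "e \<subseteq> V" "card e = 2"
        using simple[of j] K_simple[of "Fx x" "ax x"] by (auto simp: simple_graph_def V_def K_verts)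
      then obtain v w where vw: "e = {v, w}" "v \<noteq> w" "v \<in> V" "w \<in> V" by (auto simp: card_2_iff)
      then obtain n' l' where "v = yy n'" "w = yy l'" "n' < R + k" "l' < R + k"
        using yy unfolding bij_betw_def by (metis imageE lessThan_iff)
      then obtain n l where nl: "e = {yy n, yy l}" "n < l" "l < R + k"
        using vw(1,2) by (cases n' l' rule: linorder_cases) (auto simp: insert_commute)
      have diff: "adj j (yy n) (yy l) \<noteq> joint_pattern R A (\<lambda>i l. (i, l) \<in> Fx x) (ax x) n l"
        using e K_edge[OF nl(2,3)] unfolding nl(1) adj_def by blast
      have E1I: "e \<in> E1" if "e = {v, w}" "v \<in> bad" "v \<noteq> w" "w \<in> V" for v w
        using that unfolding E1_def by force
      consider "l < R" | "n < R" "R \<le> l" | "R \<le> n" "R \<le> l" by linarith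
      then show "e \<in> E1 \<union> E2"
      proof cases
        case 1
        then show ?thesis using diff A[of n l j] nl by (simp add: joint_pattern_def yy_def adj_def)
      next
        case 2
        define i where "i = l - R"
        have i: "i < k" "yy l = y i" "yy n = h j n" using 2 nl by (auto simp: i_def yy_def)
        have "\<not> good i"
        proof
          assume "good i"
          then have "cell m (x i) = ty i" using box[OF i(1)] by (auto simp: u_def split: if_splits)
          then have "cell R (x i) = vtype (B j) R (y i)"
            unfolding cell_prefix[OF assms] vtype_prefix[OF assms] ty_def by simp
          then have "ax x i ! (R - 1 - n) = adj j (y i) (h j n)"
            using nth_vtype[of n R "B j" "y i"] B[of n j "y i"] 2 i by (simp add: ax_def)
          then show False
            using diff 2 i by (simp add: joint_pattern_def i_def[symmetric] adj_def insert_commute)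
        qed
        moreover have "y i \<noteq> h j n" using y_mem(2)[OF i(1)] h_mem[OF 2(1), of j] by auto
        ultimately show ?thesis
          using E1I[of "y i" "h j n"] bad_y[OF i(1)] y_mem[OF i(1)] h_mem[OF 2(1), of j] i nl(1)
          by (auto simp: heavies_def V_def insert_commute)
      next
        case 3
        define i where "i = n - R"
        define i' where "i' = l - R"
        have i: "i < k" "i' < k" "yy n = y i" "yy l = y i'" "(i, i') \<in> ordered_pairs k" "y i \<noteq> y i'"
          using 3 nl yy_inj[of n l] by (auto simp: i_def i'_def yy_def ordered_pairs_def)
        show ?thesis
        proof (cases "good i \<and> good i'")
          case True
          have "adj j (y i) (y i') \<noteq> ((i, i') \<in> Fx x)"
            using diff 3 i by (simp add: joint_pattern_def i_def i'_def)
          then have "er i i' (x i, x i') = 1" using i(5) by (auto simp: er_def Fx_def)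
          then have "e \<in> E2" unfolding E2_def using nl(1) i True by (force simp: Q_def)
          then show ?thesis by simp
        next
          case False
          then show ?thesis
            using E1I[of "y i" "y i'"] E1I[of "y i'" "y i"] bad_y[OF i(1)] bad_y[OF i(2)]
              y_mem[OF i(1)] y_mem[OF i(2)] i nl(1) by (auto simp: insert_commute)
        qed
      qed
    qed
    let ?w = "\<lambda>e. \<Prod>v\<in>e. d v"
    have w0: "0 \<le> ?w e" for e using d0 by (intro prod_nonneg) auto
    have finE: "finite E1" "finite E2" unfolding E1_def E2_def using fin by auto
    have "sum ?w ?sym \<le> sum ?w (E1 \<union> E2)" using sub w0 finE by (intro sum_mono2) auto
    also have "\<dots> \<le> sum ?w E1 + sum ?w E2"
      using w0 finE by (subst sum_Un) (auto intro!: sum_nonneg)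
    also have "sum ?w E1 \<le> sum d bad"
    proof -
      have "sum ?w E1 \<le> sum (?w \<circ> (\<lambda>(v, w). {v, w})) {(v, w) \<in> bad \<times> V. v \<noteq> w}"
        unfolding E1_def using fin w0 by (intro sum_image_le) auto
      also have "\<dots> = (\<Sum>(v, w)\<in>{(v, w) \<in> bad \<times> V. v \<noteq> w}. d v * d w)"
        by (intro sum.cong) auto
      also have "\<dots> \<le> (\<Sum>(v, w)\<in>bad \<times> V. d v * d w)"
        using finV d0 by (intro sum_mono2) (auto simp: bad_def)
      also have "\<dots> = sum d bad * sum d V"
        by (simp add: sum_product sum.cartesian_product)
      finally show ?thesis by (simp add: sumd)
    qed
    also have "sum ?w E2 \<le> C x"
    proof -
      have "sum ?w E2 \<le> sum (?w \<circ> (\<lambda>(i, l). {y i, y l})) {(i, l) \<in> Q. er i l (x i, x l) = 1}"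
        unfolding E2_def using fin w0 by (intro sum_image_le) auto
      also have "\<dots> = (\<Sum>(i, l)\<in>{(i, l) \<in> Q. er i l (x i, x l) = 1}. d (y i) * d (y l) * er i l (x i, x l))"
        using y_inj by (intro sum.cong) (auto simp: Q_def ordered_pairs_def inj_on_eq_iff)
      also have "\<dots> \<le> C x"
        unfolding C_def using finQ d0 by (intro sum_mono2) (auto simp: er_def)
      finally show ?thesis .
    qed
    finally show ?thesis by (simp add: graph_distance_def d_def)
  qed
  have u01: "0 \<le> u i t" "u i t \<le> 1" for i t by (auto simp: u_def)
  have um[measurable]: "u i \<in> borel_measurable unif" for i
    unfolding u_def by measurable
  have erm[measurable]: "er i l \<in> borel_measurable (unif \<Otimes>\<^sub>M unif)" for i l
    unfolding er_def by measurable
  have er01: "0 \<le> er i l z" "er i l z \<le> 1" for i l z by (auto simp: er_def)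
  have qu: "(\<integral>t. u i t \<partial>unif) = q i" if "i < k" for i
  proof (cases "good i")
    case True
    then have "u i = indicator {t. cell m t = ty i}" by (auto simp: u_def fun_eq_iff indicator_def)
    then show ?thesis using True measure_cell[of "ty i" m] by (simp add: q_def ty_def)
  next
    case False
    then show ?thesis by (simp add: u_def q_def unif.prob_space[simplified])
  qed
  have q_pos: "0 < q i" for i using p_nonneg[of "ty i"] by (auto simp: q_def good_def less_le)
  define Qp where "Qp = (\<Prod>i<k. q i)"
  have Qp: "0 < Qp" unfolding Qp_def using q_pos by (intro prod_pos) auto
  \<comment> \<open>Multiplication by the indicators makes both sides vanish off the conditioning
    event, so the cost bound \<open>dist\<close> is used only on it.\<close>
  have AEb: "AE x in ?M. (\<epsilon> - sum d bad) * (\<Prod>i<k. u i (x i)) \<le> (\<Prod>i<k. u i (x i)) * C x"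
    using KP
  proof eventually_elim
    case (elim x)
    show ?case
    proof (cases "\<forall>i<k. u i (x i) = 1")
      case True
      have "\<epsilon> \<le> graph_distance (D j) (G j) (K (Fx x) (ax x))"
        using far[of j] elim K_verts[of "Fx x" "ax x"] by (simp add: far_from_def V_def)
      then have "\<epsilon> - sum d bad \<le> C x" using dist[of x] True by simp
      moreover have "(\<Prod>i<k. u i (x i)) = 1" using True by (intro prod.neutral) auto
      ultimately show ?thesis by simp
    next
      case False
      then obtain i where "i < k" "u i (x i) = 0" by (auto simp: u_def split: if_splits)
      then have zero: "(\<Prod>i<k. u i (x i)) = 0" by (intro prod_zero) auto
      show ?thesis unfolding zero by simp
    qed
  qed
  have prod01: "0 \<le> (\<Prod>i<k. u i (x i))" "(\<Prod>i<k. u i (x i)) \<le> 1" for x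
    using u01 by (auto intro!: prod_nonneg prod_le_1)
  have im: "(\<lambda>x. (\<Prod>r<k. u r (x r)) * er i l (x i, x l)) \<in> borel_measurable ?M" if "(i, l) \<in> Q" for i l
  proof -
    have [measurable]: "i \<in> {..<k}" "l \<in> {..<k}" using that by (auto simp: Q_def ordered_pairs_def)
    show ?thesis by measurable
  qed
  have ii: "integrable ?M (\<lambda>x. (\<Prod>r<k. u r (x r)) * er i l (x i, x l))" if "(i, l) \<in> Q" for i l
    using prod01 er01 im[OF that] by (intro const_bound[where B = 1])
      (auto simp: abs_mult intro!: mult_le_one)
  have iu: "integrable ?M (\<lambda>x. \<Prod>r<k. u r (x r))"
    using prod01 by (intro const_bound[where B = 1]) auto
  have uC: "(\<lambda>x. (\<Prod>i<k. u i (x i)) * C x)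
      = (\<lambda>x. \<Sum>(i, l)\<in>Q. d (y i) * d (y l) * ((\<Prod>r<k. u r (x r)) * er i l (x i, x l)))"
    by (auto simp: C_def sum_distrib_left fun_eq_iff mult_ac case_prod_unfold)
  have "(\<epsilon> - sum d bad) * Qp = (\<integral>x. (\<epsilon> - sum d bad) * (\<Prod>i<k. u i (x i)) \<partial>?M)"
  proof -
    have "(\<integral>x. (\<Prod>i<k. u i (x i)) \<partial>?M) = (\<Prod>i<k. \<integral>t. u i t \<partial>unif)"
      using u01 by (intro unif_prod.product_integral_prod) (auto intro!: unif.integrable_const_bound[where B = 1])
    then show ?thesis by (simp add: qu Qp_def)
  qed
  also have "\<dots> \<le> (\<integral>x. (\<Prod>i<k. u i (x i)) * C x \<partial>?M)"
  proof (rule integral_mono_AE[OF _ _ AEb])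
    show "integrable ?M (\<lambda>x. (\<Prod>i<k. u i (x i)) * C x)"
      unfolding uC using ii
      by (intro Bochner_Integration.integrable_sum) (auto simp: case_prod_unfold)
  qed (use iu in simp)
  also have "\<dots> = (\<Sum>(i, l)\<in>Q. d (y i) * d (y l) * (\<integral>x. (\<Prod>r<k. u r (x r)) * er i l (x i, x l) \<partial>?M))"
    unfolding uC using ii by (subst Bochner_Integration.integral_sum) (auto simp: case_prod_unfold)
  also have "\<dots> = (\<Sum>(i, l)\<in>Q. d (y i) * d (y l) * (Qp * clash m j (y i) (y l)))"
  proof (intro sum.cong refl, clarify)
    fix i l assume il: "(i, l) \<in> Q"
    then have i: "i < k" "l < k" "i \<noteq> l" "good i" "good l" by (auto simp: Q_def ordered_pairs_def)
    have "(\<integral>x. (\<Prod>r<k. u r (x r)) * er i l (x i, x l) \<partial>?M)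
        = (\<Prod>r\<in>{..<k} - {i, l}. \<integral>t. u r t \<partial>unif) *
          (\<integral>z. u i (fst z) * u l (snd z) * er i l z \<partial>(unif \<Otimes>\<^sub>M unif))"
      using i u01 er01 by (intro integral_product_pair) auto
    also have "(\<Prod>r\<in>{..<k} - {i, l}. \<integral>t. u r t \<partial>unif) = (\<Prod>r\<in>{..<k} - {i, l}. q r)"
      by (intro prod.cong refl qu) auto
    also have "(\<integral>z. u i (fst z) * u l (snd z) * er i l z \<partial>(unif \<Otimes>\<^sub>M unif))
        = (if adj j (y i) (y l) then mass0 (ty i) (ty l) else mass1 (ty i) (ty l))"
    proof -
      let ?c = "if adj j (y i) (y l) then 0 else (1 :: real)"
      have "(\<lambda>z. u i (fst z) * u l (snd z) * er i l z)
          = indicator {z. cell m (fst z) = ty i \<and> cell m (snd z) = ty l \<and> W z = ?c}"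
        using i by (auto simp: fun_eq_iff u_def er_def indicator_def)
      then show ?thesis by (simp add: mass0_def mass1_def ty_def space_pair_measure)
    qed
    \<comment> \<open>Dividing by the two missing masses turns the joint masses \<open>mass0\<close>
      and \<open>mass1\<close> into the conditional probability \<open>clash\<close>.\<close>
    also have "(\<Prod>r\<in>{..<k} - {i, l}. q r) = Qp / (p (ty i) * p (ty l))"
    proof -
      have "Qp = q i * (q l * (\<Prod>r\<in>{..<k} - {i} - {l}. q r))"
        unfolding Qp_def using i by (simp add: prod.remove[of _ i] prod.remove[of _ l])
      moreover have "{..<k} - {i} - {l} = {..<k} - {i, l}" by auto
      ultimately show ?thesis using i by (simp add: q_def good_def)
    qed
    finally show "d (y i) * d (y l) * (\<integral>x. (\<Prod>r<k. u r (x r)) * er i l (x i, x l) \<partial>?M)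
        = d (y i) * d (y l) * (Qp * clash m j (y i) (y l))"
      by (simp add: clash_def Let_def ty_def)
  qed
  also have "\<dots> = Qp * (\<Sum>(i, l)\<in>Q. d (y i) * d (y l) * clash m j (y i) (y l))"
    by (simp add: sum_distrib_left case_prod_unfold mult_ac)
  finally have "\<epsilon> - sum d bad \<le> (\<Sum>(i, l)\<in>Q. d (y i) * d (y l) * clash m j (y i) (y l))"
    using Qp by (simp add: mult.commute)
  \<comment> \<open>Conditioning on the light vertices divides their weights by a mass of at most 1,
    so it can only increase them.\<close>
  also have "\<dots> \<le> (\<Sum>(v, w)\<in>(\<lambda>(i, l). (y i, y l)) ` Q. pmf (mu j) v * pmf (mu j) w * clash m j v w)"
  proof -
    have dm: "d v \<le> pmf (mu j) v" if "v \<in> lights j" for v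
      using that lights_pos[of j] measure_pmf.prob_le_1[of "D j" "lights j"]
      by (simp add: pmf_mu d_def le_divide_eq mult_left_le)
    have "inj_on (\<lambda>(i, l). (y i, y l)) Q"
      using y_inj by (auto simp: inj_on_def Q_def ordered_pairs_def)
    then show ?thesis
      by (simp add: sum.reindex case_prod_unfold)
         (intro sum_mono mult_mono mult_right_mono dm,
          auto simp: Q_def good_def d0 clash_nonneg)
  qed
  also have "\<dots> \<le> (\<Sum>(v, w)\<in>lights j \<times> lights j. pmf (mu j) v * pmf (mu j) w * clash m j v w)"
    using finite_mu[of j] by (intro sum_mono2) (auto simp: set_mu Q_def good_def clash_nonneg)
  also have "\<dots> = measure_pmf.expectation (pair_pmf (mu j) (mu j)) (\<lambda>z. clash m j (fst z) (snd z))"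
    using finite_mu[of j] by (subst integral_measure_pmf_real[of "lights j \<times> lights j"])
      (auto simp: set_mu pmf_pair case_prod_unfold mult_ac intro!: sum.cong)
  finally have 1: "\<epsilon> - sum d bad
      \<le> measure_pmf.expectation (pair_pmf (mu j) (mu j)) (\<lambda>z. clash m j (fst z) (snd z))" .
  let ?J = "{v \<in> V. \<theta>s j \<le> pmf (D j) v \<and> pmf (D j) v < \<theta>}"
  let ?N = "{v \<in> lights j. p (vtype (B j) m v) = 0}"
  have finJN: "finite ?J" "finite ?N" using finV by (auto simp: lights_def V_def)
  \<comment> \<open>A bad vertex is junk, with total weight at most \<epsilon> / 8, or light with a
    type of limit frequency 0.\<close>
  have "sum d bad \<le> sum d (?J \<union> ?N)"
    using finJN d0 by (intro sum_mono2) (auto simp: bad_def lights_def heavies_def V_def)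
  also have "\<dots> \<le> sum d ?J + sum d ?N"
    using finJN d0 by (subst sum_Un) (auto intro!: sum_nonneg)
  also have "sum d ?J \<le> \<epsilon> / 8"
    using junk[of j] finJN unfolding d_def V_def by (simp add: measure_measure_pmf_finite)
  also have "sum d ?N \<le> (\<Sum>a\<in>words m. type_freq (mu j) (B j) a * of_bool (p a = 0))"
  proof -
    have "sum d ?N \<le> (\<Sum>v\<in>?N. pmf (mu j) v)"
      using lights_pos[of j] measure_pmf.prob_le_1[of "D j" "lights j"]
      by (intro sum_mono) (simp add: pmf_mu d_def le_divide_eq mult_left_le)
    also have "\<dots> = measure (mu j) ?N" using finJN by (simp add: measure_measure_pmf_finite)
    also have "\<dots> \<le> measure (mu j) {v. p (vtype (B j) m v) = 0}"
      by (intro measure_pmf.finite_measure_mono) auto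
    also have "\<dots> = measure_pmf.expectation (mu j) (\<lambda>v. of_bool True * of_bool (p (vtype (B j) m v) = 0))"
    proof -
      have "(\<lambda>v. of_bool True * of_bool (p (vtype (B j) m v) = 0)) = (indicator {v. p (vtype (B j) m v) = 0} :: 'a \<Rightarrow> real)"
        by (auto simp: fun_eq_iff indicator_def)
      then show ?thesis by simp
    qed
    also have "\<dots> = (\<Sum>a\<in>words m. measure (mu j) {v. True \<and> vtype (B j) m v = a} * of_bool (p a = 0))"
      by (rule expectation_of_bool_finite_range) auto
    also have "\<dots> = (\<Sum>a\<in>words m. type_freq (mu j) (B j) a * of_bool (p a = 0))"
      by (intro sum.cong refl) (simp add: type_freq_def)
    finally show ?thesis .
  qed
  finally show ?thesis using 1 by simp
qed

text \<open>The depth \<open>m\<close> is fixed before \<open>j\<close>, with kernel error below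
  \<epsilon> / 4. For late \<open>j\<close> the types of limit frequency 0, finitely many at this
  depth, weigh less than \<epsilon> / 4, and the expected clash is below \<epsilon> / 4. The total 5
  \<epsilon> / 8 is too small for an \<epsilon>-far graph.\<close>

lemma contradiction: False
proof -
  have "\<forall>\<^sub>F m in sequentially. (\<integral>z. \<bar>kernel m z - W z\<bar> \<partial>(unif \<Otimes>\<^sub>M unif)) < \<epsilon> / 4"
    using W_lim by (rule order_tendstoD(2)) (use eps in simp)
  then obtain m0 where m0: "\<And>m. m \<ge> m0 \<Longrightarrow> (\<integral>z. \<bar>kernel m z - W z\<bar> \<partial>(unif \<Otimes>\<^sub>M unif)) < \<epsilon> / 4"
    by (auto simp: eventually_sequentially)
  define m where "m = max m0 R"
  let ?Z = "\<lambda>j. \<Sum>a\<in>words m. type_freq (mu (\<rho> j)) (B (\<rho> j)) a * of_bool (p a = 0)"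
  let ?E = "\<lambda>j. measure_pmf.expectation (pair_pmf (mu (\<rho> j)) (mu (\<rho> j))) (\<lambda>z. clash m (\<rho> j) (fst z) (snd z))"
  have "?Z \<longlonglongrightarrow> (\<Sum>a\<in>words m. p a * of_bool (p a = 0))"
    by (intro tendsto_intros type_lim)
  moreover have "(\<Sum>a\<in>words m. p a * of_bool (p a = 0)) = 0" by (intro sum.neutral) auto
  ultimately have Z: "\<forall>\<^sub>F j in sequentially. ?Z j < \<epsilon> / 4"
    using eps by (intro order_tendstoD(2)[of ?Z 0]) auto
  have "?E \<longlonglongrightarrow> (\<Sum>a\<in>words m. \<Sum>b\<in>words m. e a b * (mass0 a b / (p a * p b)) +
      p a * p b * (mass1 a b / (p a * p b)) - e a b * (mass1 a b / (p a * p b)))"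
    unfolding expectation_clash by (intro tendsto_intros type_lim edge_lim)
  moreover have "(\<Sum>a\<in>words m. \<Sum>b\<in>words m. e a b * (mass0 a b / (p a * p b)) +
      p a * p b * (mass1 a b / (p a * p b)) - e a b * (mass1 a b / (p a * p b))) < \<epsilon> / 4"
    by (rule le_less_trans[OF kernel_clash m0]) (simp add: m_def)
  ultimately have E: "\<forall>\<^sub>F j in sequentially. ?E j < \<epsilon> / 4" by (rule order_tendstoD(2))
  obtain j where "?Z j < \<epsilon> / 4" "?E j < \<epsilon> / 4"
    using eventually_happens'[OF sequentially_bot eventually_conj[OF Z E]] by blast
  moreover have "\<epsilon> \<le> \<epsilon> / 8 + ?Z j + ?E j" by (rule repaired_edges_error) (simp add: m_def)
  ultimately show False using eps by simp
qed

end

lemma (in bad_sequence) contradiction: False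
proof -
  define \<beta> where "\<beta> j x r = adj j x (h j r)" for j x r
  obtain \<rho> B p e W where *: "strict_mono (\<rho> :: nat \<Rightarrow> nat)" "\<And>j x r. r < R \<Longrightarrow> B j x r = \<beta> j x r"
    "step_system p e"
    "\<And>w. (\<lambda>j. type_freq (mu (\<rho> j)) (B (\<rho> j)) w) \<longlonglongrightarrow> p w"
    "\<And>a b. (\<lambda>j. edge_freq (mu (\<rho> j)) (B (\<rho> j)) (adj (\<rho> j)) a b) \<longlonglongrightarrow> e a b"
    "W \<in> borel_measurable (unif \<Otimes>\<^sub>M unif)" "\<And>z. 0 \<le> W z" "\<And>z. W z \<le> 1"
    "(\<lambda>m. \<integral>z. \<bar>step_system.kernel p e m z - W z\<bar> \<partial>(unif \<Otimes>\<^sub>M unif)) \<longlonglongrightarrow> 0"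
    "\<And>k F a. (\<lambda>j. measure_pmf.expectation (tuple_pmf k (mu (\<rho> j)))
           (pattern_weight k (\<lambda>i x. of_bool (vtype (B (\<rho> j)) R x = a i)) F (\<lambda>x y. of_bool (adj (\<rho> j) x y))))
         \<longlonglongrightarrow> (\<integral>x. pattern_weight k (\<lambda>i t. of_bool (step_system.cell p R t = a i)) F (\<lambda>x y. W (x, y)) x
                \<partial>PiM {..<k} (\<lambda>_. unif))"
    by (rule graph_compactness[of mu R \<beta> adj, OF finite_mu]) (rule that)
  interpret bad_limit P \<epsilon> \<delta> \<theta> R A G D h \<theta>s p e \<rho> B W
    by (intro bad_limit.intro bad_limit_axioms.intro bad_sequence_axioms) (use * in \<open>auto simp: \<beta>_def\<close>)
  show False by (rule contradiction)
qed

section \<open>Testability\<close>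

lemma card_heavy_le:
  assumes "finite V" "0 < c"
  shows "real (card {v \<in> V. c \<le> pmf D v}) * c \<le> 1"
proof -
  have "real (card {v \<in> V. c \<le> pmf D v}) * c = (\<Sum>v\<in>{v \<in> V. c \<le> pmf D v}. c)" by simp
  also have "\<dots> \<le> (\<Sum>v\<in>{v \<in> V. c \<le> pmf D v}. pmf D v)" by (intro sum_mono) auto
  also have "\<dots> = measure D {v \<in> V. c \<le> pmf D v}"
    using assms by (simp add: measure_measure_pmf_finite)
  finally show ?thesis using measure_pmf.prob_le_1[of D "{v \<in> V. c \<le> pmf D v}"] by linarith
qed

lemma power_le_prod_list:
  fixes c :: real
  assumes "0 \<le> c" "\<And>x. x \<in> set xs \<Longrightarrow> c \<le> f x"
  shows "c ^ length xs \<le> prod_list (map f xs)"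
  using assms(2)
proof (induction xs)
  case (Cons x xs)
  then have "c ^ length xs \<le> prod_list (map f xs)" "c \<le> f x" by auto
  moreover have "0 \<le> f x" using assms(1) \<open>c \<le> f x\<close> by simp
  ultimately show ?case using assms(1) by (auto intro!: mult_mono)
qed simp

lemma far_from_not_mem: "far_from \<epsilon> P G D \<Longrightarrow> 0 < \<epsilon> \<Longrightarrow> G \<notin> P"
  by (auto simp: far_from_def graph_distance_def dest!: bspec)

lemma list_with_set:
  assumes "finite V" "V \<noteq> {}" "card V \<le> N"
  obtains xs where "length xs = N" "set xs = V"
proof -
  obtain vs where vs: "set vs = V" "distinct vs" using finite_distinct_list[OF assms(1)] by blast
  then have "length vs \<le> N" "vs \<noteq> []" using assms by (auto simp: distinct_card[symmetric])
  then show ?thesis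
    using that[of "vs @ replicate (N - length vs) (hd vs)"] vs hd_in_set[of vs]
    by (auto simp: set_replicate_conv_if insert_absorb)
qed

lemma exists_violation_bound:
  fixes P :: "'a graph set" and \<epsilon> \<delta> :: real
  assumes gp: "graph_property P" "hereditary P" and eps: "0 < \<epsilon>" and delta: "0 < \<delta>"
  shows "\<exists>s>0. \<forall>G D. weighted_graph G D \<longrightarrow> \<delta> / real (card (verts G)) \<le> (MIN v\<in>verts G. pmf D v) \<longrightarrow>
    far_from \<epsilon> P G D \<longrightarrow> 2 / 3 \<le> violation P G D s"
proof (rule ccontr)
  assume contr: "\<not> ?thesis"
  have neg: "\<exists>G D. weighted_graph G D \<and> \<delta> / real (card (verts G)) \<le> (MIN v\<in>verts G. pmf D v) \<and>
    far_from \<epsilon> P G D \<and> violation P G D s < 2 / 3" if "s > 0" for s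
    using contr that by (meson not_le)
  \<comment> \<open>Index 0 receives the counterexample for one draw, so that the sequence is
    indexed by all natural numbers.\<close>
  have "\<exists>G D. weighted_graph G D \<and> \<delta> / real (card (verts G)) \<le> (MIN v\<in>verts G. pmf D v) \<and>
    far_from \<epsilon> P G D \<and> (s > 0 \<longrightarrow> violation P G D s < 2 / 3)" for s
    using neg[of s] neg[of 1] by (cases "s > 0") auto
  then obtain G D where wg: "\<And>s. weighted_graph (G s) (D s)"
    and min: "\<And>s. \<delta> / real (card (verts (G s))) \<le> (MIN v\<in>verts (G s). pmf (D s) v)"
    and far: "\<And>s. far_from \<epsilon> P (G s) (D s)"
    and small: "\<And>s. s > 0 \<Longrightarrow> violation P (G s) (D s) s < 2 / 3"
    by metis
  have simple: "simple_graph (G s)" for s using wg by (simp add: weighted_graph_def)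
  have fin: "finite (verts (G s))" and ne: "verts (G s) \<noteq> {}" for s
    using simple[of s] by (auto simp: simple_graph_def)
  have card_pos: "0 < card (verts (G s))" for s using fin ne by (simp add: card_gt_0_iff)
  have low: "\<delta> / real (card (verts (G s))) \<le> pmf (D s) v" if "v \<in> verts (G s)" for s v
  proof -
    have "(MIN v\<in>verts (G s). pmf (D s) v) \<le> pmf (D s) v" using that fin by (intro Min_le) auto
    then show ?thesis using min[of s] by linarith
  qed
  have viol: "(\<lambda>s. violation P (G s) (D s) k) \<longlonglongrightarrow> 0" if "k > 0" for k
    by (rule violation_tendsto_0[OF gp wg small that])
  \<comment> \<open>With at most \<open>N\<close> vertices, each of weight at least \<delta> / N, a
    sample of \<open>N\<close> draws would exhaust them with probability at least (\<delta> / N)^N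
    and reveal the input itself, which is not in \<open>P\<close>.\<close>
  have large: "\<forall>\<^sub>F s in sequentially. N < card (verts (G s))" if N: "N > 0" for N
  proof -
    have "\<forall>\<^sub>F s in sequentially. violation P (G s) (D s) N < (\<delta> / real N) ^ N"
      using viol[OF N] by (rule order_tendstoD(2)) (use N delta in simp)
    then show ?thesis
    proof eventually_elim
      case (elim s)
      show ?case
      proof (rule ccontr)
        assume "\<not> N < card (verts (G s))"
        then have le: "card (verts (G s)) \<le> N" by simp
        obtain xs where xs: "length xs = N" "set xs = verts (G s)"
          by (rule list_with_set[OF fin ne le])
        have "(\<delta> / real N) ^ length xs \<le> prod_list (map (pmf (D s)) xs)"
        proof (rule power_le_prod_list)
          fix v assume "v \<in> set xs"
          have "\<delta> / real N \<le> \<delta> / real (card (verts (G s)))"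
            using le card_pos[of s] delta by (intro divide_left_mono) auto
          also have "\<dots> \<le> pmf (D s) v" using low \<open>v \<in> set xs\<close> xs by simp
          finally show "\<delta> / real N \<le> pmf (D s) v" .
        qed (use delta in simp)
        also have "\<dots> = (\<Sum>xs\<in>{xs}. prod_list (map (pmf (D s)) xs))" by simp
        also have "\<dots> \<le> violation P (G s) (D s) N"
          using xs far_from_not_mem[OF far eps, of s] induced_verts[OF simple[of s]]
          by (intro violation_ge_sum) auto
        finally show False using elim xs by simp
      qed
    qed
  qed
  \<comment> \<open>The limits \<open>g i\<close> of these weights are bounded and increase with
    \<open>i\<close>, so from some \<open>i0\<close> on they grow by less than \<epsilon> / 8: in
    the limit little weight lies between the threshold \<open>i0\<close> and any later one. This
    yields \<open>\<theta>\<close>.\<close>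
  define X where "X i s = measure (D s) {v \<in> verts (G s). 1 / real (Suc i) \<le> pmf (D s) v}" for i s :: nat
  have "\<bar>X i s\<bar> \<le> 1" for i s by (simp add: X_def)
  from diagonal_convergent_subseq[of X, OF this]
  obtain \<sigma> :: "nat \<Rightarrow> nat" where \<sigma>: "strict_mono \<sigma>" "\<And>i. convergent (\<lambda>n. X i (\<sigma> n))" by blast
  define g where "g i = lim (\<lambda>n. X i (\<sigma> n))" for i
  have g: "(\<lambda>n. X i (\<sigma> n)) \<longlonglongrightarrow> g i" for i
    using \<sigma>(2)[of i] by (simp add: g_def convergent_LIMSEQ_iff)
  have X_mono: "X i s \<le> X i' s" if "i \<le> i'" for i i' s
  proof -
    have "1 / real (Suc i') \<le> 1 / real (Suc i)" using that by (intro divide_left_mono) auto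
    then show ?thesis unfolding X_def by (intro measure_pmf.finite_measure_mono) auto
  qed
  have g_mono: "g i \<le> g i'" if "i \<le> i'" for i i'
    using g g by (rule LIMSEQ_le) (use X_mono[OF that] in blast)
  have g_bound: "norm (g i) \<le> 1" for i
  proof -
    have "0 \<le> g i" using g by (rule LIMSEQ_le_const) (simp add: X_def)
    moreover have "g i \<le> 1" using g by (rule LIMSEQ_le_const2) (simp add: X_def)
    ultimately show ?thesis by simp
  qed
  have "convergent g"
    using g_bound g_mono by (intro Bseq_mono_convergent BseqI[of 1]) auto
  then have "Cauchy g" by (rule convergent_Cauchy)
  then obtain i0 where i0: "\<And>i. i \<ge> i0 \<Longrightarrow> norm (g i - g i0) < \<epsilon> / 8"
    using eps unfolding Cauchy_iff by (metis order_refl divide_pos_pos zero_less_numeral)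
  \<comment> \<open>The light threshold moves with \<open>j\<close>, so each input has to control
    only one later layer. The bound on the number of vertices makes those above the light threshold,
    at most \<open>Suc (i0 + j)\<close>, fewer than half.\<close>
  have "\<exists>s\<ge>j. X (i0 + j) s - X i0 s < \<epsilon> / 8 \<and> 2 * Suc (i0 + j) < card (verts (G s))" for j
  proof -
    have "(\<lambda>n. X (i0 + j) (\<sigma> n) - X i0 (\<sigma> n)) \<longlonglongrightarrow> g (i0 + j) - g i0" by (intro tendsto_intros g)
    moreover have "g (i0 + j) - g i0 < \<epsilon> / 8"
      using i0[OF le_add1, of j] unfolding real_norm_def by linarith
    ultimately have ev1: "\<forall>\<^sub>F n in sequentially. X (i0 + j) (\<sigma> n) - X i0 (\<sigma> n) < \<epsilon> / 8"
      by (rule order_tendstoD(2))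
    have ev2: "\<forall>\<^sub>F n in sequentially. 2 * Suc (i0 + j) < card (verts (G (\<sigma> n)))"
      using filterlim_subseq[OF \<sigma>(1)] large[of "2 * Suc (i0 + j)"]
      by (auto dest: filterlim_iff[THEN iffD1])
    obtain n where "n \<ge> j" "X (i0 + j) (\<sigma> n) - X i0 (\<sigma> n) < \<epsilon> / 8" "2 * Suc (i0 + j) < card (verts (G (\<sigma> n)))"
      using eventually_happens'[OF sequentially_bot
          eventually_conj[OF eventually_ge_at_top[of j] eventually_conj[OF ev1 ev2]]] by blast
    then show ?thesis using seq_suble[OF \<sigma>(1), of n] by (intro exI[of _ "\<sigma> n"]) auto
  qed
  then obtain t where t: "\<And>j. j \<le> t j" "\<And>j. X (i0 + j) (t j) - X i0 (t j) < \<epsilon> / 8"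
    "\<And>j. 2 * Suc (i0 + j) < card (verts (G (t j)))" by metis
  have t_lim: "filterlim t at_top sequentially"
    by (rule filterlim_at_top_mono[OF filterlim_ident]) (use t(1) in simp)
  define \<theta> where "\<theta> = 1 / real (Suc i0)"
  define \<theta>s where "\<theta>s j = 1 / real (Suc (i0 + j))" for j
  have \<theta>s_le: "\<theta>s j \<le> \<theta>" for j unfolding \<theta>_def \<theta>s_def by (intro divide_left_mono) auto
  have \<theta>s_lim: "\<theta>s \<longlonglongrightarrow> 0"
    using LIMSEQ_ignore_initial_segment[OF LIMSEQ_inverse_real_of_nat, of i0]
    by (simp add: \<theta>s_def[abs_def] inverse_eq_divide add.commute)
  define V where "V j = verts (G (t j))" for j
  define Hv where "Hv j = {v \<in> V j. \<theta> \<le> pmf (D (t j)) v}" for j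
  have finV: "finite (V j)" for j using fin by (simp add: V_def)
  have finHv: "finite (Hv j)" for j using finV by (simp add: Hv_def)
  have junk: "measure (D (t j)) {v \<in> V j. \<theta>s j \<le> pmf (D (t j)) v \<and> pmf (D (t j)) v < \<theta>} < \<epsilon> / 8" for j
  proof -
    have "{v \<in> V j. \<theta>s j \<le> pmf (D (t j)) v \<and> pmf (D (t j)) v < \<theta>}
        = {v \<in> V j. \<theta>s j \<le> pmf (D (t j)) v} - {v \<in> V j. \<theta> \<le> pmf (D (t j)) v}" by auto
    also have "measure (D (t j)) \<dots> = X (i0 + j) (t j) - X i0 (t j)"
      unfolding X_def \<theta>s_def \<theta>_def V_def
      using \<theta>s_le[of j] by (intro measure_pmf.finite_measure_Diff) (auto simp: \<theta>s_def \<theta>_def)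
    finally show ?thesis using t(2)[of j] by simp
  qed
  \<comment> \<open>More than half of the vertices are light, and the promise gives each of them
    weight at least \<delta> divided by the number of vertices; this is the origin of \<delta> /
    2.\<close>
  have light: "\<delta> / 2 \<le> measure (D (t j)) {v \<in> V j. pmf (D (t j)) v < \<theta>s j}" for j
  proof -
    let ?L = "{v \<in> V j. pmf (D (t j)) v < \<theta>s j}" and ?H = "{v \<in> V j. \<theta>s j \<le> pmf (D (t j)) v}"
    have "card (V j) = card ?L + card ?H"
      using finV[of j] by (subst card_Un_disjoint[symmetric]) (auto intro!: arg_cong[where f = card])
    moreover have "card ?H \<le> Suc (i0 + j)"
      using card_heavy_le[OF finV[of j], of "\<theta>s j" "D (t j)"] by (simp add: \<theta>s_def divide_le_eq)
    ultimately have "real (card (V j)) \<le> 2 * real (card ?L)" using t(3)[of j] by (simp add: V_def)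
    then have "\<delta> / 2 \<le> real (card ?L) * (\<delta> / real (card (V j)))"
      using delta card_pos[of "t j"] by (simp add: V_def divide_le_eq le_divide_eq algebra_simps)
    also have "\<dots> = (\<Sum>v\<in>?L. \<delta> / real (card (V j)))" by simp
    also have "\<dots> \<le> (\<Sum>v\<in>?L. pmf (D (t j)) v)" using low by (intro sum_mono) (auto simp: V_def)
    also have "\<dots> = measure (D (t j)) ?L" using finV[of j] by (simp add: measure_measure_pmf_finite)
    finally show ?thesis .
  qed
  have "\<exists>h. bij_betw h {..<card (Hv j)} (Hv j)" for j
    using ex_bij_betw_nat_finite[OF finHv] by (simp add: atLeast0LessThan)
  then obtain h where h: "\<And>j. bij_betw (h j) {..<card (Hv j)} (Hv j)" by metis
  \<comment> \<open>There are at most \<open>Suc i0\<close> heavy vertices, so their number and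
    their labelled graph take finitely many values; one pair of values recurs infinitely often and
    becomes \<open>R\<close> and \<open>A\<close>.\<close>
  define code where "code j = (card (Hv j), {(r, r'). r < card (Hv j) \<and> r' < card (Hv j) \<and>
      {h j r, h j r'} \<in> edges (G (t j))})" for j
  have Hv_le: "card (Hv j) \<le> Suc i0" for j
    using card_heavy_le[OF finV[of j], of \<theta> "D (t j)"] by (simp add: Hv_def \<theta>_def divide_le_eq)
  have "code j \<in> {..Suc i0} \<times> Pow ({..<Suc i0} \<times> {..<Suc i0})" for j
    unfolding code_def using Hv_le[of j] by auto
  then have "range code \<subseteq> {..Suc i0} \<times> Pow ({..<Suc i0} \<times> {..<Suc i0})" by blast
  then have "finite (range code)" by (rule finite_subset) simp
  then obtain j0 where "infinite {j \<in> UNIV. code j = code j0}"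
    using pigeonhole_infinite[of "UNIV :: nat set" code] by auto
  then obtain r :: "nat \<Rightarrow> nat" where r: "strict_mono r" "\<And>n. code (r n) = code j0"
    using infinite_enumerate[of "{j. code j = code j0}"] by auto
  define R where "R = fst (code j0)"
  define A where "A = snd (code j0)"
  have R: "card (Hv (r n)) = R" for n using r(2)[of n] by (simp add: R_def code_def)
  have A: "{h (r n) a, h (r n) b} \<in> edges (G (t (r n))) \<longleftrightarrow> (a, b) \<in> A" if "a < R" "b < R" for n a b
  proof -
    have "A = {(a, b). a < card (Hv (r n)) \<and> b < card (Hv (r n)) \<and> {h (r n) a, h (r n) b} \<in> edges (G (t (r n)))}"
    proof -
      have "A = snd (code (r n))" by (simp only: A_def r(2))
      then show ?thesis by (simp only: code_def snd_conv)
    qed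
    then show ?thesis using that R[of n] by simp
  qed
  interpret bad_sequence P \<epsilon> \<delta> \<theta> R A "\<lambda>n. G (t (r n))" "\<lambda>n. D (t (r n))" "\<lambda>n. h (r n)" "\<lambda>n. \<theta>s (r n)"
  proof
    show "(\<lambda>n. \<theta>s (r n)) \<longlonglongrightarrow> 0" using LIMSEQ_subseq_LIMSEQ[OF \<theta>s_lim r(1)] by (simp add: o_def)
    show "(\<lambda>n. violation P (G (t (r n))) (D (t (r n))) k) \<longlonglongrightarrow> 0" if "k > 0" for k
      using filterlim_compose[OF viol[OF that] filterlim_compose[OF t_lim filterlim_subseq[OF r(1)]]] .
    show "bij_betw (h (r n)) {..<R} {v \<in> verts (G (t (r n))). \<theta> \<le> pmf (D (t (r n))) v}" for n
      using h[of "r n"] unfolding R by (simp add: Hv_def V_def)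
    show "0 < pmf (D (t (r n))) v" if "v \<in> verts (G (t (r n)))" for n v
      using low[OF that] delta card_pos[of "t (r n)"] by (meson divide_pos_pos less_le_trans of_nat_0_less_iff)
  qed (use gp eps delta \<theta>s_le wg far junk light A in \<open>auto simp: \<theta>_def V_def\<close>)
  show False by (rule contradiction)
qed

theorem theorem9:
  fixes P :: "'a graph set"
  assumes "graph_property P" and "hereditary P"
  shows "\<exists>t :: real \<Rightarrow> real \<Rightarrow> nat. \<forall>\<epsilon>\<in>{0<..<1}. \<forall>\<delta>\<in>{0<..<1}.
    vdf_testable \<epsilon> P
      (\<lambda>G D. (MIN v\<in>verts G. pmf D v) \<ge> \<delta> / real (card (verts G))) (t \<epsilon> \<delta>)"
proof -
  have "\<exists>s. vdf_testable \<epsilon> P (\<lambda>G D. (MIN v\<in>verts G. pmf D v) \<ge> \<delta> / real (card (verts G))) s"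
    if "\<epsilon> \<in> {0<..<1}" "\<delta> \<in> {0<..<1}" for \<epsilon> \<delta> :: real
  proof -
    obtain s where "s > 0" "\<And>G D. weighted_graph G D \<Longrightarrow>
        \<delta> / real (card (verts G)) \<le> (MIN v\<in>verts G. pmf D v) \<Longrightarrow> far_from \<epsilon> P G D \<Longrightarrow>
        2 / 3 \<le> violation P G D s"
      using exists_violation_bound[OF assms, of \<epsilon> \<delta>] \<open>\<epsilon> \<in> {0<..<1}\<close> \<open>\<delta> \<in> {0<..<1}\<close> by auto
    then show ?thesis by (intro exI[of _ s] vdf_testableI[OF assms]) simp_all
  qed
  \<comment> \<open>With the range conditions moved below the existential quantifier,
    \<open>t\<close> can be chosen as a total function; its values outside (0,1) are
    arbitrary.\<close>
  then have "\<forall>\<epsilon> \<delta>. \<exists>s. \<epsilon> \<in> {0<..<1} \<longrightarrow> \<delta> \<in> {0<..<1} \<longrightarrow>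
    vdf_testable \<epsilon> P (\<lambda>G D. (MIN v\<in>verts G. pmf D v) \<ge> \<delta> / real (card (verts G))) s" by blast
  then show ?thesis unfolding choice_iff by blast
qed

end
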